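(* Let $\mathbf A(\omega)$ be a measurable (random) skew symmetric transformation on $H$ transforming $\mathbb D_{2,1}(H)$ into $\mathbb D_{2,1}(H)$. Let $\{e_j\}_{j\ge1}$ be a smooth orthonormal basis of $H$. Assume that, for $j=1,2,\ldots$, $f^j(t,\omega)\in\mathbb D_{p,2}$, $\nabla f^j\in W^*$, and $f^j$ solves, for all $t$, the equation $$\frac{df(t,\omega)}{dt}=\delta\left(\mathbf A(\omega)\nabla f(t,\omega)\right)\qquad(\ast)$$ with the initial condition $f^j(0,\omega)=\langle e_j,\omega\rangle$. Then: (a) $\sum_{j=1}^n\beta_jf^j(t+\tau_j,\omega)$ solves $(\ast)$ under the initial condition $\sum_{j=1}^n\beta_jf^j(\tau_j,\omega)$, for any $\beta_j,\tau_j$. (b) Let $\psi^n(t,\omega)=\exp\left(\mathrm i\sum_{j=1}^nf^j(t+\tau_j,\omega)\right)$. Then $\psi^n(t,\omega)$ solves $(\ast)$ under the initial condition $\psi^n(0,\omega)=\exp\left(\mathrm i\sum_{j=1}^nf^j(\tau_j,\omega)\right)$. (c) $T_t\omega$ defined by $T_t\omega=\sum_{j=1}^\infty f^j(t,\omega)\,e_j$ is a stationary process. (d) If, moreover, $(\ast)$ possesses a unique solution for every initial condition $f_0(\omega)\in\mathbb D_{p,2}$, then $T_s(T_t\omega)=T_{s+t}\omega$.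
   Context: $(W,H,\mu)$ is an infinite dimensional abstract Wiener space: $W$ is a separable Banach space, $H$ a Hilbert space densely and continuously embedded in $W$, and $\mu$ the Gaussian measure on $W$ under which each $l\in W^*$ is an $N(0,|l|_H^2)$ random variable; $W^*\subset H\subset W$ through the canonical embeddings. $\{\delta h,\ h\in H\}$ is the zero-mean Gaussian field with $E[\delta h\,\delta k]=(h,k)_H$. An orthonormal basis $\{e_i\}$ of $H$ is smooth if $e_i\in W^*$ for all $i$. $\mathbb D_{p,k}$ and $\mathbb D_{p,k}(H)$ are the classical (Malliavin calculus) Sobolev spaces of real valued and $H$-valued random variables, with $\nabla:\mathbb D_{p,k}\to\mathbb D_{p,k-1}(H)$ the gradient and $\delta:\mathbb D_{p,k}(H)\to\mathbb D_{p,k-1}$ the divergence (characterized by $E(v,\nabla\Phi)_H=E[\Phi\,\delta v]$); $\nabla$ and $\delta$ act on complex valued functionals by linearity. Smooth functionals are those of the form $\varphi(\delta l_1,\ldots,\delta l_n)$ with $n\in\mathbb N$, $l_i\in W^*$, $\varphi\in C_b^\infty(\mathbb R^n)$. Stationary process: measure preserving transformations $T_t$, $t\in\mathbb R$, of $(W,\mu)$ with $T_0\omega=\omega$ form a stationary process if for any $n$, any $t_1,\ldots,t_n$, any smooth $\varphi_1,\ldots,\varphi_n$ and any $\tau$, the random vectors $(\varphi_1(T_{t_1}\omega),\ldots,\varphi_n(T_{t_n}\omega))$ and $(\varphi_1(T_{t_1+\tau}\omega),\ldots,\varphi_n(T_{t_n+\tau}\omega))$ have the same law. *)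

theory Defs
  imports "HOL-Probability.Probability"
begin

section \<open>Abstract Wiener space\<close>

text \<open>
  \<open>\<iota>\<close> is the embedding of \<open>H\<close> (type \<open>'h\<close>) into \<open>W\<close> (type \<open>'w\<close>), and \<open>W\<^sup>*\<close> is the type
  \<open>'w \<Rightarrow>\<^sub>L real\<close>.  \<open>dual_embed \<iota>\<close> is the canonical map \<open>W\<^sup>* \<rightarrow> H\<close>, sending \<open>l\<close> to the Riesz
  representative of \<open>l \<circ> \<iota>\<close>; it is injective because \<open>\<iota>\<close> has dense range.
\<close>

definition dual_embed :: "('h::{real_inner,banach} \<Rightarrow> 'w::real_normed_vector) \<Rightarrow> ('w \<Rightarrow>\<^sub>L real) \<Rightarrow> 'h" where
  "dual_embed \<iota> l = (THE h. \<forall>k. inner h k = blinfun_apply l (\<iota> k))"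

text \<open>\<open>\<langle>h, \<omega>\<rangle>\<close> for \<open>h\<close> in the image of \<open>W\<^sup>*\<close>.\<close>

definition wpairing :: "('h::{real_inner,banach} \<Rightarrow> 'w::real_normed_vector) \<Rightarrow> 'h \<Rightarrow> 'w \<Rightarrow> real" where
  "wpairing \<iota> h \<omega> = blinfun_apply (inv (dual_embed \<iota>) h) \<omega>"

text \<open>
  A Hilbert space embedded densely in this way is automatically separable, so the class
  \<open>second_countable_topology\<close> on \<open>'h\<close> is no restriction.  If \<open>dual_embed \<iota> l = 0\<close> then \<open>l = 0\<close>, and
  the (degenerate) law of \<open>l\<close> needs no assumption.
\<close>

locale abstract_wiener_space = prob_space \<mu>
  for \<mu> :: "'w::{banach,second_countable_topology} measure" +
  fixes \<iota> :: "'h::{real_inner,banach,second_countable_topology} \<Rightarrow> 'w"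
  assumes bounded_linear_embedding: "bounded_linear \<iota>"
    and inj_embedding: "inj \<iota>"
    and dense_embedding: "closure (range \<iota>) = UNIV"
    and infinite_dimensional: "\<nexists>B :: 'h set. finite B \<and> span B = UNIV"
    and sets_borel: "sets \<mu> = sets borel"
    and gaussian: "\<And>l. dual_embed \<iota> l \<noteq> 0 \<Longrightarrow>
      distributed \<mu> lborel (blinfun_apply l) (normal_density 0 (norm (dual_embed \<iota> l)))"

definition orthonormal_set :: "'h::real_inner set \<Rightarrow> bool" where
  "orthonormal_set S \<longleftrightarrow> pairwise orthogonal S \<and> (\<forall>x\<in>S. norm x = 1)"

definition smooth_orthonormal_basis ::
  "('h::{real_inner,banach} \<Rightarrow> 'w::real_normed_vector) \<Rightarrow> (nat \<Rightarrow> 'h) \<Rightarrow> bool" where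
  "smooth_orthonormal_basis \<iota> e \<longleftrightarrow>
     inj e \<and> orthonormal_set (range e) \<and> closure (span (range e)) = UNIV \<and>
     (\<forall>j. e j \<in> range (dual_embed \<iota>))"


section \<open>Smooth functionals\<close>

text \<open>
  Points of \<open>\<real>\<^sup>n\<close> are functions \<open>nat \<Rightarrow> real\<close> of which only the coordinates below \<open>n\<close> matter.
\<close>

definition partial_deriv :: "nat \<Rightarrow> ((nat \<Rightarrow> real) \<Rightarrow> real) \<Rightarrow> (nat \<Rightarrow> real) \<Rightarrow> real" where
  "partial_deriv k \<phi> x = deriv (\<lambda>s. \<phi> (x(k := s))) (x k)"

definition Cb_infinity :: "nat \<Rightarrow> ((nat \<Rightarrow> real) \<Rightarrow> real) set" where
  "Cb_infinity n = {\<phi>.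
     (\<forall>x y. (\<forall>k<n. x k = y k) \<longrightarrow> \<phi> x = \<phi> y) \<and>
     (\<forall>ks. set ks \<subseteq> {..<n} \<longrightarrow>
        (let \<phi>' = foldr partial_deriv ks \<phi> in
           bounded (range \<phi>') \<and> continuous_on UNIV \<phi>' \<and>
           (\<forall>k<n. \<forall>x. (\<lambda>s. \<phi>' (x(k := s))) differentiable (at (x k)))))}"

text \<open>
  \<open>\<delta>l(\<omega>) = \<langle>l, \<omega>\<rangle>\<close> for \<open>l \<in> W\<^sup>*\<close>.
\<close>

definition smooth_functionals :: "('w::real_normed_vector \<Rightarrow> real) set" where
  "smooth_functionals = {F. \<exists>n \<phi> (l :: nat \<Rightarrow> 'w \<Rightarrow>\<^sub>L real). \<phi> \<in> Cb_infinity n \<and>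
     F = (\<lambda>\<omega>. \<phi> (\<lambda>k. blinfun_apply (l k) \<omega>))}"

text \<open>
  Smooth functionals with values in a Hilbert space; for \<open>'e = real\<close> this is again the set
  \<open>smooth_functionals\<close>.
\<close>

definition smooth_vector_functionals :: "('w::real_normed_vector \<Rightarrow> 'e::real_normed_vector) set" where
  "smooth_vector_functionals = {u. \<exists>(m::nat) F v. (\<forall>k<m. F k \<in> smooth_functionals) \<and>
     u = (\<lambda>\<omega>. \<Sum>k<m. F k \<omega> *\<^sub>R v k)}"


section \<open>Sobolev spaces, gradient and divergence\<close>

text \<open>
  The \<open>k\<close>-th gradient of a smooth functional at \<open>\<omega>\<close> is represented by the multilinear form
  \<open>(h\<^sub>1,\<dots>,h\<^sub>k) \<mapsto> D\<^bsub>h\<^sub>1\<^esub> \<cdots> D\<^bsub>h\<^sub>k\<^esub> u(\<omega>)\<close> on \<open>H\<close>, its arguments being collected in a list.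
\<close>

definition dir_deriv :: "('h \<Rightarrow> 'w::real_normed_vector) \<Rightarrow> 'h \<Rightarrow> ('w \<Rightarrow> 'e::real_normed_vector) \<Rightarrow> 'w \<Rightarrow> 'e" where
  "dir_deriv \<iota> h u \<omega> = vector_derivative (\<lambda>s. u (\<omega> + s *\<^sub>R \<iota> h)) (at 0)"

definition iterated_gradient ::
  "('h \<Rightarrow> 'w::real_normed_vector) \<Rightarrow> ('w \<Rightarrow> 'e::real_normed_vector) \<Rightarrow> 'w \<Rightarrow> 'h list \<Rightarrow> 'e" where
  "iterated_gradient \<iota> u \<omega> hs = foldr (dir_deriv \<iota>) hs u \<omega>"

text \<open>
  Hilbert-Schmidt norm of a \<open>j\<close>-linear form, i.e. its norm in \<open>H\<^sup>\<otimes>\<^sup>j \<otimes> E\<close>.  The sum over all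
  \<open>j\<close>-tuples from an orthonormal basis is the supremum of the sums over \<open>j\<close>-tuples from finite
  orthonormal sets.  Only used for gradients of smooth functionals, where the supremum is finite.
\<close>

definition hs_norm :: "nat \<Rightarrow> ('h::real_inner list \<Rightarrow> 'e::real_normed_vector) \<Rightarrow> real" where
  "hs_norm j B = sqrt (SUP S\<in>{S. finite S \<and> orthonormal_set S}.
     \<Sum>hs\<in>{hs. set hs \<subseteq> S \<and> length hs = j}. (norm (B hs))\<^sup>2)"

text \<open>\<open>p\<close>-th power of the \<open>L\<^sup>p\<close> norm.\<close>

definition Lp_power :: "'w measure \<Rightarrow> real \<Rightarrow> ('w \<Rightarrow> 'e::real_normed_vector) \<Rightarrow> ennreal" where
  "Lp_power \<mu> p u = (\<integral>\<^sup>+\<omega>. ennreal (norm (u \<omega>) powr p) \<partial>\<mu>)"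

definition Lp :: "'w measure \<Rightarrow> real \<Rightarrow> ('w \<Rightarrow> 'e::real_normed_vector) set" where
  "Lp \<mu> p = {u. u \<in> borel_measurable \<mu> \<and> Lp_power \<mu> p u < \<infinity>}"

text \<open>\<open>p\<close>-th power of the \<open>\<D>\<^bsub>p,k\<^esub>\<close> norm of a smooth functional.\<close>

definition sobolev_power ::
  "'w::real_normed_vector measure \<Rightarrow> ('h::real_inner \<Rightarrow> 'w) \<Rightarrow> real \<Rightarrow> nat \<Rightarrow> ('w \<Rightarrow> 'e::real_normed_vector) \<Rightarrow> ennreal" where
  "sobolev_power \<mu> \<iota> p k u =
     (\<Sum>j\<le>k. Lp_power \<mu> p (\<lambda>\<omega>. hs_norm j (iterated_gradient \<iota> u \<omega>)))"

text \<open>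
  \<open>\<D>\<^bsub>p,k\<^esub>\<close> (for \<open>'e = real\<close>) and \<open>\<D>\<^bsub>p,k\<^esub>(H)\<close> (for \<open>'e = 'h\<close>): the completion of the smooth functionals
  in the \<open>\<D>\<^bsub>p,k\<^esub>\<close> norm, realised as a space of \<open>p\<close>-integrable random variables.
\<close>

definition sobolev ::
  "'w::real_normed_vector measure \<Rightarrow> ('h::real_inner \<Rightarrow> 'w) \<Rightarrow> real \<Rightarrow> nat \<Rightarrow> ('w \<Rightarrow> 'e::real_normed_vector) set" where
  "sobolev \<mu> \<iota> p k = {u \<in> Lp \<mu> p. \<exists>v. (\<forall>n::nat. v n \<in> smooth_vector_functionals) \<and>
     (\<lambda>n. Lp_power \<mu> p (\<lambda>\<omega>. v n \<omega> - u \<omega>)) \<longlonglongrightarrow> 0 \<and>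
     (\<forall>\<epsilon>>0. \<exists>N. \<forall>m\<ge>N. \<forall>n\<ge>N. sobolev_power \<mu> \<iota> p k (\<lambda>\<omega>. v m \<omega> - v n \<omega>) < \<epsilon>)}"

definition smooth_gradient ::
  "('h::real_inner \<Rightarrow> 'w::real_normed_vector) \<Rightarrow> ('w \<Rightarrow> real) \<Rightarrow> 'w \<Rightarrow> 'h" where
  "smooth_gradient \<iota> F \<omega> = (THE g. \<forall>h. inner g h = dir_deriv \<iota> h F \<omega>)"

text \<open>
  \<open>\<nabla>F = G\<close> in \<open>\<D>\<^bsub>p,1\<^esub>\<close>, the closure in \<open>L\<^sup>p\<close> of the gradient on smooth functionals.  Since this
  operator is closable, \<open>G\<close> is determined by \<open>F\<close> up to null sets.
\<close>

definition has_gradient ::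
  "'w::real_normed_vector measure \<Rightarrow> ('h::real_inner \<Rightarrow> 'w) \<Rightarrow> real \<Rightarrow> ('w \<Rightarrow> real) \<Rightarrow> ('w \<Rightarrow> 'h) \<Rightarrow> bool" where
  "has_gradient \<mu> \<iota> p F G \<longleftrightarrow> F \<in> Lp \<mu> p \<and> G \<in> Lp \<mu> p \<and>
     (\<exists>\<Phi>. (\<forall>n::nat. \<Phi> n \<in> smooth_functionals) \<and>
        (\<lambda>n. Lp_power \<mu> p (\<lambda>\<omega>. \<Phi> n \<omega> - F \<omega>)) \<longlonglongrightarrow> 0 \<and>
        (\<lambda>n. Lp_power \<mu> p (\<lambda>\<omega>. smooth_gradient \<iota> (\<Phi> n) \<omega> - G \<omega>)) \<longlonglongrightarrow> 0)"

text \<open>\<open>\<delta>v = D\<close>.  Again \<open>D\<close> is determined by \<open>v\<close> up to null sets.\<close>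

definition has_divergence ::
  "'w::real_normed_vector measure \<Rightarrow> ('h::real_inner \<Rightarrow> 'w) \<Rightarrow> real \<Rightarrow> ('w \<Rightarrow> 'h) \<Rightarrow> ('w \<Rightarrow> real) \<Rightarrow> bool" where
  "has_divergence \<mu> \<iota> p v D \<longleftrightarrow> v \<in> Lp \<mu> p \<and> D \<in> Lp \<mu> p \<and>
     (\<forall>\<Phi>\<in>smooth_functionals.
        (\<integral>\<omega>. inner (v \<omega>) (smooth_gradient \<iota> \<Phi> \<omega>) \<partial>\<mu>) = (\<integral>\<omega>. \<Phi> \<omega> * D \<omega> \<partial>\<mu>))"


section \<open>The equation\<close>

text \<open>
  Everywhere defined skew symmetric linear maps on a Hilbert space are automatically bounded.
\<close>

definition random_skew_transformation ::
  "'w measure \<Rightarrow> ('w \<Rightarrow> 'h::real_inner \<Rightarrow> 'h) \<Rightarrow> bool" where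
  "random_skew_transformation \<mu> A \<longleftrightarrow>
     (\<forall>h. (\<lambda>\<omega>. A \<omega> h) \<in> borel_measurable \<mu>) \<and>
     (\<forall>\<omega>. linear (A \<omega>) \<and> (\<forall>h k. inner (A \<omega> h) k = - inner h (A \<omega> k)))"

text \<open>
  \<open>df/dt = \<delta>(A\<nabla>f)\<close> for all \<open>t\<close>, and \<open>f(0) = f0\<close> almost surely.  The time derivative is taken in
  \<open>L\<^sup>2(\<mu>)\<close>; \<open>\<nabla>\<close> and \<open>\<delta>\<close> are the \<open>L\<^sup>2\<close> operators.
\<close>

definition solves ::
  "'w::real_normed_vector measure \<Rightarrow> ('h::real_inner \<Rightarrow> 'w) \<Rightarrow> ('w \<Rightarrow> 'h \<Rightarrow> 'h) \<Rightarrow>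
   (real \<Rightarrow> 'w \<Rightarrow> real) \<Rightarrow> ('w \<Rightarrow> real) \<Rightarrow> bool" where
  "solves \<mu> \<iota> A f f0 \<longleftrightarrow> (AE \<omega> in \<mu>. f 0 \<omega> = f0 \<omega>) \<and>
     (\<forall>t. \<exists>G D. has_gradient \<mu> \<iota> 2 (f t) G \<and> has_divergence \<mu> \<iota> 2 (\<lambda>\<omega>. A \<omega> (G \<omega>)) D \<and>
        ((\<lambda>s. Lp_power \<mu> 2 (\<lambda>\<omega>. (f (t + s) \<omega> - f t \<omega>) / s - D \<omega>)) \<longlongrightarrow> 0) (at 0))"

text \<open>\<open>\<nabla>\<close> and \<open>\<delta>\<close> act on complex valued functionals by linearity.\<close>

definition solves_complex ::
  "'w::real_normed_vector measure \<Rightarrow> ('h::real_inner \<Rightarrow> 'w) \<Rightarrow> ('w \<Rightarrow> 'h \<Rightarrow> 'h) \<Rightarrow>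
   (real \<Rightarrow> 'w \<Rightarrow> complex) \<Rightarrow> ('w \<Rightarrow> complex) \<Rightarrow> bool" where
  "solves_complex \<mu> \<iota> A f f0 \<longleftrightarrow>
     solves \<mu> \<iota> A (\<lambda>t \<omega>. Re (f t \<omega>)) (\<lambda>\<omega>. Re (f0 \<omega>)) \<and>
     solves \<mu> \<iota> A (\<lambda>t \<omega>. Im (f t \<omega>)) (\<lambda>\<omega>. Im (f0 \<omega>))"

definition uniquely_solvable ::
  "'w::real_normed_vector measure \<Rightarrow> ('h::real_inner \<Rightarrow> 'w) \<Rightarrow> real \<Rightarrow> ('w \<Rightarrow> 'h \<Rightarrow> 'h) \<Rightarrow> bool" where
  "uniquely_solvable \<mu> \<iota> p A \<longleftrightarrow> (\<forall>f0 \<in> sobolev \<mu> \<iota> p 2.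
     (\<exists>f. solves \<mu> \<iota> A f f0) \<and>
     (\<forall>f g. solves \<mu> \<iota> A f f0 \<longrightarrow> solves \<mu> \<iota> A g f0 \<longrightarrow> (\<forall>t. AE \<omega> in \<mu>. f t \<omega> = g t \<omega>)))"


section \<open>Stationary processes\<close>

text \<open>
  As usual for transformations of a measure space, \<open>T\<^sub>0\<omega> = \<omega>\<close> is required for almost every \<open>\<omega>\<close>.
\<close>

definition stationary_process ::
  "'w::real_normed_vector measure \<Rightarrow> (real \<Rightarrow> 'w \<Rightarrow> 'w) \<Rightarrow> bool" where
  "stationary_process \<mu> T \<longleftrightarrow>
     (\<forall>t. T t \<in> measurable \<mu> \<mu> \<and> distr \<mu> \<mu> (T t) = \<mu>) \<and>
     (AE \<omega> in \<mu>. T 0 \<omega> = \<omega>) \<and>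
     (\<forall>(n::nat) t \<phi> \<tau>. (\<forall>k<n. \<phi> k \<in> smooth_functionals) \<longrightarrow>
        distr \<mu> (Pi\<^sub>M {..<n} (\<lambda>_. borel)) (\<lambda>\<omega>. \<lambda>k\<in>{..<n}. \<phi> k (T (t k) \<omega>)) =
        distr \<mu> (Pi\<^sub>M {..<n} (\<lambda>_. borel)) (\<lambda>\<omega>. \<lambda>k\<in>{..<n}. \<phi> k (T (t k + \<tau>) \<omega>)))"

end

theory Submission
  imports Defs
begin

text \<open>
  Write \<open>L F = \<delta>(A\<nabla>F)\<close>.  The equation \<open>df/dt = L f\<close> is linear and autonomous, so linear combinations of
  time shifts of solutions are solutions, which is (a).  Moreover \<open>L\<close> behaves like a first order operator: the
  product rule for the divergence gives
  \<open>L (cos F) = - sin F \<cdot> L F + cos F \<cdot> (\<nabla>F, A\<nabla>F)\<close>,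
  and the last term vanishes because \<open>A\<close> is skew symmetric (\<open>has_generator_cos\<close>).  By the chain rule in time,
  the cosine and the sine of a solution are again solutions (\<open>flow_solution_cos\<close>, \<open>flow_solution_sin\<close>), which
  is (b).

  Since a divergence has mean zero, the expectation of a solution does not depend on time.  For the cosine and
  the sine of a linear combination of the \<open>f\<^sup>j(s + \<tau>)\<close> this says that its characteristic function does not depend
  on \<open>\<tau>\<close>; by the uniqueness theorem for joint characteristic functions (\<open>joint_law_eqI\<close>) the law of the whole family
  \<open>(f\<^sup>j(s + \<tau>))\<close>, indexed by all \<open>j\<close> and \<open>s\<close>, does not depend on \<open>\<tau>\<close> (\<open>trajectory_law\<close>).  Hence every
  measurable relation between members of the family that holds almost surely for \<open>\<tau> = 0\<close> does so for all \<open>\<tau>\<close>, and (c) and (d) are read off at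
  time \<open>0\<close>, where \<open>f\<^sup>j(0, \<omega>) = \<langle>e\<^sub>j, \<omega>\<rangle>\<close>:
  the series \<open>\<Sum>\<^sub>j f\<^sup>j(0) e\<^sub>j\<close> converges almost surely to \<open>\<omega>\<close>, so \<open>\<Sum>\<^sub>j f\<^sup>j(t) e\<^sub>j\<close> converges almost surely and
  has law \<open>\<mu>\<close>; and the almost sure identity \<open>f\<^sup>j(s, T\<^sub>0 \<omega>) = f\<^sup>j(s, \<omega>)\<close>, a relation between members
  of the family, becomes \<open>f\<^sup>j(s, T\<^sub>t \<omega>) = f\<^sup>j(s + t, \<omega>)\<close>.

  What remains is the convergence \<open>\<Sum>\<^sub>j \<langle>e\<^sub>j, \<omega>\<rangle> e\<^sub>j = \<omega>\<close> in the norm of \<open>W\<close> (\<open>partial_expansion_tendsto\<close>), a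
  case of the Ito-Nisio theorem.  With \<open>S\<^sub>n\<close> the partial sums, the reflection \<open>2 S\<^sub>n - id\<close> preserves the law
  of every \<open>l \<in> W\<^sup>*\<close>, hence preserves \<open>\<mu>\<close>, because these laws determine a Borel probability on a separable Banach
  space (\<open>borel_measure_eqI_dual\<close>).  As \<open>\<omega> - S\<^sub>n\<close> is half the difference of \<open>\<omega>\<close> and its reflection, the
  remainders are tight, and since they tend to \<open>0\<close> under every \<open>l\<close> they tend to \<open>0\<close> in probability.  Since
  \<open>S\<^sub>n\<close> is half the sum of \<open>\<omega>\<close> and its reflection, Levy's maximal inequality holds and gives almost sure
  convergence.  The invariance of \<open>\<mu>\<close> and the convergence in probability rest on the Hahn-Banach theorem: \<open>W\<^sup>*\<close>
  separates the points of \<open>W\<close>.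
\<close>

section \<open>Continuous functionals separate points\<close>

definition sublinear :: "('a::real_vector \<Rightarrow> real) \<Rightarrow> bool" where
  "sublinear q \<longleftrightarrow> (\<forall>x y. q (x + y) \<le> q x + q y) \<and> (\<forall>c>0. \<forall>x. q (c *\<^sub>R x) \<le> c * q x)"

lemma sublinear_homogeneous:
  assumes "sublinear q" and "c > 0"
  shows "q (c *\<^sub>R x) = c * q x"
proof (rule antisym)
  show "q (c *\<^sub>R x) \<le> c * q x"
    using assms by (simp add: sublinear_def)
  have "q (inverse c *\<^sub>R (c *\<^sub>R x)) \<le> inverse c * q (c *\<^sub>R x)"
    using assms by (simp add: sublinear_def del: scaleR_scaleR)
  then show "c * q x \<le> q (c *\<^sub>R x)"
    using \<open>c > 0\<close> by (simp add: field_simps)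
qed

lemma sublinear_zero:
  assumes "sublinear q"
  shows "q 0 = 0"
  using sublinear_homogeneous[OF assms, of 2 0] by simp

lemma sublinear_ge_neg:
  assumes "sublinear q"
  shows "- q (- x) \<le> q x"
  using assms sublinear_zero[OF assms] unfolding sublinear_def
  by (smt (verit) add.right_inverse)

text \<open>
  The largest sublinear functional below \<open>q\<close> that is at most \<open>- q y\<close> at \<open>- y\<close>.
\<close>
definition lower_along :: "('a::real_vector \<Rightarrow> real) \<Rightarrow> 'a \<Rightarrow> 'a \<Rightarrow> real" where
  "lower_along q y x = (INF t\<in>{0..}. q (x + t *\<^sub>R y) - t * q y)"

lemma lower_along_le:
  assumes q: "sublinear q" and "t \<ge> 0"
  shows "lower_along q y x \<le> q (x + t *\<^sub>R y) - t * q y"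
  unfolding lower_along_def
proof (rule cINF_lower)
  show "bdd_below ((\<lambda>t. q (x + t *\<^sub>R y) - t * q y) ` {0..})"
  proof (rule bdd_belowI2)
    fix t :: real assume "t \<in> {0..}"
    have "q (t *\<^sub>R y) = t * q y"
      using sublinear_homogeneous[OF q, of t y] sublinear_zero[OF q] \<open>t \<in> {0..}\<close>
      by (cases "t = 0") auto
    moreover have "q ((x + t *\<^sub>R y) + - x) \<le> q (x + t *\<^sub>R y) + q (- x)"
      using q unfolding sublinear_def by blast
    ultimately show "- q (- x) \<le> q (x + t *\<^sub>R y) - t * q y"
      by simp
  qed
qed (use \<open>t \<ge> 0\<close> in auto)

lemma lower_along_greatest:
  assumes "\<And>t. t \<ge> 0 \<Longrightarrow> m \<le> q (x + t *\<^sub>R y) - t * q y"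
  shows "m \<le> lower_along q y x"
  unfolding lower_along_def by (rule cINF_greatest) (use assms in auto)

lemma sublinear_lower_along:
  assumes q: "sublinear q"
  shows "sublinear (lower_along q y)"
  unfolding sublinear_def
proof (intro conjI allI impI)
  fix x x' :: 'a
  have *: "lower_along q y (x + x') \<le> (q (x + s *\<^sub>R y) - s * q y) + (q (x' + t *\<^sub>R y) - t * q y)"
    if "s \<ge> 0" "t \<ge> 0" for s t
  proof -
    have "lower_along q y (x + x') \<le> q (x + x' + (s + t) *\<^sub>R y) - (s + t) * q y"
      using lower_along_le[OF q] that by simp
    also have "q (x + x' + (s + t) *\<^sub>R y) = q ((x + s *\<^sub>R y) + (x' + t *\<^sub>R y))"
      by (simp add: algebra_simps)
    also have "\<dots> \<le> q (x + s *\<^sub>R y) + q (x' + t *\<^sub>R y)"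
      using q unfolding sublinear_def by blast
    finally show ?thesis by (simp add: algebra_simps)
  qed
  have "lower_along q y (x + x') - (q (x + s *\<^sub>R y) - s * q y) \<le> lower_along q y x'" if "s \<ge> 0" for s
    by (rule lower_along_greatest) (use *[OF that] in \<open>simp add: algebra_simps\<close>)
  then have "lower_along q y (x + x') - lower_along q y x' \<le> lower_along q y x"
    by (intro lower_along_greatest) (simp add: algebra_simps)
  then show "lower_along q y (x + x') \<le> lower_along q y x + lower_along q y x'"
    by simp
next
  fix c :: real and x assume "c > 0"
  have "lower_along q y (c *\<^sub>R x) / c \<le> lower_along q y x"
  proof (rule lower_along_greatest)
    fix t :: real assume "t \<ge> 0"
    have "lower_along q y (c *\<^sub>R x) \<le> q (c *\<^sub>R x + (c * t) *\<^sub>R y) - (c * t) * q y"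
      using \<open>c > 0\<close> \<open>t \<ge> 0\<close> by (intro lower_along_le[OF q]) simp
    also have "q (c *\<^sub>R x + (c * t) *\<^sub>R y) = c * q (x + t *\<^sub>R y)"
      using sublinear_homogeneous[OF q \<open>c > 0\<close>, of "x + t *\<^sub>R y"] by (simp add: algebra_simps)
    finally show "lower_along q y (c *\<^sub>R x) / c \<le> q (x + t *\<^sub>R y) - t * q y"
      using \<open>c > 0\<close> by (simp add: field_simps)
  qed
  then show "lower_along q y (c *\<^sub>R x) \<le> c * lower_along q y x"
    using \<open>c > 0\<close> by (simp add: field_simps)
qed

text \<open>
  Minimality forces \<open>lower_along q y = q\<close> for every \<open>y\<close>, and the parameter \<open>t = 1\<close> in the infimum then
  yields \<open>q x + q y \<le> q (x + y)\<close>.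
\<close>
lemma linear_minimal_sublinear:
  assumes q: "sublinear q" and min: "\<And>r. sublinear r \<Longrightarrow> r \<le> q \<Longrightarrow> r = q"
  shows "linear q"
proof -
  have eq: "lower_along q y = q" for y
    using lower_along_le[OF q, of 0 y] by (intro min sublinear_lower_along q) (simp add: le_fun_def)
  have add: "q (x + y) = q x + q y" for x y
    using lower_along_le[OF q, of 1 y x] q unfolding eq sublinear_def
    by (intro antisym) auto
  have neg: "q (- x) = - q x" for x
    using add[of x "- x"] sublinear_zero[OF q] by simp
  have "q (c *\<^sub>R x) = c * q x" for c x
  proof (cases c "0::real" rule: linorder_cases)
    case less
    then show ?thesis
      using sublinear_homogeneous[OF q, of "- c" x] neg[of "c *\<^sub>R x"] by simp
  qed (use sublinear_homogeneous[OF q] sublinear_zero[OF q] in auto)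
  then show ?thesis
    by (intro linearI) (simp_all add: add)
qed

text \<open>
  The Hahn-Banach theorem in the form given by Zorn's lemma: a chain of sublinear functionals below \<open>q\<close> has
  its pointwise infimum as a lower bound, finite because \<open>r x \<ge> - r (- x) \<ge> - q (- x)\<close>.
\<close>
lemma linear_below_sublinear:
  fixes q :: "'a::real_vector \<Rightarrow> real"
  assumes q: "sublinear q"
  shows "\<exists>l. linear l \<and> l \<le> q"
proof -
  define Q where "Q = {r. sublinear r \<and> r \<le> q}"
  have "\<exists>l\<in>Q. \<forall>r\<in>Q. r \<le> l \<longrightarrow> r = l"
  proof (rule predicate_Zorn)
    show "partial_order_on Q (relation_of (\<lambda>a b. b \<le> a) Q)"
      by (rule partial_order_on_relation_ofI) auto
    fix C assume "C \<in> Chains (relation_of (\<lambda>a b. b \<le> a) Q)"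
    then have sub: "C \<subseteq> Q" and chain: "\<And>a b. a \<in> C \<Longrightarrow> b \<in> C \<Longrightarrow> a \<le> b \<or> b \<le> a"
      unfolding Chains_def relation_of_def by auto
    show "\<exists>u\<in>Q. \<forall>a\<in>C. u \<le> a"
    proof (cases "C = {}")
      case True
      then show ?thesis using q by (auto simp: Q_def)
    next
      case False
      define u where "u x = (INF r\<in>C. r x)" for x
      have bdd: "bdd_below ((\<lambda>r. r x) ` C)" for x
      proof (rule bdd_belowI2)
        fix r assume "r \<in> C"
        then have "sublinear r" "r (- x) \<le> q (- x)"
          using sub by (auto simp: Q_def le_fun_def)
        then show "- q (- x) \<le> r x"
          using sublinear_ge_neg[of r x] by simp
      qed
      have u_le: "u x \<le> r x" if "r \<in> C" for r x
        unfolding u_def by (rule cINF_lower[OF bdd that])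
      have u_ge: "m \<le> u x" if "\<And>r. r \<in> C \<Longrightarrow> m \<le> r x" for m x
        unfolding u_def by (rule cINF_greatest[OF False that])
      have "sublinear u"
        unfolding sublinear_def
      proof (intro conjI allI impI)
        fix x y
        have *: "u (x + y) \<le> r x + s y" if "r \<in> C" "s \<in> C" for r s
        proof -
          obtain w where w: "w \<in> C" "w \<le> r" "w \<le> s"
            using chain[OF \<open>r \<in> C\<close> \<open>s \<in> C\<close>] \<open>r \<in> C\<close> \<open>s \<in> C\<close> that[of r] that[of s] by (elim disjE) simp_all
          have "u (x + y) \<le> w (x + y)" by (rule u_le[OF w(1)])
          also have "\<dots> \<le> w x + w y"
            using w(1) sub unfolding Q_def sublinear_def by blast
          also have "\<dots> \<le> r x + s y"
            using w by (intro add_mono) (simp_all add: le_fun_def)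
          finally show ?thesis .
        qed
        have "u (x + y) - r x \<le> u y" if "r \<in> C" for r
          by (rule u_ge) (use *[OF that] in \<open>simp add: algebra_simps\<close>)
        then have "u (x + y) - u y \<le> u x"
          by (intro u_ge) (simp add: algebra_simps)
        then show "u (x + y) \<le> u x + u y" by simp
      next
        fix c :: real and x assume "c > 0"
        have "u (c *\<^sub>R x) / c \<le> u x"
        proof (rule u_ge)
          fix r assume "r \<in> C"
          then have "r (c *\<^sub>R x) \<le> c * r x"
            using sub \<open>c > 0\<close> unfolding Q_def sublinear_def by blast
          then show "u (c *\<^sub>R x) / c \<le> r x"
            using u_le[OF \<open>r \<in> C\<close>, of "c *\<^sub>R x"] \<open>c > 0\<close> by (simp add: field_simps)
        qed
        then show "u (c *\<^sub>R x) \<le> c * u x"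
          using \<open>c > 0\<close> by (simp add: field_simps)
      qed
      moreover have "u \<le> q"
      proof (rule le_funI)
        fix x
        obtain r where "r \<in> C" using False by blast
        then show "u x \<le> q x"
          using u_le[of r x] sub by (auto simp: Q_def le_fun_def intro: order_trans)
      qed
      ultimately show ?thesis
        using u_le by (auto simp: Q_def le_fun_def)
    qed
  qed
  then obtain l where l: "l \<in> Q" and min: "\<And>r. r \<in> Q \<Longrightarrow> r \<le> l \<Longrightarrow> r = l" by blast
  have "linear l"
  proof (rule linear_minimal_sublinear)
    show "sublinear l" using l by (simp add: Q_def)
    show "r = l" if "sublinear r" "r \<le> l" for r
      using that l by (intro min) (auto simp: Q_def intro: order_trans)
  qed
  then show ?thesis using l by (auto simp: Q_def)
qed

text \<open>
  A linear functional below \<open>lower_along norm x\<close> is bounded by the norm and satisfies \<open>l (- x) \<le> - norm x\<close>.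
\<close>
lemma dual_separates_points:
  fixes x :: "'a::real_normed_vector"
  assumes "x \<noteq> 0"
  obtains l :: "'a \<Rightarrow>\<^sub>L real" where "l x \<noteq> 0"
proof -
  have n: "sublinear (norm :: 'a \<Rightarrow> real)"
    by (auto simp: sublinear_def norm_triangle_ineq)
  obtain l where l: "linear l" "l \<le> lower_along norm x"
    using linear_below_sublinear[OF sublinear_lower_along[OF n]] by blast
  have le: "l y \<le> norm y" for y
    using l(2) lower_along_le[OF n, of 0 x y] by (auto simp: le_fun_def intro: order_trans)
  have "l (- x) \<le> - norm x"
    using l(2) lower_along_le[OF n, of 1 x "- x"] by (auto simp: le_fun_def intro: order_trans)
  then have "l x \<noteq> 0"
    using assms linear_neg[OF l(1), of x] by auto
  moreover have "bounded_linear l"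
  proof -
    have "norm (l y) \<le> norm y * 1" for y
      using le[of y] le[of "- y"] linear_neg[OF l(1), of y] by (auto simp: abs_le_iff)
    then show ?thesis
      unfolding bounded_linear_def bounded_linear_axioms_def using l(1) by blast
  qed
  ultimately show thesis
    using that[of "Blinfun l"] by (simp add: bounded_linear_Blinfun_apply)
qed

text \<open>
  The open sets \<open>{x. l x \<noteq> 0}\<close> cover the complement of the origin, and the Lindelof property leaves countably
  many of them.
\<close>
lemma countable_dual_family_separates_points:
  obtains l :: "nat \<Rightarrow> 'a::{real_normed_vector,second_countable_topology} \<Rightarrow>\<^sub>L real"
  where "\<And>x. x \<noteq> 0 \<Longrightarrow> \<exists>n. l n x \<noteq> 0"
proof -
  define U where "U l = {x. blinfun_apply l x \<noteq> 0}" for l :: "'a \<Rightarrow>\<^sub>L real"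
  have "open (U l)" for l
    unfolding U_def by (intro open_Collect_neq continuous_intros)
  then obtain F where F: "F \<subseteq> range U" "countable F" "\<Union>F = \<Union>(range U)"
    using Lindelof[of "range U"] by (metis (no_types, lifting) imageE)
  have "\<Union>(range U) = - {0}"
  proof (intro set_eqI iffI)
    fix x assume "x \<in> \<Union>(range U)"
    then show "x \<in> - {0}" by (auto simp: U_def blinfun.zero_right)
  next
    fix x :: 'a assume "x \<in> - {0}"
    then show "x \<in> \<Union>(range U)"
      using dual_separates_points[of x] by (auto simp: U_def)
  qed
  obtain C where C: "countable C" "F = U ` C"
    using countable_subset_image[of F U UNIV] F by auto
  define l where "l = from_nat_into (insert 0 C)"
  have rl: "range l = insert 0 C"
    unfolding l_def using C by (intro range_from_nat_into) auto
  show thesis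
  proof (rule that)
    fix x :: 'a assume "x \<noteq> 0"
    then have "x \<in> \<Union>F" using F \<open>\<Union>(range U) = - {0}\<close> by auto
    then obtain k where "k \<in> C" "blinfun_apply k x \<noteq> 0" using C by (auto simp: U_def)
    then show "\<exists>n. l n x \<noteq> 0" using rl by (metis insertCI rangeE)
  qed
qed

section \<open>Laws determined by their characteristic functions\<close>

lemma (in finite_measure) integrable_bounded_measurable:
  fixes g :: "'a \<Rightarrow> real"
  assumes "g \<in> borel_measurable M" and "\<And>x. \<bar>g x\<bar> \<le> B"
  shows "integrable M g"
  using assms by (intro integrable_const_bound[of _ B]) auto

text \<open>
  Normalising the weights turns this into Levy's uniqueness theorem for the laws of \<open>X\<close> and \<open>Y\<close> under the
  probabilities with densities proportional to \<open>g\<close> and \<open>h\<close>.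
\<close>
lemma weighted_law_eqI:
  fixes X g :: "'a \<Rightarrow> real" and Y h :: "'b \<Rightarrow> real"
  assumes M: "prob_space M" and N: "prob_space N"
    and [measurable]: "X \<in> borel_measurable M" "Y \<in> borel_measurable N"
      "g \<in> borel_measurable M" "h \<in> borel_measurable N"
    and g: "\<And>x. 0 \<le> g x" "\<And>x. g x \<le> B" and h: "\<And>x. 0 \<le> h x" "\<And>x. h x \<le> B"
    and cos: "\<And>t. (\<integral>x. g x * cos (t * X x) \<partial>M) = (\<integral>y. h y * cos (t * Y y) \<partial>N)"
    and sin: "\<And>t. (\<integral>x. g x * sin (t * X x) \<partial>M) = (\<integral>y. h y * sin (t * Y y) \<partial>N)"
    and S: "S \<in> sets borel"
  shows "(\<integral>x. g x * indicator S (X x) \<partial>M) = (\<integral>y. h y * indicator S (Y y) \<partial>N)"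
proof -
  have [measurable]: "S \<in> sets borel" by fact
  interpret M: prob_space M by fact
  interpret N: prob_space N by fact
  define Z where "Z = (\<integral>x. g x \<partial>M)"
  have Z: "Z = (\<integral>y. h y \<partial>N)"
    using cos[of 0] by (simp add: Z_def)
  have intg: "integrable M (\<lambda>x. g x * c x)" if [measurable]: "c \<in> borel_measurable M" and "\<And>x. \<bar>c x\<bar> \<le> 1" for c
    using g mult_mono[OF g(2) that(2)] order_trans[OF g(1) g(2)]
    by (intro M.integrable_bounded_measurable[of _ B]) (auto simp: abs_mult)
  have inth: "integrable N (\<lambda>x. h x * c x)" if [measurable]: "c \<in> borel_measurable N" and "\<And>x. \<bar>c x\<bar> \<le> 1" for c
    using h mult_mono[OF h(2) that(2)] order_trans[OF h(1) h(2)]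
    by (intro N.integrable_bounded_measurable[of _ B]) (auto simp: abs_mult)
  have ig: "integrable M g" and ih: "integrable N h"
    using intg[of "\<lambda>_. 1"] inth[of "\<lambda>_. 1"] by auto
  have "Z \<ge> 0" unfolding Z_def using g by (intro Bochner_Integration.integral_nonneg) auto
  show ?thesis
  proof (cases "Z = 0")
    case True
    have "AE x in M. g x = 0"
      using integral_nonneg_eq_0_iff_AE[OF ig] g True by (auto simp: Z_def)
    then have 1: "(\<integral>x. g x * indicator S (X x) \<partial>M) = (\<integral>x. 0 \<partial>M)"
      by (intro integral_cong_AE) auto
    have "AE x in N. h x = 0"
      using integral_nonneg_eq_0_iff_AE[OF ih] h True by (auto simp: Z)
    then have 2: "(\<integral>x. h x * indicator S (Y x) \<partial>N) = (\<integral>x. 0 \<partial>N)"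
      by (intro integral_cong_AE) auto
    show ?thesis using 1 2 by simp
  next
    case False
    then have "Z > 0" using \<open>Z \<ge> 0\<close> by simp
    define P where "P = distr (density M (\<lambda>x. ennreal (g x / Z))) borel X"
    define Q where "Q = distr (density N (\<lambda>x. ennreal (h x / Z))) borel Y"
    have "prob_space (density M (\<lambda>x. ennreal (g x / Z)))"
    proof
      have "(\<integral>\<^sup>+x. ennreal (g x / Z) \<partial>M) = ennreal (\<integral>x. g x / Z \<partial>M)"
        using g \<open>Z > 0\<close> ig by (intro nn_integral_eq_integral) auto
      also have "\<dots> = 1" using \<open>Z > 0\<close> by (simp add: Z_def)
      finally show "emeasure (density M (\<lambda>x. ennreal (g x / Z))) (space (density M (\<lambda>x. ennreal (g x / Z)))) = 1"
        by (simp add: emeasure_density cong: nn_integral_cong)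
    qed
    then have P: "real_distribution P"
      unfolding P_def by (intro prob_space.real_distribution_distr) auto
    have "prob_space (density N (\<lambda>x. ennreal (h x / Z)))"
    proof
      have "(\<integral>\<^sup>+x. ennreal (h x / Z) \<partial>N) = ennreal (\<integral>x. h x / Z \<partial>N)"
        using h \<open>Z > 0\<close> ih by (intro nn_integral_eq_integral) auto
      also have "\<dots> = 1" using \<open>Z > 0\<close> by (simp add: Z)
      finally show "emeasure (density N (\<lambda>x. ennreal (h x / Z))) (space (density N (\<lambda>x. ennreal (h x / Z)))) = 1"
        by (simp add: emeasure_density cong: nn_integral_cong)
    qed
    then have Q: "real_distribution Q"
      unfolding Q_def by (intro prob_space.real_distribution_distr) auto
    have iP: "(\<integral>x. c x \<partial>P) = (\<integral>x. g x * c (X x) \<partial>M) / Z" if [measurable]: "c \<in> borel_measurable borel" for c :: "real \<Rightarrow> real"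
      unfolding P_def using g \<open>Z > 0\<close>
      by (simp add: integral_distr integral_density)
    have iQ: "(\<integral>x. c x \<partial>Q) = (\<integral>x. h x * c (Y x) \<partial>N) / Z" if [measurable]: "c \<in> borel_measurable borel" for c :: "real \<Rightarrow> real"
      unfolding Q_def using h \<open>Z > 0\<close>
      by (simp add: integral_distr integral_density)
    have char: "char R t = Complex (\<integral>x. cos (t * x) \<partial>R) (\<integral>x. sin (t * x) \<partial>R)" if "real_distribution R" for R t
    proof -
      interpret R: real_distribution R by fact
      have i: "integrable R (\<lambda>x. iexp (t * x))"
        by (intro R.integrable_const_bound[of _ 1]) auto
      have "Re (char R t) = (\<integral>x. cos (t * x) \<partial>R)" "Im (char R t) = (\<integral>x. sin (t * x) \<partial>R)"
        unfolding char_def using i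
        by (subst integral_Re[symmetric] integral_Im[symmetric]; simp add: Re_exp Im_exp)+
      then show ?thesis by (simp add: complex_eq_iff)
    qed
    have "char P = char Q"
      using cos sin by (simp add: fun_eq_iff char[OF P] char[OF Q] iP iQ)
    then have "P = Q" by (rule Levy_uniqueness[OF P Q])
    then have "(\<integral>x. g x * indicator S (X x) \<partial>M) / Z = (\<integral>y. h y * indicator S (Y y) \<partial>N) / Z"
      by (subst iP[symmetric], simp, subst iQ[symmetric], simp_all)
    then show ?thesis using \<open>Z > 0\<close> by simp
  qed
qed

text \<open>
  Uniqueness of joint characteristic functions, for families of random variables of any size that are closed
  under linear combinations.  Indicators of the coordinates are inserted one at a time under
  the expectation of \<open>cos (a + X v)\<close>.  The remaining factor has to be a nonnegative density for the
  one-dimensional theorem to apply, so \<open>cos\<close> is replaced by \<open>2 + cos\<close>; the constant is removed afterwards by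
  subtracting the same identity with \<open>a + pi\<close> in place of \<open>a\<close>.
\<close>
lemma joint_law_eqI:
  fixes X :: "'v \<Rightarrow> 'a \<Rightarrow> real" and Y :: "'v \<Rightarrow> 'b \<Rightarrow> real"
  assumes M: "prob_space M" and N: "prob_space N"
    and [measurable]: "\<And>v. X v \<in> borel_measurable M" "\<And>v. Y v \<in> borel_measurable N"
    and comb: "\<And>u v c. \<exists>w. (\<forall>x. X w x = X u x + c * X v x) \<and> (\<forall>y. Y w y = Y u y + c * Y v y)"
    and cos: "\<And>v. (\<integral>x. cos (X v x) \<partial>M) = (\<integral>y. cos (Y v y) \<partial>N)"
    and sin: "\<And>v. (\<integral>x. sin (X v x) \<partial>M) = (\<integral>y. sin (Y v y) \<partial>N)"
  shows "distr M (Pi\<^sub>M UNIV (\<lambda>_. borel)) (\<lambda>x v. X v x) = distr N (Pi\<^sub>M UNIV (\<lambda>_. borel)) (\<lambda>y v. Y v y)"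
proof -
  interpret M: prob_space M by fact
  interpret N: prob_space N by fact
  have main: "(\<integral>x. (\<Prod>j\<in>J. indicator (S j) (X j x)) * cos (a + X v x) \<partial>M)
            = (\<integral>y. (\<Prod>j\<in>J. indicator (S j) (Y j y)) * cos (a + Y v y) \<partial>N)"
    if "finite J" "\<And>j. S j \<in> sets borel" for J S v a
    using that(1)
  proof (induction J arbitrary: v a rule: finite_induct)
    case empty
    have "(\<integral>x. cos (a + X v x) \<partial>M) = cos a * (\<integral>x. cos (X v x) \<partial>M) - sin a * (\<integral>x. sin (X v x) \<partial>M)"
      by (simp add: cos_add M.integrable_bounded_measurable[where B=1])
    moreover have "(\<integral>x. cos (a + Y v x) \<partial>N) = cos a * (\<integral>x. cos (Y v x) \<partial>N) - sin a * (\<integral>x. sin (Y v x) \<partial>N)"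
      by (simp add: cos_add N.integrable_bounded_measurable[where B=1])
    ultimately show ?case by (simp add: cos sin)
  next
    case (insert k J)
    have [measurable]: "S j \<in> sets borel" for j by (rule that(2))
    define P where "P x = (\<Prod>j\<in>J. indicator (S j) (X j x) :: real)" for x
    define Q where "Q y = (\<Prod>j\<in>J. indicator (S j) (Y j y) :: real)" for y
    have [measurable]: "P \<in> borel_measurable M" "Q \<in> borel_measurable N"
      unfolding P_def Q_def by measurable
    have P01: "0 \<le> P x" "P x \<le> 1" for x
      unfolding P_def by (auto intro!: prod_nonneg prod_le_1)
    have Q01: "0 \<le> Q x" "Q x \<le> 1" for x
      unfolding Q_def by (auto intro!: prod_nonneg prod_le_1)
    have intP: "integrable M (\<lambda>x. P x * c x)" if [measurable]: "c \<in> borel_measurable M" and "\<And>x. \<bar>c x\<bar> \<le> C" for c C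
    proof (rule M.integrable_bounded_measurable[of _ C])
      show "\<bar>P x * c x\<bar> \<le> C" for x
        using mult_mono[OF P01(2)[of x] that(2)[of x]] P01[of x] by (simp add: abs_mult)
    qed measurable
    have intQ: "integrable N (\<lambda>x. Q x * c x)" if [measurable]: "c \<in> borel_measurable N" and "\<And>x. \<bar>c x\<bar> \<le> C" for c C
    proof (rule N.integrable_bounded_measurable[of _ C])
      show "\<bar>Q x * c x\<bar> \<le> C" for x
        using mult_mono[OF Q01(2)[of x] that(2)[of x]] Q01[of x] by (simp add: abs_mult)
    qed measurable
    have IH: "(\<integral>x. P x * cos (b + X u x) \<partial>M) = (\<integral>y. Q y * cos (b + Y u y) \<partial>N)" for b u
      using insert.IH[of b u] by (simp add: P_def Q_def)
    \<comment> \<open>The product of the two cosines is half the sum of the cosines of \<open>X u \<plusminus> t X k\<close>, which belong to the family.\<close>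
    have two: "(\<integral>x. P x * cos (b + X u x) * cos (d + t * X k x) \<partial>M)
             = (\<integral>y. Q y * cos (b + Y u y) * cos (d + t * Y k y) \<partial>N)" for b d t u
    proof -
      obtain w w' where w: "\<And>x. X w x = X u x + t * X k x" "\<And>y. Y w y = Y u y + t * Y k y"
        and w': "\<And>x. X w' x = X u x + (- t) * X k x" "\<And>y. Y w' y = Y u y + (- t) * Y k y"
        using comb[of u t k] comb[of u "- t" k] by blast
      have pt: "p * cos (b + x) * cos (d + z) = p * (cos ((b - d) + (x - z)) / 2) + p * (cos ((b + d) + (x + z)) / 2)" for p x z :: real
        by (simp add: cos_times_cos mult.assoc add_divide_distrib algebra_simps)
      have "(\<integral>x. P x * cos (b + X u x) * cos (d + t * X k x) \<partial>M)
          = (\<integral>x. P x * (cos ((b - d) + X w' x) / 2) + P x * (cos ((b + d) + X w x) / 2) \<partial>M)"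
        by (simp add: pt w w')
      also have "\<dots> = (\<integral>x. P x * (cos ((b - d) + X w' x) / 2) \<partial>M) + (\<integral>x. P x * (cos ((b + d) + X w x) / 2) \<partial>M)"
        by (intro Bochner_Integration.integral_add intP[of _ 1]) (auto intro: order_trans[OF abs_cos_le_one])
      also have "\<dots> = (\<integral>x. Q x * (cos ((b - d) + Y w' x) / 2) \<partial>N) + (\<integral>x. Q x * (cos ((b + d) + Y w x) / 2) \<partial>N)"
        using IH by simp
      also have "\<dots> = (\<integral>x. Q x * (cos ((b - d) + Y w' x) / 2) + Q x * (cos ((b + d) + Y w x) / 2) \<partial>N)"
        by (intro Bochner_Integration.integral_add[symmetric] intQ[of _ 1]) (auto intro: order_trans[OF abs_cos_le_one])
      also have "\<dots> = (\<integral>x. Q x * cos (b + Y u x) * cos (d + t * Y k x) \<partial>N)"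
        by (simp add: pt w w')
      finally show ?thesis .
    qed
    have one: "(\<integral>x. P x * cos (d + t * X k x) \<partial>M) = (\<integral>y. Q y * cos (d + t * Y k y) \<partial>N)" for d t
    proof -
      obtain z where z: "\<And>x. X z x = 0" "\<And>y. Y z y = 0"
        using comb[of k "-1" k] by auto
      show ?thesis using two[of 0 z d t] by (simp add: z)
    qed
    have wt: "(\<integral>x. P x * (2 + cos (b + X v x)) * cos (d + t * X k x) \<partial>M)
            = (\<integral>y. Q y * (2 + cos (b + Y v y)) * cos (d + t * Y k y) \<partial>N)" for b d t
    proof -
      have pt: "p * (2 + c) * e = 2 * (p * e) + p * c * e" for p c e :: real
        by (simp add: algebra_simps)
      have "(\<integral>x. P x * (2 + cos (b + X v x)) * cos (d + t * X k x) \<partial>M)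
          = 2 * (\<integral>x. P x * cos (d + t * X k x) \<partial>M) + (\<integral>x. P x * cos (b + X v x) * cos (d + t * X k x) \<partial>M)"
        unfolding pt mult.assoc[of "P _"]
        by (subst Bochner_Integration.integral_add) (auto intro!: intP[of _ 1] mult_le_one simp: abs_mult)
      moreover have "(\<integral>x. Q x * (2 + cos (b + Y v x)) * cos (d + t * Y k x) \<partial>N)
          = 2 * (\<integral>x. Q x * cos (d + t * Y k x) \<partial>N) + (\<integral>x. Q x * cos (b + Y v x) * cos (d + t * Y k x) \<partial>N)"
        unfolding pt mult.assoc[of "Q _"]
        by (subst Bochner_Integration.integral_add) (auto intro!: intQ[of _ 1] mult_le_one simp: abs_mult)
      ultimately show ?thesis by (simp add: one two)
    qed
    have ind: "(\<integral>x. P x * (2 + cos (b + X v x)) * indicator (S k) (X k x) \<partial>M)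
             = (\<integral>y. Q y * (2 + cos (b + Y v y)) * indicator (S k) (Y k y) \<partial>N)" for b
    proof (rule weighted_law_eqI[OF M N, where B = 3])
      have 2: "0 \<le> 2 + cos z" "2 + cos z \<le> 3" for z :: real
        using cos_ge_minus_one[of z] cos_le_one[of z] by linarith+
      show "0 \<le> P x * (2 + cos (b + X v x))" "P x * (2 + cos (b + X v x)) \<le> 3" for x
        using mult_mono[OF P01(2)[of x] 2(2)[of "b + X v x"]] P01[of x] 2[of "b + X v x"] by auto
      show "0 \<le> Q x * (2 + cos (b + Y v x))" "Q x * (2 + cos (b + Y v x)) \<le> 3" for x
        using mult_mono[OF Q01(2)[of x] 2(2)[of "b + Y v x"]] Q01[of x] 2[of "b + Y v x"] by auto
      show "(\<integral>x. P x * (2 + cos (b + X v x)) * cos (t * X k x) \<partial>M)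
          = (\<integral>y. Q y * (2 + cos (b + Y v y)) * cos (t * Y k y) \<partial>N)" for t
        using wt[of b 0 t] by simp
      have s: "sin z = cos (- (pi/2) + z)" for z :: real
        unfolding cos_add cos_minus sin_minus by simp
      show "(\<integral>x. P x * (2 + cos (b + X v x)) * sin (t * X k x) \<partial>M)
          = (\<integral>y. Q y * (2 + cos (b + Y v y)) * sin (t * Y k y) \<partial>N)" for t
        using wt[of b "- (pi/2)" t] by (simp only: s)
    qed (auto simp: that(2))
    have pt: "p * (2 + cos (a + x)) * i - p * (2 + cos ((a + pi) + x)) * i = 2 * ((i * p) * cos (a + x))" for p x i :: real
      by (simp add: cos_add sin_add algebra_simps)
    have b3: "\<bar>(2 + cos z) * indicator T y\<bar> \<le> 3" for z :: real and T :: "real set" and y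
    proof -
      have "\<bar>2 + cos z\<bar> \<le> 3" using cos_ge_minus_one[of z] cos_le_one[of z] by linarith
      then show ?thesis by (simp add: indicator_def)
    qed
    have iM: "integrable M (\<lambda>x. P x * (2 + cos (b + X v x)) * indicator (S k) (X k x))" for b
      unfolding mult.assoc
      by (rule intP[of _ 3]) (measurable, rule b3)
    have iN: "integrable N (\<lambda>x. Q x * (2 + cos (b + Y v x)) * indicator (S k) (Y k x))" for b
      unfolding mult.assoc
      by (rule intQ[of _ 3]) (measurable, rule b3)
    have "2 * (\<integral>x. (indicator (S k) (X k x) * P x) * cos (a + X v x) \<partial>M)
        = (\<integral>x. P x * (2 + cos (a + X v x)) * indicator (S k) (X k x) \<partial>M) - (\<integral>x. P x * (2 + cos ((a + pi) + X v x)) * indicator (S k) (X k x) \<partial>M)"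
      by (subst Bochner_Integration.integral_diff[symmetric, OF iM iM]) (simp only: pt integral_mult_right_zero)
    also have "\<dots> = (\<integral>x. Q x * (2 + cos (a + Y v x)) * indicator (S k) (Y k x) \<partial>N) - (\<integral>x. Q x * (2 + cos ((a + pi) + Y v x)) * indicator (S k) (Y k x) \<partial>N)"
      by (simp only: ind)
    also have "\<dots> = 2 * (\<integral>x. (indicator (S k) (Y k x) * Q x) * cos (a + Y v x) \<partial>N)"
      by (subst Bochner_Integration.integral_diff[symmetric, OF iN iN]) (simp only: pt integral_mult_right_zero)
    finally show ?case
      using insert.hyps by (simp add: P_def Q_def)
  qed
  let ?\<Pi> = "Pi\<^sub>M UNIV (\<lambda>_::'v. borel :: real measure)"
  have [measurable]: "(\<lambda>x v. X v x) \<in> measurable M ?\<Pi>" "(\<lambda>y v. Y v y) \<in> measurable N ?\<Pi>"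
    by (auto intro!: measurable_PiM_single')
  show ?thesis
  proof (rule measure_eqI_PiM_infinite)
    interpret D: prob_space "distr M ?\<Pi> (\<lambda>x v. X v x)" by (rule M.prob_space_distr) measurable
    show "finite_measure (distr M ?\<Pi> (\<lambda>x v. X v x))" by (rule D.finite_measure)
    fix S :: "'v \<Rightarrow> real set" and J :: "'v set"
    assume J: "finite J" "J \<subseteq> UNIV" and S: "\<And>i. i \<in> J \<Longrightarrow> S i \<in> sets borel"
    define S' where "S' j = (if j \<in> J then S j else {})" for j
    have S': "S' j \<in> sets borel" for j using S by (auto simp: S'_def)
    then have [measurable]: "S' j \<in> sets borel" for j by simp
    have emb: "prod_emb UNIV (\<lambda>_. borel) J (Pi\<^sub>E J S) = {\<xi>. \<forall>j\<in>J. \<xi> j \<in> S' j}"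
      by (auto simp: prod_emb_def S'_def PiE_iff space_PiM)
    obtain z where z: "\<And>x. X z x = 0" "\<And>y. Y z y = 0"
      using comb[of undefined "-1" undefined] by auto
    have zz: "(\<integral>x. (\<Prod>j\<in>J. indicator (S' j) (X j x)) \<partial>M) = (\<integral>y. (\<Prod>j\<in>J. indicator (S' j) (Y j y)) \<partial>N :: real)"
      using main[of J S' 0 z] J(1) S' by (simp add: z)
    have ip: "(\<Prod>j\<in>J. indicator (S' j) (F j)) = (indicator {\<xi>. \<forall>j\<in>J. \<xi> j \<in> S' j} F :: real)" for F :: "'v \<Rightarrow> real"
      using J(1) by (auto simp: indicator_def split: if_splits)
    have set: "{\<xi>. \<forall>j\<in>J. \<xi> j \<in> S' j} \<in> sets ?\<Pi>"
      unfolding emb[symmetric] using J S by (intro sets_PiM_I) auto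
    have "emeasure (distr M ?\<Pi> (\<lambda>x v. X v x)) {\<xi>. \<forall>j\<in>J. \<xi> j \<in> S' j} = ennreal (\<integral>\<xi>. indicator {\<xi>. \<forall>j\<in>J. \<xi> j \<in> S' j} \<xi> \<partial>distr M ?\<Pi> (\<lambda>x v. X v x))"
      using set by (simp add: D.emeasure_eq_measure)
    also have "\<dots> = ennreal (\<integral>x. (\<Prod>j\<in>J. indicator (S' j) (X j x)) \<partial>M)"
      using set by (subst integral_distr) (auto simp: ip)
    finally have 1: "emeasure (distr M ?\<Pi> (\<lambda>x v. X v x)) {\<xi>. \<forall>j\<in>J. \<xi> j \<in> S' j} = ennreal (\<integral>x. (\<Prod>j\<in>J. indicator (S' j) (X j x)) \<partial>M)" .
    interpret E: prob_space "distr N ?\<Pi> (\<lambda>x v. Y v x)" by (rule N.prob_space_distr) measurable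
    have "emeasure (distr N ?\<Pi> (\<lambda>x v. Y v x)) {\<xi>. \<forall>j\<in>J. \<xi> j \<in> S' j} = ennreal (\<integral>\<xi>. indicator {\<xi>. \<forall>j\<in>J. \<xi> j \<in> S' j} \<xi> \<partial>distr N ?\<Pi> (\<lambda>x v. Y v x))"
      using set by (simp add: E.emeasure_eq_measure)
    also have "\<dots> = ennreal (\<integral>x. (\<Prod>j\<in>J. indicator (S' j) (Y j x)) \<partial>N)"
      using set by (subst integral_distr) (auto simp: ip)
    finally have 2: "emeasure (distr N ?\<Pi> (\<lambda>x v. Y v x)) {\<xi>. \<forall>j\<in>J. \<xi> j \<in> S' j} = ennreal (\<integral>x. (\<Prod>j\<in>J. indicator (S' j) (Y j x)) \<partial>N)" .
    show "emeasure (distr M ?\<Pi> (\<lambda>x v. X v x)) (prod_emb UNIV (\<lambda>_. borel) J (Pi\<^sub>E J S))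
        = emeasure (distr N ?\<Pi> (\<lambda>x v. Y v x)) (prod_emb UNIV (\<lambda>_. borel) J (Pi\<^sub>E J S))"
      unfolding emb 1 2 zz ..
  qed simp_all
qed

text \<open>
  A countable separating family embeds \<open>W\<close> continuously and injectively into a countable product of lines.  A
  compact set is the preimage of its (closed) image there, so the joint laws of continuous functionals determine
  the measure of compact sets, and inner regularity extends this to all Borel sets.
\<close>
lemma borel_measure_eqI_dual:
  fixes \<mu> \<nu> :: "'w::{banach,second_countable_topology} measure"
  assumes \<mu>: "prob_space \<mu>" "sets \<mu> = sets borel" and \<nu>: "prob_space \<nu>" "sets \<nu> = sets borel"
    and cos: "\<And>l :: 'w \<Rightarrow>\<^sub>L real. (\<integral>x. cos (l x) \<partial>\<mu>) = (\<integral>x. cos (l x) \<partial>\<nu>)"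
    and sin: "\<And>l :: 'w \<Rightarrow>\<^sub>L real. (\<integral>x. sin (l x) \<partial>\<mu>) = (\<integral>x. sin (l x) \<partial>\<nu>)"
  shows "\<mu> = \<nu>"
proof -
  interpret \<mu>: prob_space \<mu> by fact
  interpret \<nu>: prob_space \<nu> by fact
  note [measurable_cong] = \<mu>(2) \<nu>(2)
  have lm [measurable]: "blinfun_apply l \<in> borel_measurable borel" for l :: "'w \<Rightarrow>\<^sub>L real"
    by (intro borel_measurable_continuous_onI continuous_intros)
  let ?\<Pi> = "Pi\<^sub>M UNIV (\<lambda>_. borel) :: (('w \<Rightarrow>\<^sub>L real) \<Rightarrow> real) measure"
  have all: "distr \<mu> ?\<Pi> (\<lambda>x l. blinfun_apply l x) = distr \<nu> ?\<Pi> (\<lambda>x l. blinfun_apply l x)"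
  proof (rule joint_law_eqI[OF \<mu>(1) \<nu>(1)])
    fix u v :: "'w \<Rightarrow>\<^sub>L real" and c
    show "\<exists>w. (\<forall>x. blinfun_apply w x = blinfun_apply u x + c * blinfun_apply v x) \<and>
              (\<forall>x. blinfun_apply w x = blinfun_apply u x + c * blinfun_apply v x)"
      by (intro exI[of _ "u + c *\<^sub>R v"]) (simp add: blinfun.add_left blinfun.scaleR_left)
  qed (auto intro: cos sin)
  obtain l :: "nat \<Rightarrow> 'w \<Rightarrow>\<^sub>L real" where l: "\<And>x. x \<noteq> 0 \<Longrightarrow> \<exists>n. l n x \<noteq> 0"
    using countable_dual_family_separates_points by blast
  define L where "L x = (\<lambda>n. blinfun_apply (l n) x)" for x
  have inj: "inj L"
  proof (rule injI)
    fix x y assume "L x = L y"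
    then have "\<forall>n. l n (x - y) = 0"
      by (simp add: L_def fun_eq_iff blinfun.diff_right)
    then show "x = y" using l[of "x - y"] by auto
  qed
  have contL: "continuous_on S L" for S
    unfolding L_def by (intro continuous_on_coordinatewise_then_product continuous_intros)
  have K: "emeasure \<mu> K = emeasure \<nu> K" if "compact K" for K
  proof -
    have "closed (L ` K)"
      using compact_continuous_image[OF contL that] by (rule compact_imp_closed)
    then have [measurable]: "L ` K \<in> sets (Pi\<^sub>M UNIV (\<lambda>_. borel))"
      by (simp add: sets_PiM_equal_borel)
    have [measurable]: "(\<lambda>\<xi> n. \<xi> (l n)) \<in> measurable ?\<Pi> (Pi\<^sub>M UNIV (\<lambda>_. borel))"
      by (intro measurable_PiM_single') auto
    have 1: "{x. (\<lambda>n. blinfun_apply (l n) x) \<in> L ` K} = K"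
      using inj by (auto simp: L_def inj_def)
    have [measurable]: "{\<xi>. (\<lambda>n. \<xi> (l n)) \<in> L ` K} \<in> sets ?\<Pi>"
      using measurable_sets[of "\<lambda>\<xi> n. \<xi> (l n)" ?\<Pi> "Pi\<^sub>M UNIV (\<lambda>_. borel)" "L ` K"]
      by (simp add: vimage_def space_PiM)
    have m: "(\<lambda>x l. blinfun_apply l x) \<in> measurable \<mu> ?\<Pi>" "(\<lambda>x l. blinfun_apply l x) \<in> measurable \<nu> ?\<Pi>"
      by (auto intro!: measurable_PiM_single')
    have sp: "space \<mu> = UNIV" "space \<nu> = UNIV"
      using sets_eq_imp_space_eq[OF \<mu>(2)] sets_eq_imp_space_eq[OF \<nu>(2)] by auto
    have "emeasure (distr \<mu> ?\<Pi> (\<lambda>x l. blinfun_apply l x)) {\<xi>. (\<lambda>n. \<xi> (l n)) \<in> L ` K} = emeasure \<mu> K"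
      by (subst emeasure_distr[OF m(1)]) (auto simp: sp 1 vimage_def)
    moreover have "emeasure (distr \<nu> ?\<Pi> (\<lambda>x l. blinfun_apply l x)) {\<xi>. (\<lambda>n. \<xi> (l n)) \<in> L ` K} = emeasure \<nu> K"
      by (subst emeasure_distr[OF m(2)]) (auto simp: sp 1 vimage_def)
    ultimately show ?thesis using all by simp
  qed
  show ?thesis
  proof (rule measure_eqI)
    show "sets \<mu> = sets \<nu>" using \<mu> \<nu> by simp
    fix B assume "B \<in> sets \<mu>"
    then have B: "B \<in> sets borel" using \<mu> by simp
    have "emeasure \<mu> B = (SUP K \<in> {K. K \<subseteq> B \<and> compact K}. emeasure \<mu> K)"
      by (rule inner_regular[OF \<mu>(2) _ B]) simp
    also have "\<dots> = (SUP K \<in> {K. K \<subseteq> B \<and> compact K}. emeasure \<nu> K)"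
      by (intro SUP_cong) (auto simp: K)
    also have "\<dots> = emeasure \<nu> B"
      by (rule inner_regular[OF \<nu>(2) _ B, symmetric]) simp
    finally show "emeasure \<mu> B = emeasure \<nu> B" .
  qed
qed

section \<open>The coordinate expansion of a point of Wiener space\<close>

locale wiener_basis = abstract_wiener_space \<mu> \<iota>
  for \<mu> :: "'w::{banach,second_countable_topology} measure"
    and \<iota> :: "'h::{real_inner,banach,second_countable_topology} \<Rightarrow> 'w" +
  fixes e :: "nat \<Rightarrow> 'h"
  assumes smooth_basis: "smooth_orthonormal_basis \<iota> e"
begin

lemma space_\<mu> [simp]: "space \<mu> = UNIV"
  using sets_eq_imp_space_eq[OF sets_borel] by simp

lemma Collect_sets_\<mu>: "Measurable.pred \<mu> P \<Longrightarrow> {x. P x} \<in> sets \<mu>"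
  by (simp add: pred_def)

lemma dense_span: "closure (span (range e)) = UNIV"
  using smooth_basis by (simp add: smooth_orthonormal_basis_def)

lemma inner_basis: "inner (e i) (e j) = (if i = j then 1 else 0)"
proof -
  have inj: "inj e" and on: "orthonormal_set (range e)"
    using smooth_basis by (auto simp: smooth_orthonormal_basis_def)
  have "inner (e i) (e i) = 1"
    using on by (simp add: orthonormal_set_def dot_square_norm)
  moreover have "inner (e i) (e j) = 0" if "i \<noteq> j"
    using on inj that unfolding orthonormal_set_def pairwise_def orthogonal_def
    by (metis injD rangeI)
  ultimately show ?thesis by auto
qed

lemma norm_sum_basis: "finite F \<Longrightarrow> (norm (\<Sum>j\<in>F. a j *\<^sub>R e j))\<^sup>2 = (\<Sum>j\<in>F. (a j)\<^sup>2)"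
  unfolding power2_norm_eq_inner
  by (simp add: inner_sum_left inner_sum_right inner_basis if_distrib[of "\<lambda>x. _ * x"] power2_eq_square cong: if_cong)

text \<open>
  Riesz representation.  Applying \<open>\<phi>\<close> to the partial sums of \<open>\<Sum>\<^sub>j \<phi>(e\<^sub>j) e\<^sub>j\<close> bounds \<open>\<Sum>\<^sub>j \<phi>(e\<^sub>j)\<^sup>2\<close> by the square of
  the norm of \<open>\<phi>\<close>, so the series converges.
\<close>
lemma riesz_basis:
  fixes \<phi> :: "'h \<Rightarrow> real"
  assumes "bounded_linear \<phi>"
  obtains h where "(\<lambda>j. \<phi> (e j) *\<^sub>R e j) sums h" "\<And>k. inner h k = \<phi> k"
proof -
  interpret \<phi>: bounded_linear \<phi> by fact
  define a where "a j = \<phi> (e j)" for j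
  obtain C where C: "C > 0" "\<And>x. norm (\<phi> x) \<le> norm x * C"
    using \<phi>.pos_bounded by blast
  have bessel: "(\<Sum>j\<in>F. (a j)\<^sup>2) \<le> C\<^sup>2" if "finite F" for F
  proof -
    define v where "v = (\<Sum>j\<in>F. a j *\<^sub>R e j)"
    have v: "(norm v)\<^sup>2 = (\<Sum>j\<in>F. (a j)\<^sup>2)"
      unfolding v_def by (rule norm_sum_basis[OF that])
    have "\<phi> v = (\<Sum>j\<in>F. (a j)\<^sup>2)"
      by (simp add: v_def \<phi>.sum \<phi>.scaleR a_def power2_eq_square)
    then have "norm v * norm v \<le> norm v * C"
      using C(2)[of v] v by (simp add: power2_eq_square)
    then have "norm v \<le> C"
      using C(1) by (cases "norm v = 0") (auto simp: mult_le_cancel_left)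
    then have "(norm v)\<^sup>2 \<le> C\<^sup>2" by (intro power_mono) auto
    then show ?thesis by (simp add: v)
  qed
  have "summable (\<lambda>j. (a j)\<^sup>2)"
    by (rule summableI_nonneg_bounded[of _ "C\<^sup>2"]) (auto intro: bessel)
  then have cauchy: "\<forall>\<epsilon>>0. \<exists>N. \<forall>m\<ge>N. \<forall>n. norm (\<Sum>j\<in>{m..<n}. (a j)\<^sup>2) < \<epsilon>"
    by (simp add: summable_Cauchy)
  have "summable (\<lambda>j. a j *\<^sub>R e j)"
    unfolding summable_Cauchy
  proof (intro allI impI)
    fix \<epsilon> :: real assume "\<epsilon> > 0"
    then obtain N where N: "\<And>m n. m \<ge> N \<Longrightarrow> norm (\<Sum>j\<in>{m..<n}. (a j)\<^sup>2) < \<epsilon>\<^sup>2"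
      using cauchy zero_less_power[of \<epsilon> 2] by blast
    have "norm (\<Sum>j\<in>{m..<n}. a j *\<^sub>R e j) < \<epsilon>" if "m \<ge> N" for m n
    proof -
      have "(norm (\<Sum>j\<in>{m..<n}. a j *\<^sub>R e j))\<^sup>2 < \<epsilon>\<^sup>2"
        using N[OF that, of n] by (simp add: norm_sum_basis)
      then show ?thesis using \<open>\<epsilon> > 0\<close> by (simp add: power_less_imp_less_base)
    qed
    then show "\<exists>N. \<forall>m\<ge>N. \<forall>n. norm (\<Sum>j\<in>{m..<n}. a j *\<^sub>R e j) < \<epsilon>" by blast
  qed
  then obtain h where h: "(\<lambda>j. a j *\<^sub>R e j) sums h" by (auto simp: summable_def)
  have "inner h (e i) = \<phi> (e i)" for i
  proof -
    have "(\<lambda>j. inner (a j *\<^sub>R e j) (e i)) sums inner h (e i)"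
      by (rule bounded_linear.sums[OF bounded_linear_inner_left h])
    moreover have "(\<lambda>j. inner (a j *\<^sub>R e j) (e i)) = (\<lambda>j. if j = i then a j else 0)"
      by (auto simp: inner_basis fun_eq_iff)
    ultimately have "(\<lambda>j. if j = i then a j else 0) sums inner h (e i)" by simp
    then have "inner h (e i) = a i" using sums_single[of i a] by (rule sums_unique2)
    then show ?thesis by (simp add: a_def)
  qed
  then have "span (range e) \<subseteq> {k. inner h k = \<phi> k}"
    by (intro span_minimal) (auto simp: subspace_def inner_add_right \<phi>.add \<phi>.scaleR \<phi>.zero)
  moreover have "closed {k. inner h k = \<phi> k}"
    by (intro closed_Collect_eq continuous_intros \<phi>.continuous_on)
  ultimately have "closure (span (range e)) \<subseteq> {k. inner h k = \<phi> k}"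
    by (rule closure_minimal)
  then have "inner h k = \<phi> k" for k using dense_span by auto
  then show thesis using that h by (simp add: a_def)
qed

lemma basis_expansion: "(\<lambda>j. inner h (e j) *\<^sub>R e j) sums h"
proof -
  obtain g where g: "(\<lambda>j. inner h (e j) *\<^sub>R e j) sums g" "\<And>k. inner g k = inner h k"
    using riesz_basis[of "inner h"] bounded_linear_inner_right by blast
  have "g = h" using vector_eq_ldot[of g h] g(2) by (metis inner_commute)
  then show ?thesis using g by simp
qed

lemma inner_dual_embed: "inner (dual_embed \<iota> l) k = blinfun_apply l (\<iota> k)"
proof -
  have "bounded_linear (\<lambda>k. blinfun_apply l (\<iota> k))"
    using bounded_linear_compose[OF blinfun.bounded_linear_right bounded_linear_embedding] .
  then obtain h where h: "\<And>k. inner h k = blinfun_apply l (\<iota> k)"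
    using riesz_basis by blast
  have "\<exists>!h. \<forall>k. inner h k = blinfun_apply l (\<iota> k)"
  proof (rule ex1I[of _ h])
    fix g assume "\<forall>k. inner g k = blinfun_apply l (\<iota> k)"
    then show "g = h" using h vector_eq_ldot[of g h] by (metis inner_commute)
  qed (use h in blast)
  from theI'[OF this] show ?thesis by (simp add: dual_embed_def)
qed

lemma dual_embed_eqI:
  assumes "\<And>k. inner h k = blinfun_apply l (\<iota> k)"
  shows "dual_embed \<iota> l = h"
  using assms inner_dual_embed[of l] by (metis inner_commute vector_eq_ldot)

text \<open>
  Two continuous functionals that agree on the dense image of \<open>H\<close> are equal.
\<close>
lemma inj_dual_embed: "inj (dual_embed \<iota>)"
proof (rule injI)
  fix l l' assume eq: "dual_embed \<iota> l = dual_embed \<iota> l'"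
  have "blinfun_apply l (\<iota> k) = blinfun_apply l' (\<iota> k)" for k
    using inner_dual_embed[of l k] inner_dual_embed[of l' k] eq by simp
  then have "range \<iota> \<subseteq> {x. blinfun_apply l x = blinfun_apply l' x}" by auto
  moreover have "closed {x. blinfun_apply l x = blinfun_apply l' x}"
    by (intro closed_Collect_eq continuous_intros)
  ultimately have "closure (range \<iota>) \<subseteq> {x. blinfun_apply l x = blinfun_apply l' x}"
    by (rule closure_minimal)
  then show "l = l'" using dense_embedding by (auto intro: blinfun_eqI)
qed

text \<open>
  The element of \<open>W\<^sup>*\<close> that \<open>\<langle>e\<^sub>j, \<omega>\<rangle>\<close> evaluates at \<open>\<omega>\<close>.
\<close>
definition coord :: "nat \<Rightarrow> 'w \<Rightarrow>\<^sub>L real" where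
  "coord j = inv (dual_embed \<iota>) (e j)"

lemma dual_embed_coord: "dual_embed \<iota> (coord j) = e j"
  using smooth_basis unfolding coord_def smooth_orthonormal_basis_def by (blast intro: f_inv_into_f)

lemma wpairing_basis: "wpairing \<iota> (e j) = blinfun_apply (coord j)"
  by (simp add: wpairing_def coord_def fun_eq_iff)

lemma coord_embedding: "blinfun_apply (coord j) (\<iota> k) = inner (e j) k"
  using inner_dual_embed[of "coord j" k] by (simp add: dual_embed_coord)

lemma blinfun_measurable [measurable]: "blinfun_apply (l :: 'w \<Rightarrow>\<^sub>L real) \<in> borel_measurable \<mu>"
proof -
  have "blinfun_apply l \<in> borel_measurable borel"
    by (intro borel_measurable_continuous_onI continuous_intros)
  then show ?thesis by (simp cong: measurable_cong_sets add: sets_borel)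
qed

text \<open>
  The Gaussian law of \<open>l\<close> depends only on the norm of \<open>l\<close> in \<open>H\<close>.
\<close>
lemma dual_law_cong:
  fixes c :: "real \<Rightarrow> real"
  assumes [measurable]: "c \<in> borel_measurable borel"
    and eq: "norm (dual_embed \<iota> l) = norm (dual_embed \<iota> l')"
  shows "(\<integral>x. c (blinfun_apply l x) \<partial>\<mu>) = (\<integral>x. c (blinfun_apply l' x) \<partial>\<mu>)"
proof (cases "dual_embed \<iota> l = 0")
  case True
  then have "l = l'" using eq inj_dual_embed by (auto simp: inj_def)
  then show ?thesis by simp
next
  case False
  then have "dual_embed \<iota> l' \<noteq> 0" using eq by auto
  then show ?thesis
    using distributed_integral[OF gaussian[OF False], of c] distributed_integral[OF gaussian, of l' c] eq
    by simp
qed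

lemma gaussian_tail:
  assumes "c > 0"
  shows "prob {x. c \<le> \<bar>blinfun_apply l x\<bar>} \<le> (norm (dual_embed \<iota> l))\<^sup>2 / c\<^sup>2"
proof (cases "dual_embed \<iota> l = 0")
  case True
  have "dual_embed \<iota> 0 = 0" by (rule dual_embed_eqI) simp
  then have "l = 0" using True inj_dual_embed by (auto simp: inj_def)
  then show ?thesis using \<open>c > 0\<close> by (simp add: not_le)
next
  case False
  define \<sigma> where "\<sigma> = norm (dual_embed \<iota> l)"
  have \<sigma>: "\<sigma> > 0" using False by (simp add: \<sigma>_def)
  have d: "distributed \<mu> lborel (blinfun_apply l) (normal_density 0 \<sigma>)"
    using gaussian[OF False] by (simp add: \<sigma>_def)
  have ex: "expectation (blinfun_apply l) = 0"
    by (rule normal_distributed_expectation[OF \<sigma> d])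
  have var: "variance (blinfun_apply l) = \<sigma>\<^sup>2"
    by (rule normal_distributed_variance[OF \<sigma> d])
  have "integrable \<mu> (\<lambda>x. (blinfun_apply l x)\<^sup>2)"
  proof (rule ccontr)
    assume "\<not> integrable \<mu> (\<lambda>x. (blinfun_apply l x)\<^sup>2)"
    then have "variance (blinfun_apply l) = 0"
      unfolding ex by (simp add: not_integrable_integral_eq)
    then show False using var \<sigma> by simp
  qed
  then have "prob {x\<in>space \<mu>. c \<le> \<bar>blinfun_apply l x - expectation (blinfun_apply l)\<bar>} \<le> variance (blinfun_apply l) / c\<^sup>2"
    using \<open>c > 0\<close> by (intro Chebyshev_inequality) auto
  then show ?thesis unfolding var by (simp add: ex \<sigma>_def)
qed

definition partial_expansion :: "nat \<Rightarrow> 'w \<Rightarrow> 'w" where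
  "partial_expansion n x = (\<Sum>j<n. blinfun_apply (coord j) x *\<^sub>R \<iota> (e j))"

definition reflection :: "nat \<Rightarrow> 'w \<Rightarrow> 'w" where
  "reflection n x = 2 *\<^sub>R partial_expansion n x - x"

lemma continuous_partial_expansion: "continuous_on S (partial_expansion n)"
  unfolding partial_expansion_def by (intro continuous_intros)

lemma partial_expansion_measurable [measurable]: "partial_expansion n \<in> borel_measurable \<mu>"
  using borel_measurable_continuous_onI[OF continuous_partial_expansion, of n]
  by (simp cong: measurable_cong_sets add: sets_borel)

lemma id_measurable [measurable]: "(\<lambda>x. x) \<in> borel_measurable \<mu>"
  by (rule measurable_ident_sets) (rule sets_borel)

lemma reflection_measurable [measurable]: "reflection n \<in> borel_measurable \<mu>"
  unfolding reflection_def by measurable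

lemma reflection_measurable' [measurable]: "reflection n \<in> measurable \<mu> \<mu>"
  using reflection_measurable by (simp cong: measurable_cong_sets add: sets_borel)

lemma dual_partial_expansion:
  "blinfun_apply l (partial_expansion n x)
     = blinfun_apply (\<Sum>j<n. inner (dual_embed \<iota> l) (e j) *\<^sub>R coord j) x"
  by (simp add: partial_expansion_def blinfun.sum_right blinfun.sum_left blinfun.scaleR_left
      blinfun.scaleR_right inner_dual_embed mult.commute)

lemma linear_dual_embed: "linear (dual_embed \<iota>)"
  by (intro linearI dual_embed_eqI)
    (simp_all add: inner_add_left inner_dual_embed blinfun.add_left blinfun.scaleR_left)

text \<open>
  A functional \<open>l\<close> with Riesz vector \<open>h\<close> composed with the reflection has Riesz vector \<open>2 p - h\<close>, where \<open>p\<close> is the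
  orthogonal projection of \<open>h\<close> on the span of the first \<open>n\<close> basis vectors.  This vector has the same norm as \<open>h\<close>.
\<close>
lemma distr_reflection: "distr \<mu> \<mu> (reflection n) = \<mu>"
proof -
  interpret D: prob_space "distr \<mu> \<mu> (reflection n)"
    by (rule prob_space_distr) measurable
  interpret de: linear "dual_embed \<iota>" by (rule linear_dual_embed)
  have norm_eq: "\<exists>l'. norm (dual_embed \<iota> l') = norm (dual_embed \<iota> l) \<and>
     (\<forall>x. blinfun_apply l (reflection n x) = blinfun_apply l' x)" for l :: "'w \<Rightarrow>\<^sub>L real"
  proof -
    define h where "h = dual_embed \<iota> l"
    define q where "q = (\<Sum>j<n. inner h (e j) *\<^sub>R coord j)"
    define p where "p = (\<Sum>j<n. inner h (e j) *\<^sub>R e j)"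
    have "dual_embed \<iota> q = p"
      by (simp add: q_def p_def de.sum de.scaleR dual_embed_coord)
    then have d: "dual_embed \<iota> (2 *\<^sub>R q - l) = 2 *\<^sub>R p - h"
      by (simp add: de.diff de.scaleR h_def)
    have "inner p p = (\<Sum>j<n. (inner h (e j))\<^sup>2)"
      using norm_sum_basis[of "{..<n}" "\<lambda>j. inner h (e j)"] by (simp add: p_def power2_norm_eq_inner)
    also have "\<dots> = inner p h"
      unfolding p_def inner_sum_left by (simp add: power2_eq_square inner_commute)
    finally have "inner p p = inner p h" .
    then have "inner (2 *\<^sub>R p - h) (2 *\<^sub>R p - h) = inner h h"
      by (simp add: inner_diff_left inner_diff_right inner_commute)
    then have "norm (2 *\<^sub>R p - h) = norm h"
      by (simp add: norm_eq_sqrt_inner)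
    moreover have "blinfun_apply l (reflection n x) = blinfun_apply (2 *\<^sub>R q - l) x" for x
      by (simp add: reflection_def blinfun.diff_right blinfun.scaleR_right dual_partial_expansion
          blinfun.diff_left blinfun.scaleR_left q_def h_def)
    ultimately show ?thesis using d h_def by metis
  qed
  have eq: "(\<integral>x. c (blinfun_apply l x) \<partial>distr \<mu> \<mu> (reflection n)) = (\<integral>x. c (blinfun_apply l x) \<partial>\<mu>)"
    if [measurable]: "c \<in> borel_measurable borel" for c :: "real \<Rightarrow> real" and l
  proof -
    obtain l' where l': "norm (dual_embed \<iota> l') = norm (dual_embed \<iota> l)"
      "\<And>x. blinfun_apply l (reflection n x) = blinfun_apply l' x" using norm_eq by blast
    have "(\<integral>x. c (blinfun_apply l x) \<partial>distr \<mu> \<mu> (reflection n)) = (\<integral>x. c (blinfun_apply l' x) \<partial>\<mu>)"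
      by (subst integral_distr) (auto simp: l'(2))
    also have "\<dots> = (\<integral>x. c (blinfun_apply l x) \<partial>\<mu>)"
      by (rule dual_law_cong) (auto simp: l'(1))
    finally show ?thesis .
  qed
  show ?thesis
    by (rule borel_measure_eqI_dual)
      (auto intro!: eq simp: sets_borel D.prob_space_axioms prob_space_axioms)
qed

lemma emeasure_reflection:
  assumes "S \<in> sets \<mu>"
  shows "emeasure \<mu> {x. reflection n x \<in> S} = emeasure \<mu> S"
  using emeasure_distr[of "reflection n" \<mu> \<mu> S] assms by (simp add: distr_reflection vimage_def)

lemma coord_reflection: "j < n \<Longrightarrow> blinfun_apply (coord j) (reflection n x) = blinfun_apply (coord j) x"
  by (simp add: reflection_def blinfun.diff_right blinfun.scaleR_right partial_expansion_def
      blinfun.sum_right coord_embedding inner_basis if_distrib[of "\<lambda>x. _ * x"] cong: if_cong)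

lemma partial_expansion_reflection:
  "k \<le> n \<Longrightarrow> partial_expansion k (reflection n x) = partial_expansion k x"
  unfolding partial_expansion_def by (intro sum.cong) (auto simp: coord_reflection)

definition remainder :: "nat \<Rightarrow> 'w \<Rightarrow> 'w" where
  "remainder n x = x - partial_expansion n x"

lemma remainder_measurable [measurable]: "remainder n \<in> borel_measurable \<mu>"
  unfolding remainder_def by measurable

text \<open>
  The functional \<open>l\<close> of the remainder is Gaussian with standard deviation the distance of the Riesz vector of \<open>l\<close>
  from its \<open>n\<close>-th partial expansion.
\<close>
lemma dual_remainder_null:
  fixes l :: "'w \<Rightarrow>\<^sub>L real"
  assumes "c > 0"
  shows "(\<lambda>n. prob {x. c \<le> \<bar>blinfun_apply l (remainder n x)\<bar>}) \<longlonglongrightarrow> 0"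
proof (rule tendsto_sandwich[OF _ _ tendsto_const])
  interpret de: linear "dual_embed \<iota>" by (rule linear_dual_embed)
  define h where "h = dual_embed \<iota> l"
  have "prob {x. c \<le> \<bar>blinfun_apply l (remainder n x)\<bar>} \<le> (norm (h - (\<Sum>j<n. inner h (e j) *\<^sub>R e j)))\<^sup>2 / c\<^sup>2" for n
    using gaussian_tail[OF assms, of "l - (\<Sum>j<n. inner h (e j) *\<^sub>R coord j)"]
    by (simp add: remainder_def blinfun.diff_right blinfun.diff_left dual_partial_expansion
        de.diff de.sum de.scaleR dual_embed_coord h_def)
  then show "\<forall>\<^sub>F n in sequentially. prob {x. c \<le> \<bar>blinfun_apply l (remainder n x)\<bar>}
       \<le> (norm (h - (\<Sum>j<n. inner h (e j) *\<^sub>R e j)))\<^sup>2 / c\<^sup>2" by simp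
  have "(\<lambda>n. \<Sum>j<n. inner h (e j) *\<^sub>R e j) \<longlonglongrightarrow> h"
    using basis_expansion[of h] by (simp add: sums_def)
  then have "(\<lambda>n. (norm (h - (\<Sum>j<n. inner h (e j) *\<^sub>R e j)))\<^sup>2 / c\<^sup>2) \<longlonglongrightarrow> (norm (h - h))\<^sup>2 / c\<^sup>2"
    by (intro tendsto_intros) (use assms in auto)
  then show "(\<lambda>n. (norm (h - (\<Sum>j<n. inner h (e j) *\<^sub>R e j)))\<^sup>2 / c\<^sup>2) \<longlonglongrightarrow> 0" by simp
qed simp

text \<open>
  If \<open>x\<close> and its reflection lie in a compact set \<open>K\<close> of large measure, the remainder, half their
  difference, lies in the compact set \<open>(K - K) / 2\<close>.  The part of that set outside a ball around \<open>0\<close> is covered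
  by finitely many sets \<open>{x. 1 < \<bar>l x\<bar>}\<close>, each of which the remainder enters with small probability.
\<close>
lemma remainder_null:
  assumes "a > 0"
  shows "(\<lambda>n. prob {x. a \<le> norm (remainder n x)}) \<longlonglongrightarrow> 0"
proof (rule LIMSEQ_I)
  fix \<epsilon> :: real assume "\<epsilon> > 0"
  have "emeasure \<mu> UNIV = (SUP K \<in> {K. K \<subseteq> UNIV \<and> compact K}. emeasure \<mu> K)"
    by (rule inner_regular[OF sets_borel]) auto
  moreover have "emeasure \<mu> UNIV = 1" using emeasure_space_1 by simp
  moreover have "ennreal (1 - \<epsilon> / 4) < 1" using \<open>\<epsilon> > 0\<close> by (simp add: ennreal_less_one_iff)
  ultimately have "ennreal (1 - \<epsilon> / 4) < (SUP K \<in> {K. K \<subseteq> UNIV \<and> compact K}. emeasure \<mu> K)" by simp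
  then obtain K where K: "compact K" "ennreal (1 - \<epsilon> / 4) < emeasure \<mu> K"
    unfolding less_SUP_iff by auto
  have [measurable]: "K \<in> sets \<mu>" using compact_imp_closed[OF K(1)] by (simp add: sets_borel)
  have "1 - \<epsilon> / 4 < prob K"
  proof (cases "1 - \<epsilon> / 4 \<ge> 0")
    case True
    then show ?thesis using K(2) by (simp add: emeasure_eq_measure ennreal_less_iff del: ennreal_minus)
  next
    case False
    then show ?thesis using measure_nonneg[of \<mu> K] by linarith
  qed
  then have pK: "prob (- K) < \<epsilon> / 4"
    using prob_compl[of K] by (simp add: Compl_eq_Diff_UNIV)
  have mK [measurable]: "- K \<in> sets \<mu>" using sets.compl_sets[of K \<mu>] by (simp add: Compl_eq_Diff_UNIV)
  have mR: "{x. reflection n x \<in> - K} \<in> sets \<mu>" for n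
    by (intro Collect_sets_\<mu>) measurable
  have mL: "{x. 1 \<le> \<bar>blinfun_apply l (remainder n x)\<bar>} \<in> sets \<mu>" for l :: "'w \<Rightarrow>\<^sub>L real" and n
  proof -
    have [measurable]: "blinfun_apply l \<in> borel_measurable borel"
      by (intro borel_measurable_continuous_onI continuous_intros)
    show ?thesis by (intro Collect_sets_\<mu>) measurable
  qed
  have pK': "prob {x. reflection n x \<in> - K} < \<epsilon> / 4" for n
    using emeasure_reflection[OF \<open>- K \<in> sets \<mu>\<close>, of n] pK by (simp add: emeasure_eq_measure del: Compl_iff)
  define C where "C = (\<lambda>p. (1/2) *\<^sub>R (fst p - snd p)) ` (K \<times> K) \<inter> {x. a \<le> norm x}"
  have "compact C"
    unfolding C_def
    by (rule compact_Int_closed[OF compact_continuous_image[OF _ compact_Times[OF K(1) K(1)]]])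
      (intro continuous_intros closed_Collect_le)+
  moreover have "C \<subseteq> (\<Union>l\<in>(UNIV :: ('w \<Rightarrow>\<^sub>L real) set). {x. 1 < \<bar>blinfun_apply l x\<bar>})"
  proof
    fix x assume "x \<in> C"
    then have "x \<noteq> 0" using assms by (auto simp: C_def)
    then obtain l :: "'w \<Rightarrow>\<^sub>L real" where l: "blinfun_apply l x \<noteq> 0" by (rule dual_separates_points)
    then have "1 < \<bar>blinfun_apply ((2 / blinfun_apply l x) *\<^sub>R l) x\<bar>"
      by (simp add: blinfun.scaleR_left)
    then show "x \<in> (\<Union>l\<in>(UNIV :: ('w \<Rightarrow>\<^sub>L real) set). {x. 1 < \<bar>blinfun_apply l x\<bar>})" by blast
  qed
  moreover have "open {x. 1 < \<bar>blinfun_apply l x\<bar>}" for l :: "'w \<Rightarrow>\<^sub>L real"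
    by (intro open_Collect_less continuous_intros)
  ultimately obtain F :: "('w \<Rightarrow>\<^sub>L real) set" where F: "finite F" "C \<subseteq> (\<Union>l\<in>F. {x. 1 < \<bar>blinfun_apply l x\<bar>})"
    using compactE_image[of C UNIV "\<lambda>l :: 'w \<Rightarrow>\<^sub>L real. {x. 1 < \<bar>blinfun_apply l x\<bar>}"] by metis
  have "(\<lambda>n. \<Sum>l\<in>F. prob {x. 1 \<le> \<bar>blinfun_apply l (remainder n x)\<bar>}) \<longlonglongrightarrow> (\<Sum>l\<in>F. 0)"
    by (intro tendsto_sum dual_remainder_null) simp
  then have "\<forall>\<^sub>F n in sequentially. (\<Sum>l\<in>F. prob {x. 1 \<le> \<bar>blinfun_apply l (remainder n x)\<bar>}) < \<epsilon> / 4"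
    using \<open>\<epsilon> > 0\<close> by (intro order_tendstoD) auto
  then obtain N where N: "\<And>n. n \<ge> N \<Longrightarrow> (\<Sum>l\<in>F. prob {x. 1 \<le> \<bar>blinfun_apply l (remainder n x)\<bar>}) < \<epsilon> / 4"
    unfolding eventually_sequentially by blast
  have "prob {x. a \<le> norm (remainder n x)} < \<epsilon>" if "n \<ge> N" for n
  proof -
    have sub: "{x. a \<le> norm (remainder n x)} \<subseteq>
      (- K \<union> {x. reflection n x \<in> - K}) \<union> (\<Union>l\<in>F. {x. 1 \<le> \<bar>blinfun_apply l (remainder n x)\<bar>})"
    proof
      fix x assume x: "x \<in> {x. a \<le> norm (remainder n x)}"
      show "x \<in> (- K \<union> {x. reflection n x \<in> - K}) \<union> (\<Union>l\<in>F. {x. 1 \<le> \<bar>blinfun_apply l (remainder n x)\<bar>})"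
      proof (cases "x \<in> K \<and> reflection n x \<in> K")
        case True
        have "remainder n x = (1/2) *\<^sub>R (x - reflection n x)"
          by (simp add: remainder_def reflection_def algebra_simps flip: scaleR_left.add)
        then have "remainder n x \<in> C"
          using True x unfolding C_def by force
        then show ?thesis using F(2) by force
      qed auto
    qed
    have "prob {x. a \<le> norm (remainder n x)} \<le>
      prob ((- K \<union> {x. reflection n x \<in> - K}) \<union> (\<Union>l\<in>F. {x. 1 \<le> \<bar>blinfun_apply l (remainder n x)\<bar>}))"
      by (intro finite_measure_mono sub sets.Un sets.finite_UN mK mR mL F(1))
    also have "\<dots> \<le> prob (- K \<union> {x. reflection n x \<in> - K}) + prob (\<Union>l\<in>F. {x. 1 \<le> \<bar>blinfun_apply l (remainder n x)\<bar>})"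
      by (intro measure_Un_le sets.Un sets.finite_UN mK mR mL F(1))
    also have "prob (- K \<union> {x. reflection n x \<in> - K}) \<le> prob (- K) + prob {x. reflection n x \<in> - K}"
      by (intro measure_Un_le mK mR)
    also have "prob (\<Union>l\<in>F. {x. 1 \<le> \<bar>blinfun_apply l (remainder n x)\<bar>}) \<le> (\<Sum>l\<in>F. prob {x. 1 \<le> \<bar>blinfun_apply l (remainder n x)\<bar>})"
      by (intro measure_UNION_le mL F(1))
    finally show ?thesis using pK pK'[of n] N[OF that] \<open>\<epsilon> > 0\<close> by simp
  qed
  then show "\<exists>N. \<forall>n\<ge>N. norm (prob {x. a \<le> norm (remainder n x)} - 0) < \<epsilon>" by auto
qed

text \<open>
  Levy's argument.  On the event \<open>S n\<close> that the bound is first exceeded at time \<open>n\<close>, the increment is the mean of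
  the remainder at \<open>x\<close> and at the reflection of \<open>x\<close>, so one of these exceeds the bound.  The reflection at level
  \<open>m + n\<close> preserves \<open>\<mu>\<close> and leaves \<open>S n\<close> invariant.
\<close>
lemma maximal_inequality:
  assumes "a > 0"
  shows "emeasure \<mu> {x. \<exists>n. a < norm (partial_expansion (m + n) x - partial_expansion m x)}
       \<le> 2 * emeasure \<mu> {x. a < norm (remainder m x)}"
proof -
  define D where "D n x = norm (partial_expansion (m + n) x - partial_expansion m x)" for n x
  have [measurable]: "D n \<in> borel_measurable \<mu>" for n
    unfolding D_def by measurable
  define S where "S n = {x. a < D n x \<and> (\<forall>k<n. D k x \<le> a)}" for n
  define B where "B = {x. a < norm (remainder m x)}"
  have "{x\<in>space \<mu>. a < D n x \<and> (\<forall>k<n. D k x \<le> a)} \<in> sets \<mu>" "{x\<in>space \<mu>. a < norm (remainder m x)} \<in> sets \<mu>" for n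
    by measurable
  then have [measurable]: "S n \<in> sets \<mu>" "B \<in> sets \<mu>" for n
    by (simp_all add: S_def B_def)
  have un: "{x. \<exists>n. a < norm (partial_expansion (m + n) x - partial_expansion m x)} = (\<Union>n. S n)"
  proof (intro set_eqI iffI)
    fix x assume "x \<in> {x. \<exists>n. a < norm (partial_expansion (m + n) x - partial_expansion m x)}"
    then have ex: "\<exists>n. a < D n x" by (simp add: D_def)
    define n where "n = (LEAST n. a < D n x)"
    have "a < D n x" unfolding n_def by (rule LeastI_ex[OF ex])
    moreover have "D k x \<le> a" if "k < n" for k
      using not_less_Least[of k "\<lambda>n. a < D n x"] that by (auto simp: n_def not_less)
    ultimately show "x \<in> (\<Union>n. S n)" by (auto simp: S_def)
  qed (auto simp: S_def D_def)
  have disj: "disjoint_family S"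
    unfolding disjoint_family_on_def
  proof (intro ballI impI)
    fix i j :: nat assume "i \<noteq> j"
    then show "S i \<inter> S j = {}"
      by (cases i j rule: linorder_cases) (auto simp: S_def not_le dest!: spec)
  qed
  have inv: "D k (reflection (m + n) x) = D k x" if "k \<le> n" for k n x
    using that by (simp add: D_def partial_expansion_reflection)
  have le: "emeasure \<mu> (S n) \<le> 2 * emeasure \<mu> (S n \<inter> B)" for n
  proof -
    have "S n \<subseteq> (S n \<inter> B) \<union> {x. reflection (m + n) x \<in> S n \<inter> B}"
    proof
      fix x assume x: "x \<in> S n"
      let ?y = "reflection (m + n) x"
      have "?y \<in> S n" using x inv[of _ n x] by (auto simp: S_def)
      have "2 *\<^sub>R (partial_expansion (m + n) x - partial_expansion m x) = remainder m x + remainder m ?y"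
        by (simp add: remainder_def partial_expansion_reflection) (simp add: reflection_def algebra_simps scaleR_2)
      then have "2 * D n x = norm (remainder m x + remainder m ?y)"
        unfolding D_def by (metis norm_scaleR abs_numeral)
      also have "\<dots> \<le> norm (remainder m x) + norm (remainder m ?y)" by (rule norm_triangle_ineq)
      finally have "a < norm (remainder m x) \<or> a < norm (remainder m ?y)"
        using x by (auto simp: S_def)
      then show "x \<in> (S n \<inter> B) \<union> {x. reflection (m + n) x \<in> S n \<inter> B}"
        using x \<open>?y \<in> S n\<close> by (auto simp: B_def)
    qed
    then have "emeasure \<mu> (S n) \<le> emeasure \<mu> ((S n \<inter> B) \<union> {x. reflection (m + n) x \<in> S n \<inter> B})"
      by (intro emeasure_mono sets.Un Collect_sets_\<mu>) measurable
    also have "\<dots> \<le> emeasure \<mu> (S n \<inter> B) + emeasure \<mu> {x. reflection (m + n) x \<in> S n \<inter> B}"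
      by (intro emeasure_subadditive Collect_sets_\<mu>) measurable
    also have "\<dots> = 2 * emeasure \<mu> (S n \<inter> B)"
      by (subst emeasure_reflection) (auto simp: mult_2)
    finally show ?thesis .
  qed
  have "emeasure \<mu> (\<Union>n. S n) = (\<Sum>n. emeasure \<mu> (S n))"
    using disj by (intro suminf_emeasure[symmetric]) auto
  also have "\<dots> \<le> (\<Sum>n. 2 * emeasure \<mu> (S n \<inter> B))"
    by (intro suminf_le le) auto
  also have "\<dots> = 2 * (\<Sum>n. emeasure \<mu> (S n \<inter> B))"
    by (rule ennreal_suminf_cmult)
  also have "(\<Sum>n. emeasure \<mu> (S n \<inter> B)) = emeasure \<mu> (\<Union>n. S n \<inter> B)"
    using disj by (intro suminf_emeasure) (auto simp: disjoint_family_on_def)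
  also have "\<dots> \<le> emeasure \<mu> B"
    by (intro emeasure_mono) auto
  finally show ?thesis
    unfolding un B_def by (simp add: mult_left_mono)
qed

text \<open>
  The maximal inequality bounds the probability that some later partial sum is far from \<open>x\<close> by three times
  the probability that the \<open>m\<close>-th remainder is large.
\<close>
lemma partial_expansion_tendsto: "AE x in \<mu>. (\<lambda>n. partial_expansion n x) \<longlonglongrightarrow> x"
proof -
  have "AE x in \<mu>. \<exists>m. \<forall>n\<ge>m. norm (partial_expansion n x - x) \<le> 2 * a" if "a > 0" for a
  proof -
    define Z where "Z = {x. \<forall>m. \<exists>n\<ge>m. 2 * a < norm (partial_expansion n x - x)}"
    have "{x\<in>space \<mu>. \<forall>m. \<exists>n\<ge>m. 2 * a < norm (partial_expansion n x - x)} \<in> sets \<mu>"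
      by measurable
    then have [measurable]: "Z \<in> sets \<mu>" by (simp add: Z_def)
    have "prob Z \<le> 3 * prob {x. a \<le> norm (remainder m x)}" for m
    proof -
      have "Z \<subseteq> {x. a < norm (remainder m x)} \<union> {x. \<exists>n. a < norm (partial_expansion (m + n) x - partial_expansion m x)}"
      proof
        fix x assume "x \<in> Z"
        then obtain n where "2 * a < norm (partial_expansion (m + n) x - x)"
          unfolding Z_def by (auto simp: le_iff_add)
        also have "\<dots> \<le> norm (partial_expansion (m + n) x - partial_expansion m x) + norm (remainder m x)"
          using norm_triangle_ineq4[of "partial_expansion (m + n) x - partial_expansion m x" "remainder m x"]
          by (simp add: remainder_def)
        finally show "x \<in> {x. a < norm (remainder m x)} \<union> {x. \<exists>n. a < norm (partial_expansion (m + n) x - partial_expansion m x)}"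
          by (smt (verit) UnI1 UnI2 mem_Collect_eq)
      qed
      then have "emeasure \<mu> Z \<le> emeasure \<mu> ({x. a < norm (remainder m x)} \<union> {x. \<exists>n. a < norm (partial_expansion (m + n) x - partial_expansion m x)})"
        by (intro emeasure_mono sets.Un Collect_sets_\<mu>) measurable
      also have "\<dots> \<le> emeasure \<mu> {x. a < norm (remainder m x)} + emeasure \<mu> {x. \<exists>n. a < norm (partial_expansion (m + n) x - partial_expansion m x)}"
        by (intro emeasure_subadditive Collect_sets_\<mu>) measurable
      also have "\<dots> \<le> emeasure \<mu> {x. a < norm (remainder m x)} + 2 * emeasure \<mu> {x. a < norm (remainder m x)}"
        by (intro add_left_mono maximal_inequality that)
      also have "\<dots> = 3 * emeasure \<mu> {x. a < norm (remainder m x)}"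
        using distrib_right[of 1 2 "emeasure \<mu> {x. a < norm (remainder m x)}"] by simp
      also have "\<dots> \<le> 3 * emeasure \<mu> {x. a \<le> norm (remainder m x)}"
        by (intro mult_left_mono emeasure_mono Collect_sets_\<mu>) (auto, measurable)
      finally show ?thesis
        by (simp add: emeasure_eq_measure ennreal_mult[symmetric] flip: ennreal_numeral)
    qed
    moreover have "(\<lambda>m. 3 * prob {x. a \<le> norm (remainder m x)}) \<longlonglongrightarrow> 3 * 0"
      by (intro tendsto_intros remainder_null that)
    ultimately have "prob Z \<le> 0"
      by (intro LIMSEQ_le_const[of "\<lambda>m. 3 * prob {x. a \<le> norm (remainder m x)}" 0]) auto
    then have "emeasure \<mu> Z = 0" by (simp add: emeasure_eq_measure measure_le_0_iff)
    then have "AE x in \<mu>. x \<notin> Z" by (intro AE_not_in) (auto simp: null_sets_def)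
    then show ?thesis by eventually_elim (auto simp: Z_def not_less)
  qed
  then have "AE x in \<mu>. \<forall>i. \<exists>m. \<forall>n\<ge>m. norm (partial_expansion n x - x) \<le> 2 * inverse (real (Suc i))"
    unfolding AE_all_countable by (intro allI) simp
  then show ?thesis
  proof eventually_elim
    fix x assume x: "\<forall>i. \<exists>m. \<forall>n\<ge>m. norm (partial_expansion n x - x) \<le> 2 * inverse (real (Suc i))"
    show "(\<lambda>n. partial_expansion n x) \<longlonglongrightarrow> x"
    proof (rule LIMSEQ_I)
      fix r :: real assume "r > 0"
      then obtain i where i: "inverse (real (Suc i)) < r / 2" using reals_Archimedean[of "r/2"] by auto
      obtain m where m: "\<And>n. n \<ge> m \<Longrightarrow> norm (partial_expansion n x - x) \<le> 2 * inverse (real (Suc i))"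
        using x by blast
      have "norm (partial_expansion n x - x) < r" if "n \<ge> m" for n
        using m[OF that] i by linarith
      then show "\<exists>m. \<forall>n\<ge>m. norm (partial_expansion n x - x) < r" by blast
    qed
  qed
qed

end

section \<open>Calculus of smooth functionals\<close>

text \<open>
  A coinductive criterion: it suffices to find a class of bounded continuous functions of the first \<open>n\<close>
  coordinates that contains its own partial derivatives.
\<close>
lemma Cb_infinityI:
  assumes S: "\<And>\<phi>. \<phi> \<in> S \<Longrightarrow> (\<forall>x y. (\<forall>k<n. x k = y k) \<longrightarrow> \<phi> x = \<phi> y) \<and> bounded (range \<phi>) \<and> continuous_on UNIV \<phi>"
    and D: "\<And>\<phi> k. \<phi> \<in> S \<Longrightarrow> k < n \<Longrightarrow>
      \<exists>\<psi>\<in>S. \<forall>x. ((\<lambda>s. \<phi> (x(k := s))) has_real_derivative \<psi> x) (at (x k))"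
    and \<phi>: "\<phi> \<in> S"
  shows "\<phi> \<in> Cb_infinity n"
proof -
  have pd: "partial_deriv k \<psi> \<in> S" if "\<psi> \<in> S" "k < n" for \<psi> k
  proof -
    obtain \<theta> where \<theta>: "\<theta> \<in> S" "\<And>x. ((\<lambda>s. \<psi> (x(k := s))) has_real_derivative \<theta> x) (at (x k))"
      using D[OF \<open>\<psi> \<in> S\<close> \<open>k < n\<close>] by blast
    then have "partial_deriv k \<psi> = \<theta>"
      by (auto simp: fun_eq_iff partial_deriv_def intro: DERIV_imp_deriv)
    then show ?thesis using \<theta> by simp
  qed
  have "foldr partial_deriv ks \<phi> \<in> S" if "set ks \<subseteq> {..<n}" for ks
    using that by (induction ks) (auto simp: \<phi> intro: pd)
  moreover have "(\<lambda>s. \<psi> (x(k := s))) differentiable (at (x k))" if "\<psi> \<in> S" "k < n" for \<psi> k x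
    using D[OF that] by (auto simp: real_differentiable_def)
  ultimately show ?thesis
    using S \<phi> unfolding Cb_infinity_def Let_def by blast
qed

lemma Cb_infinityD:
  assumes "\<phi> \<in> Cb_infinity n"
  shows "(\<And>k. k < n \<Longrightarrow> x k = y k) \<Longrightarrow> \<phi> x = \<phi> y" "bounded (range \<phi>)" "continuous_on UNIV \<phi>"
proof -
  have *: "\<forall>x y. (\<forall>k<n. x k = y k) \<longrightarrow> \<phi> x = \<phi> y"
    "\<forall>ks. set ks \<subseteq> {..<n} \<longrightarrow> bounded (range (foldr partial_deriv ks \<phi>)) \<and> continuous_on UNIV (foldr partial_deriv ks \<phi>)"
    using assms by (auto simp: Cb_infinity_def Let_def)
  show "bounded (range \<phi>)" "continuous_on UNIV \<phi>" using *(2)[rule_format, of "[]"] by auto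
  show "\<phi> x = \<phi> y" if "\<And>k. k < n \<Longrightarrow> x k = y k" using *(1) that by blast
qed

lemma Cb_infinity_has_partial:
  assumes "\<phi> \<in> Cb_infinity n" "k < n"
  shows "((\<lambda>s. \<phi> (x(k := s))) has_real_derivative partial_deriv k \<phi> (x(k := t))) (at t)"
proof -
  have *: "\<forall>ks. set ks \<subseteq> {..<n} \<longrightarrow> (\<forall>k<n. \<forall>x. (\<lambda>s. foldr partial_deriv ks \<phi> (x(k := s))) differentiable (at (x k)))"
    using assms by (auto simp: Cb_infinity_def Let_def)
  have "(\<lambda>s. \<phi> ((x(k := t))(k := s))) differentiable (at ((x(k := t)) k))"
    using *[rule_format, of "[]" k "x(k := t)"] assms(2) by simp
  then show ?thesis
    by (simp add: partial_deriv_def DERIV_deriv_iff_real_differentiable)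
qed

lemma Cb_infinity_partial_deriv:
  assumes "\<phi> \<in> Cb_infinity n" "k < n"
  shows "partial_deriv k \<phi> \<in> Cb_infinity n"
  unfolding Cb_infinity_def mem_Collect_eq
proof (intro conjI allI impI)
  fix x y :: "nat \<Rightarrow> real" assume xy: "\<forall>k<n. x k = y k"
  have "\<phi> (x(k := s)) = \<phi> (y(k := s))" for s
    by (rule Cb_infinityD(1)[OF assms(1)]) (use xy in auto)
  then show "partial_deriv k \<phi> x = partial_deriv k \<phi> y"
    using xy assms(2) by (simp add: partial_deriv_def)
next
  fix ks assume ks: "set ks \<subseteq> {..<n}"
  have *: "\<forall>ks. set ks \<subseteq> {..<n} \<longrightarrow> (let \<phi>' = foldr partial_deriv ks \<phi> in
           bounded (range \<phi>') \<and> continuous_on UNIV \<phi>' \<and>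
           (\<forall>k<n. \<forall>x. (\<lambda>s. \<phi>' (x(k := s))) differentiable (at (x k))))"
    using assms(1) by (simp add: Cb_infinity_def)
  show "let \<phi>' = foldr partial_deriv ks (partial_deriv k \<phi>) in
           bounded (range \<phi>') \<and> continuous_on UNIV \<phi>' \<and>
           (\<forall>k<n. \<forall>x. (\<lambda>s. \<phi>' (x(k := s))) differentiable (at (x k)))"
    using *[rule_format, of "ks @ [k]"] ks assms(2) by simp
qed

text \<open>
  A class to which the coinductive criterion applies because, by the product and chain rules, it is closed under
  partial derivatives; the derivative of the cosine is a cosine with shifted argument.
\<close>
inductive_set trig_algebra :: "nat \<Rightarrow> ((nat \<Rightarrow> real) \<Rightarrow> real) set" for n where
  base: "\<phi> \<in> Cb_infinity n \<Longrightarrow> \<phi> \<in> trig_algebra n"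
| const: "(\<lambda>x. c) \<in> trig_algebra n"
| add: "\<phi> \<in> trig_algebra n \<Longrightarrow> \<psi> \<in> trig_algebra n \<Longrightarrow> (\<lambda>x. \<phi> x + \<psi> x) \<in> trig_algebra n"
| mult: "\<phi> \<in> trig_algebra n \<Longrightarrow> \<psi> \<in> trig_algebra n \<Longrightarrow> (\<lambda>x. \<phi> x * \<psi> x) \<in> trig_algebra n"
| cos: "\<phi> \<in> trig_algebra n \<Longrightarrow> (\<lambda>x. cos (\<phi> x)) \<in> trig_algebra n"

lemma trig_algebra_subset: "trig_algebra n \<subseteq> Cb_infinity n"
proof
  fix \<phi> assume "\<phi> \<in> trig_algebra n"
  then show "\<phi> \<in> Cb_infinity n"
  proof (rule Cb_infinityI[rotated 2])
    fix \<phi> assume "\<phi> \<in> trig_algebra n"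
    then show "(\<forall>x y. (\<forall>k<n. x k = y k) \<longrightarrow> \<phi> x = \<phi> y) \<and> bounded (range \<phi>) \<and> continuous_on UNIV \<phi>"
    proof induction
      case (base \<phi>)
      then show ?case using Cb_infinityD[OF base] by blast
    next
      case (add \<phi> \<psi>)
      then have "bounded (range (\<lambda>x. \<phi> x + \<psi> x))" by (intro bounded_plus_comp) auto
      with add show ?case by (auto intro!: continuous_intros arg_cong2[where f = "(+)"])
    next
      case (mult \<phi> \<psi>)
      obtain B C where B: "\<And>x. norm (\<phi> x) \<le> B" and C: "\<And>x. norm (\<psi> x) \<le> C"
        using mult unfolding bounded_iff by blast
      have "norm (\<phi> x * \<psi> x) \<le> B * C" for x
        unfolding norm_mult
        by (intro mult_mono B C order_trans[OF norm_ge_zero B]) auto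
      then have "bounded (range (\<lambda>x. \<phi> x * \<psi> x))" unfolding bounded_iff by blast
      with mult show ?case by (auto intro!: continuous_intros arg_cong2[where f = "(*)"])
    next
      case (cos \<phi>)
      have "bounded (range (\<lambda>x. cos (\<phi> x)))" unfolding bounded_iff by (auto intro!: exI[of _ 1])
      with cos show ?case by (auto intro!: continuous_intros arg_cong[where f = cos])
    qed auto
    fix k assume "k < n"
    show "\<exists>\<psi>\<in>trig_algebra n. \<forall>x. ((\<lambda>s. \<phi> (x(k := s))) has_real_derivative \<psi> x) (at (x k))"
      using \<open>\<phi> \<in> trig_algebra n\<close>
    proof induction
      case (base \<phi>)
      have "\<forall>x. ((\<lambda>s. \<phi> (x(k := s))) has_real_derivative partial_deriv k \<phi> x) (at (x k))"
      proof
        fix x show "((\<lambda>s. \<phi> (x(k := s))) has_real_derivative partial_deriv k \<phi> x) (at (x k))"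
          using Cb_infinity_has_partial[OF base \<open>k < n\<close>, of x "x k"] by (simp only: fun_upd_triv)
      qed
      then show ?case
        using trig_algebra.base[OF Cb_infinity_partial_deriv[OF base \<open>k < n\<close>]] by blast
    next
      case (const c)
      show ?case by (intro bexI[of _ "\<lambda>x. 0"]) (auto intro: trig_algebra.const)
    next
      case (add \<phi> \<psi>)
      then obtain \<phi>' \<psi>' where *: "\<phi>' \<in> trig_algebra n" "\<psi>' \<in> trig_algebra n"
        "\<And>x. ((\<lambda>s. \<phi> (x(k := s))) has_real_derivative \<phi>' x) (at (x k))"
        "\<And>x. ((\<lambda>s. \<psi> (x(k := s))) has_real_derivative \<psi>' x) (at (x k))" by blast
      show ?case
        by (rule bexI[OF _ trig_algebra.add[OF *(1,2)]]) (intro allI DERIV_add *)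
    next
      case (mult \<phi> \<psi>)
      then obtain \<phi>' \<psi>' where *: "\<phi>' \<in> trig_algebra n" "\<psi>' \<in> trig_algebra n"
        "\<And>x. ((\<lambda>s. \<phi> (x(k := s))) has_real_derivative \<phi>' x) (at (x k))"
        "\<And>x. ((\<lambda>s. \<psi> (x(k := s))) has_real_derivative \<psi>' x) (at (x k))" by blast
      have "((\<lambda>s. \<phi> (x(k := s)) * \<psi> (x(k := s))) has_real_derivative \<phi>' x * \<psi> x + \<psi>' x * \<phi> x) (at (x k))" for x
        using DERIV_mult[OF *(3,4)[of x]] by (simp only: fun_upd_triv)
      moreover have "(\<lambda>x. \<phi>' x * \<psi> x + \<psi>' x * \<phi> x) \<in> trig_algebra n"
        using * mult.hyps by (intro trig_algebra.add trig_algebra.mult)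
      ultimately show ?case by (intro bexI[of _ "\<lambda>x. \<phi>' x * \<psi> x + \<psi>' x * \<phi> x"] allI)
    next
      case (cos \<phi>)
      then obtain \<phi>' where *: "\<phi>' \<in> trig_algebra n"
        "\<And>x. ((\<lambda>s. \<phi> (x(k := s))) has_real_derivative \<phi>' x) (at (x k))" by blast
      have sin: "- sin z = cos (z + pi / 2)" for z :: real by (simp add: cos_add)
      have "((\<lambda>s. cos (\<phi> (x(k := s)))) has_real_derivative cos (\<phi> x + pi / 2) * \<phi>' x) (at (x k))" for x
        using DERIV_fun_cos[OF *(2)[of x]] by (simp only: fun_upd_triv sin)
      moreover have "(\<lambda>x. cos (\<phi> x + pi / 2) * \<phi>' x) \<in> trig_algebra n"
        using * cos.hyps by (intro trig_algebra.mult trig_algebra.cos trig_algebra.add trig_algebra.const)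
      ultimately show ?case by (intro bexI[of _ "\<lambda>x. cos (\<phi> x + pi / 2) * \<phi>' x"] allI)
    qed
  qed
qed

text \<open>
  Used to write two smooth functionals as functions of a common list of continuous functionals.  A partial
  derivative in a coordinate outside the range of the shift is zero, hence the additional member of \<open>S\<close>.
\<close>
lemma Cb_infinity_shift:
  assumes "\<phi> \<in> Cb_infinity n" and le: "n + c \<le> N"
  shows "(\<lambda>x. \<phi> (\<lambda>i. x (i + c))) \<in> Cb_infinity N"
proof -
  define S where "S = insert (\<lambda>_. 0) {(\<lambda>x. \<psi> (\<lambda>i. x (i + c))) |\<psi>. \<psi> \<in> Cb_infinity n}"
  have "(\<lambda>x. \<phi> (\<lambda>i. x (i + c))) \<in> S" using assms by (auto simp: S_def)
  then show ?thesis
  proof (rule Cb_infinityI[rotated 2])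
    fix \<theta> assume "\<theta> \<in> S"
    then consider "\<theta> = (\<lambda>_. 0)" | \<psi> where "\<psi> \<in> Cb_infinity n" "\<theta> = (\<lambda>x. \<psi> (\<lambda>i. x (i + c)))"
      by (auto simp: S_def)
    note cases = this
    from cases show "(\<forall>x y. (\<forall>k<N. x k = y k) \<longrightarrow> \<theta> x = \<theta> y) \<and> bounded (range \<theta>) \<and> continuous_on UNIV \<theta>"
    proof cases
      case (2 \<psi>)
      have "continuous_on UNIV (\<lambda>x (i::nat). x (i + c) :: real)"
        by (intro continuous_on_coordinatewise_then_product continuous_on_product_coordinates)
      then have "continuous_on UNIV \<theta>"
        unfolding 2 by (rule continuous_on_compose2[OF Cb_infinityD(3)[OF 2(1)]]) auto
      moreover have "bounded (range \<theta>)"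
        unfolding 2 by (rule bounded_subset[OF Cb_infinityD(2)[OF 2(1)]]) auto
      moreover have "\<forall>x y. (\<forall>k<N. x k = y k) \<longrightarrow> \<theta> x = \<theta> y"
        unfolding 2 using le by (auto intro!: Cb_infinityD(1)[OF 2(1)])
      ultimately show ?thesis by blast
    qed auto
    fix k assume "k < N"
    from cases show "\<exists>\<psi>\<in>S. \<forall>x. ((\<lambda>s. \<theta> (x(k := s))) has_real_derivative \<psi> x) (at (x k))"
    proof cases
      case 1
      then show ?thesis by (auto simp: S_def intro!: bexI[of _ "\<lambda>_. 0"])
    next
      case (2 \<psi>)
      show ?thesis
      proof (cases "c \<le> k \<and> k < n + c")
        case True
        then have k: "k - c < n" by auto
        have upd: "(\<lambda>i. (x(k := s)) (i + c)) = (\<lambda>i. x (i + c))(k - c := s)" for x :: "nat \<Rightarrow> real" and s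
          using True by (auto simp: fun_eq_iff)
        have "((\<lambda>s. \<theta> (x(k := s))) has_real_derivative partial_deriv (k - c) \<psi> (\<lambda>i. x (i + c))) (at (x k))" for x
          using Cb_infinity_has_partial[OF 2(1) k, of "\<lambda>i. x (i + c)" "x k"] True
          unfolding 2 upd by (simp add: fun_upd_idem)
        then show ?thesis
          using Cb_infinity_partial_deriv[OF 2(1) k]
          by (intro bexI[of _ "\<lambda>x. partial_deriv (k - c) \<psi> (\<lambda>i. x (i + c))"]) (auto simp: S_def)
      next
        case False
        have "\<theta> (x(k := s)) = \<theta> x" for x s
          unfolding 2 using False by (intro Cb_infinityD(1)[OF 2(1)]) auto
        then show ?thesis by (auto simp: S_def intro!: bexI[of _ "\<lambda>_. 0"])
      qed
    qed
  qed
qed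

text \<open>
  The chain rule from partial derivatives: the coordinates are moved along the line one after the other, by
  induction on the number \<open>m\<close> of moving coordinates, and continuity of the next partial derivative permits
  combining it with the derivative in the first \<open>m\<close> coordinates.
\<close>
lemma Cb_infinity_line_derivative:
  assumes \<phi>: "\<phi> \<in> Cb_infinity n"
  shows "((\<lambda>s. \<phi> (\<lambda>k. x k + s * v k)) has_real_derivative (\<Sum>k<n. partial_deriv k \<phi> x * v k)) (at 0)"
proof -
  define y where "y m x s = (\<lambda>k. if k < m then x k + s * v k else x k)" for m x and s :: real
  have "((\<lambda>s. \<phi> (y m x s)) has_real_derivative (\<Sum>k<m. partial_deriv k \<phi> (y m x s) * v k)) (at s)"
    if "m \<le> n" for m x s
    using that
  proof (induction m arbitrary: x s)
    case 0
    then show ?case by (simp add: y_def)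
  next
    case (Suc m)
    then have m: "m < n" by simp
    define g where "g a b = \<phi> (y m (x(m := x m + b * v m)) a)" for a b
    have diag: "g a a = \<phi> (y (Suc m) x a)" for a
      unfolding g_def y_def by (rule arg_cong[of _ _ \<phi>]) (auto simp: fun_eq_iff less_Suc_eq)
    have split: "y m (x(m := x m + b * v m)) a = (y m x a)(m := x m + b * v m)" for a b
      by (auto simp: y_def fun_eq_iff)
    define d where "d a b = partial_deriv m \<phi> (y m (x(m := x m + b * v m)) a) * v m" for a b
    have "((\<lambda>(a, b). g a b) has_derivative (\<lambda>(ta, tb).
        (\<Sum>k<m. partial_deriv k \<phi> (y m (x(m := x m + s * v m)) s) * v k) * ta + blinfun_mult_right (d s s) tb))
        (at (s, s) within UNIV \<times> UNIV)"
    proof (rule has_derivative_partialsI[where f = g and fy = "\<lambda>a b. blinfun_mult_right (d a b)"])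
      show "((\<lambda>a. g a s) has_derivative (\<lambda>ta. (\<Sum>k<m. partial_deriv k \<phi> (y m (x(m := x m + s * v m)) s) * v k) * ta)) (at s within UNIV)"
        using Suc.IH[of "x(m := x m + s * v m)" s] Suc.prems unfolding g_def has_field_derivative_def by simp
      show "((\<lambda>b. g a b) has_derivative blinfun_apply (blinfun_mult_right (d a b))) (at b within UNIV)" for a b
      proof -
        have "((\<lambda>b. \<phi> ((y m x a)(m := x m + b * v m))) has_real_derivative
            partial_deriv m \<phi> ((y m x a)(m := x m + b * v m)) * v m) (at b)"
          by (rule DERIV_chain2[OF Cb_infinity_has_partial[OF \<phi> m]]) (auto intro!: derivative_eq_intros)
        then show ?thesis
          unfolding g_def d_def split has_field_derivative_def by (simp add: blinfun_mult_right.rep_eq)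
      qed
      have "continuous_on UNIV (\<lambda>p::real \<times> real. y m (x(m := x m + snd p * v m)) (fst p))"
      proof (rule continuous_on_coordinatewise_then_product)
        fix i show "continuous_on UNIV (\<lambda>p::real \<times> real. y m (x(m := x m + snd p * v m)) (fst p) i)"
          unfolding y_def by (cases "i = m"; cases "i < m") (auto intro!: continuous_intros)
      qed
      from continuous_on_compose2[OF Cb_infinityD(3)[OF Cb_infinity_partial_deriv[OF \<phi> m]] this]
      have "continuous_on UNIV (\<lambda>p. d (fst p) (snd p))"
        unfolding d_def by (intro continuous_on_mult continuous_on_const) auto
      then have "continuous_on UNIV (\<lambda>p. blinfun_mult_right (d (fst p) (snd p)))"
        by (rule bounded_linear.continuous_on[OF bounded_linear_blinfun_mult_right])
      then show "continuous (at (s, s) within UNIV \<times> UNIV) (\<lambda>(a, b). blinfun_mult_right (d a b))"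
        by (simp add: continuous_on_eq_continuous_within case_prod_beta')
    qed auto
    then have D: "((\<lambda>(a, b). g a b) has_derivative (\<lambda>(ta, tb).
        (\<Sum>k<m. partial_deriv k \<phi> (y m (x(m := x m + s * v m)) s) * v k) * ta + d s s * tb)) (at (s, s))"
      by (simp add: blinfun_mult_right.rep_eq)
    have "((\<lambda>t. (\<lambda>(a, b). g a b) (t, t)) has_derivative (\<lambda>t. (\<lambda>(ta, tb).
        (\<Sum>k<m. partial_deriv k \<phi> (y m (x(m := x m + s * v m)) s) * v k) * ta + d s s * tb) (t, t))) (at s)"
    proof (rule has_derivative_compose[where f = "\<lambda>t. (t, t)" and f' = "\<lambda>t. (t, t)"])
      show "((\<lambda>t. (t, t)) has_derivative (\<lambda>t. (t, t))) (at s)" by (auto intro!: derivative_intros)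
    qed (rule D)
    moreover have "y m (x(m := x m + s * v m)) s = y (Suc m) x s"
      by (auto simp: y_def fun_eq_iff less_Suc_eq)
    moreover have "(\<lambda>t. P * t + Q * t) = (*) (P + Q)" for P Q :: real
      by (auto simp: distrib_right)
    ultimately show ?case
      unfolding has_field_derivative_def by (simp add: diag d_def)
  qed
  note this[of n x 0]
  moreover have "\<phi> (y n x s) = \<phi> (\<lambda>k. x k + s * v k)" for s
    by (rule Cb_infinityD(1)[OF \<phi>]) (simp add: y_def)
  moreover have "y n x 0 = x" by (simp add: y_def fun_eq_iff)
  ultimately show ?thesis by simp
qed

lemma smooth_functionals_pair:
  assumes "F \<in> smooth_functionals" "G \<in> smooth_functionals"
  obtains n \<phi> \<psi> and l :: "nat \<Rightarrow> 'w::real_normed_vector \<Rightarrow>\<^sub>L real"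
  where "\<phi> \<in> Cb_infinity n" "\<psi> \<in> Cb_infinity n"
    "F = (\<lambda>x. \<phi> (\<lambda>k. blinfun_apply (l k) x))" "G = (\<lambda>x. \<psi> (\<lambda>k. blinfun_apply (l k) x))"
proof -
  obtain n1 \<phi> and l1 :: "nat \<Rightarrow> 'w \<Rightarrow>\<^sub>L real" where \<phi>: "\<phi> \<in> Cb_infinity n1" "F = (\<lambda>x. \<phi> (\<lambda>k. blinfun_apply (l1 k) x))"
    using assms(1) unfolding smooth_functionals_def by blast
  obtain n2 \<psi> and l2 :: "nat \<Rightarrow> 'w \<Rightarrow>\<^sub>L real" where \<psi>: "\<psi> \<in> Cb_infinity n2" "G = (\<lambda>x. \<psi> (\<lambda>k. blinfun_apply (l2 k) x))"
    using assms(2) unfolding smooth_functionals_def by blast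
  show thesis
  proof (rule that)
    show "\<phi> \<in> Cb_infinity (n1 + n2)"
      using Cb_infinity_shift[OF \<phi>(1), of 0 "n1 + n2"] by simp
    show "(\<lambda>x. \<psi> (\<lambda>i. x (i + n1))) \<in> Cb_infinity (n1 + n2)"
      using Cb_infinity_shift[OF \<psi>(1), of n1 "n1 + n2"] by simp
    show "F = (\<lambda>x. \<phi> (\<lambda>k. blinfun_apply (if k < n1 then l1 k else l2 (k - n1)) x))"
      unfolding \<phi>(2) by (intro ext Cb_infinityD(1)[OF \<phi>(1)]) simp
    show "G = (\<lambda>x. (\<lambda>x. \<psi> (\<lambda>i. x (i + n1))) (\<lambda>k. blinfun_apply (if k < n1 then l1 k else l2 (k - n1)) x))"
      unfolding \<psi>(2) by simp
  qed
qed

lemma smooth_functionals_const: "(\<lambda>_. c) \<in> smooth_functionals"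
  unfolding smooth_functionals_def
  using trig_algebra.const[of c 0] trig_algebra_subset[of 0] by blast

lemma smooth_functionals_add:
  assumes "F \<in> smooth_functionals" "G \<in> smooth_functionals"
  shows "(\<lambda>x. F x + G x) \<in> smooth_functionals"
  using assms
proof (rule smooth_functionals_pair)
  fix n \<phi> \<psi> and l :: "nat \<Rightarrow> 'a \<Rightarrow>\<^sub>L real"
  assume *: "\<phi> \<in> Cb_infinity n" "\<psi> \<in> Cb_infinity n"
    "F = (\<lambda>x. \<phi> (\<lambda>k. blinfun_apply (l k) x))" "G = (\<lambda>x. \<psi> (\<lambda>k. blinfun_apply (l k) x))"
  then have "(\<lambda>x. \<phi> x + \<psi> x) \<in> Cb_infinity n"
    using trig_algebra_subset by (blast intro: trig_algebra.intros)
  then show ?thesis unfolding smooth_functionals_def *(3,4) by blast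
qed

lemma smooth_functionals_mult:
  assumes "F \<in> smooth_functionals" "G \<in> smooth_functionals"
  shows "(\<lambda>x. F x * G x) \<in> smooth_functionals"
  using assms
proof (rule smooth_functionals_pair)
  fix n \<phi> \<psi> and l :: "nat \<Rightarrow> 'a \<Rightarrow>\<^sub>L real"
  assume *: "\<phi> \<in> Cb_infinity n" "\<psi> \<in> Cb_infinity n"
    "F = (\<lambda>x. \<phi> (\<lambda>k. blinfun_apply (l k) x))" "G = (\<lambda>x. \<psi> (\<lambda>k. blinfun_apply (l k) x))"
  then have "(\<lambda>x. \<phi> x * \<psi> x) \<in> Cb_infinity n"
    using trig_algebra_subset by (blast intro: trig_algebra.intros)
  then show ?thesis unfolding smooth_functionals_def *(3,4) by blast
qed

lemma smooth_functionals_cos: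
  assumes "F \<in> smooth_functionals"
  shows "(\<lambda>x. cos (F x)) \<in> smooth_functionals"
proof -
  obtain n \<phi> and l :: "nat \<Rightarrow> 'a \<Rightarrow>\<^sub>L real" where *: "\<phi> \<in> Cb_infinity n" "F = (\<lambda>x. \<phi> (\<lambda>k. blinfun_apply (l k) x))"
    using assms unfolding smooth_functionals_def by blast
  then have "(\<lambda>x. cos (\<phi> x)) \<in> Cb_infinity n"
    using trig_algebra_subset by (blast intro: trig_algebra.intros)
  then show ?thesis unfolding smooth_functionals_def *(2) by blast
qed

lemma continuous_smooth_functional:
  assumes "F \<in> smooth_functionals"
  shows "continuous_on UNIV F"
proof -
  obtain n \<phi> and l :: "nat \<Rightarrow> 'a \<Rightarrow>\<^sub>L real" where *: "\<phi> \<in> Cb_infinity n" "F = (\<lambda>x. \<phi> (\<lambda>k. blinfun_apply (l k) x))"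
    using assms unfolding smooth_functionals_def by blast
  have "continuous_on UNIV (\<lambda>x k. blinfun_apply (l k) x)"
    by (intro continuous_on_coordinatewise_then_product continuous_intros)
  then show ?thesis
    unfolding *(2) by (rule continuous_on_compose2[OF Cb_infinityD(3)[OF *(1)]]) auto
qed

lemma bounded_smooth_functional:
  assumes "F \<in> smooth_functionals"
  shows "\<exists>B. \<forall>x. \<bar>F x\<bar> \<le> B"
proof -
  obtain n \<phi> and l :: "nat \<Rightarrow> 'a \<Rightarrow>\<^sub>L real" where *: "\<phi> \<in> Cb_infinity n" "F = (\<lambda>x. \<phi> (\<lambda>k. blinfun_apply (l k) x))"
    using assms unfolding smooth_functionals_def by blast
  show ?thesis
    using Cb_infinityD(2)[OF *(1)] unfolding *(2) bounded_iff by (auto intro: exI)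
qed

context wiener_basis begin

lemma smooth_functional_measurable:
  "F \<in> smooth_functionals \<Longrightarrow> F \<in> borel_measurable \<mu>"
  using borel_measurable_continuous_onI[OF continuous_smooth_functional]
  by (simp cong: measurable_cong_sets add: sets_borel)

lemma smooth_gradient_eqI:
  assumes "\<And>h. ((\<lambda>s. F (x + s *\<^sub>R \<iota> h)) has_real_derivative inner g h) (at 0)"
  shows "smooth_gradient \<iota> F x = g"
proof -
  have "dir_deriv \<iota> h F x = inner g h" for h
    unfolding dir_deriv_def
    by (rule vector_derivative_at) (use assms[of h] in \<open>simp add: has_real_derivative_iff_has_vector_derivative\<close>)
  then show ?thesis
    unfolding smooth_gradient_def
    by (intro the_equality) (metis inner_commute vector_eq_ldot)+
qed

text \<open>
  The gradient of \<open>\<phi>(l\<^sub>1, \<dots>, l\<^sub>n)\<close> is the sum of the \<open>\<partial>\<^sub>k\<phi>(l\<^sub>1, \<dots>, l\<^sub>n)\<close> times the Riesz vectors of the \<open>l\<^sub>k\<close>.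
\<close>
lemma smooth_functional_gradient:
  assumes "F \<in> smooth_functionals"
  obtains G where "\<And>x h. ((\<lambda>s. F (x + s *\<^sub>R \<iota> h)) has_real_derivative inner (G x) h) (at 0)"
    "continuous_on UNIV G" "bounded (range G)"
proof -
  obtain n \<phi> and l :: "nat \<Rightarrow> 'w \<Rightarrow>\<^sub>L real" where *: "\<phi> \<in> Cb_infinity n" "F = (\<lambda>x. \<phi> (\<lambda>k. blinfun_apply (l k) x))"
    using assms unfolding smooth_functionals_def by blast
  define d where "d k x = partial_deriv k \<phi> (\<lambda>k. blinfun_apply (l k) x)" for k x
  have dc: "continuous_on UNIV (d k)" and db: "bounded (range (d k))" if "k < n" for k
  proof -
    note pd = Cb_infinity_partial_deriv[OF *(1) that]
    have "continuous_on UNIV (\<lambda>x k. blinfun_apply (l k) x)"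
      by (intro continuous_on_coordinatewise_then_product continuous_intros)
    then show "continuous_on UNIV (d k)"
      unfolding d_def by (rule continuous_on_compose2[OF Cb_infinityD(3)[OF pd]]) auto
    show "bounded (range (d k))"
      unfolding d_def by (rule bounded_subset[OF Cb_infinityD(2)[OF pd]]) auto
  qed
  define G where "G x = (\<Sum>k<n. d k x *\<^sub>R dual_embed \<iota> (l k))" for x
  show thesis
  proof (rule that[of G])
    show "((\<lambda>s. F (x + s *\<^sub>R \<iota> h)) has_real_derivative inner (G x) h) (at 0)" for x h
      using Cb_infinity_line_derivative[OF *(1), of "\<lambda>k. blinfun_apply (l k) x" "\<lambda>k. blinfun_apply (l k) (\<iota> h)"]
      by (simp add: *(2) G_def d_def inner_sum_left inner_dual_embed blinfun.add_right blinfun.scaleR_right)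
    show "continuous_on UNIV G"
      unfolding G_def by (intro continuous_intros dc) auto
    obtain B where B: "\<And>k x. k < n \<Longrightarrow> \<bar>d k x\<bar> \<le> B k"
      using db unfolding bounded_iff by (metis rangeI real_norm_def)
    have "norm (G x) \<le> (\<Sum>k<n. B k * norm (dual_embed \<iota> (l k)))" for x
      unfolding G_def using B by (intro sum_norm_le) (auto intro: mult_right_mono)
    then show "bounded (range G)" unfolding bounded_iff by blast
  qed
qed

lemma smooth_gradient_props:
  assumes "F \<in> smooth_functionals"
  shows "((\<lambda>s. F (x + s *\<^sub>R \<iota> h)) has_real_derivative inner (smooth_gradient \<iota> F x) h) (at 0)"
    and "smooth_gradient \<iota> F \<in> borel_measurable \<mu>"
    and "\<exists>B. \<forall>x. norm (smooth_gradient \<iota> F x) \<le> B"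
proof -
  obtain G where G: "\<And>x h. ((\<lambda>s. F (x + s *\<^sub>R \<iota> h)) has_real_derivative inner (G x) h) (at 0)"
    "continuous_on UNIV G" "bounded (range G)"
    using smooth_functional_gradient[OF assms] by blast
  have eq: "smooth_gradient \<iota> F = G"
    by (intro ext smooth_gradient_eqI G)
  show "((\<lambda>s. F (x + s *\<^sub>R \<iota> h)) has_real_derivative inner (smooth_gradient \<iota> F x) h) (at 0)"
    unfolding eq by (rule G)
  show "smooth_gradient \<iota> F \<in> borel_measurable \<mu>"
    using borel_measurable_continuous_onI[OF G(2)] unfolding eq
    by (simp cong: measurable_cong_sets add: sets_borel)
  show "\<exists>B. \<forall>x. norm (smooth_gradient \<iota> F x) \<le> B"
    using G(3) unfolding eq bounded_iff by blast
qed

lemma smooth_gradient_const: "smooth_gradient \<iota> (\<lambda>_. c) x = 0"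
  by (rule smooth_gradient_eqI) simp

lemma smooth_gradient_add:
  assumes "F \<in> smooth_functionals" "G \<in> smooth_functionals"
  shows "smooth_gradient \<iota> (\<lambda>x. F x + G x) x = smooth_gradient \<iota> F x + smooth_gradient \<iota> G x"
  by (rule smooth_gradient_eqI)
    (auto simp: inner_add_left intro!: DERIV_add smooth_gradient_props(1) assms)

lemma smooth_gradient_mult:
  assumes "F \<in> smooth_functionals" "G \<in> smooth_functionals"
  shows "smooth_gradient \<iota> (\<lambda>x. F x * G x) x = F x *\<^sub>R smooth_gradient \<iota> G x + G x *\<^sub>R smooth_gradient \<iota> F x"
  by (rule smooth_gradient_eqI)
    (use DERIV_mult[OF smooth_gradient_props(1)[OF assms(1)] smooth_gradient_props(1)[OF assms(2)]] in
      \<open>simp add: inner_add_left algebra_simps\<close>)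

lemma smooth_gradient_cos:
  assumes "F \<in> smooth_functionals"
  shows "smooth_gradient \<iota> (\<lambda>x. cos (F x)) x = - sin (F x) *\<^sub>R smooth_gradient \<iota> F x"
  by (rule smooth_gradient_eqI)
    (auto intro!: derivative_eq_intros smooth_gradient_props(1)[OF assms])

end

section \<open>Mean square convergence\<close>

lemma Lp_power_2: "Lp_power M 2 u = (\<integral>\<^sup>+x. ennreal ((norm (u x))\<^sup>2) \<partial>M)"
  by (simp add: Lp_power_def)

lemma Lp_power_2_mono:
  assumes "\<And>x. norm (u x) \<le> C * norm (v x)" and [measurable]: "v \<in> borel_measurable M"
  shows "Lp_power M 2 u \<le> ennreal (C\<^sup>2) * Lp_power M 2 v"
proof -
  have "Lp_power M 2 u \<le> (\<integral>\<^sup>+x. ennreal (C\<^sup>2) * ennreal ((norm (v x))\<^sup>2) \<partial>M)"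
    unfolding Lp_power_2
  proof (intro nn_integral_mono)
    fix x
    have "(norm (u x))\<^sup>2 \<le> (C * norm (v x))\<^sup>2"
      by (intro power_mono assms) auto
    then show "ennreal ((norm (u x))\<^sup>2) \<le> ennreal (C\<^sup>2) * ennreal ((norm (v x))\<^sup>2)"
      by (simp add: ennreal_mult[symmetric] power_mult_distrib)
  qed
  also have "\<dots> = ennreal (C\<^sup>2) * Lp_power M 2 v"
    unfolding Lp_power_2 by (rule nn_integral_cmult) measurable
  finally show ?thesis .
qed

lemma Lp_power_2_add:
  fixes u v :: "'a \<Rightarrow> 'b::{real_normed_vector,second_countable_topology}"
  assumes [measurable]: "u \<in> borel_measurable M" "v \<in> borel_measurable M"
  shows "Lp_power M 2 (\<lambda>x. u x + v x) \<le> 2 * Lp_power M 2 u + 2 * Lp_power M 2 v"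
proof -
  have "Lp_power M 2 (\<lambda>x. u x + v x) \<le> (\<integral>\<^sup>+x. 2 * ennreal ((norm (u x))\<^sup>2) + 2 * ennreal ((norm (v x))\<^sup>2) \<partial>M)"
    unfolding Lp_power_2
  proof (intro nn_integral_mono)
    fix x
    have "(norm (u x + v x))\<^sup>2 \<le> (norm (u x) + norm (v x))\<^sup>2"
      by (intro power_mono norm_triangle_ineq) auto
    also have "\<dots> \<le> 2 * (norm (u x))\<^sup>2 + 2 * (norm (v x))\<^sup>2"
      using zero_le_power2[of "norm (u x) - norm (v x)"] by (simp add: power2_eq_square algebra_simps)
    finally have "ennreal ((norm (u x + v x))\<^sup>2) \<le> ennreal (2 * (norm (u x))\<^sup>2 + 2 * (norm (v x))\<^sup>2)"
      by (rule ennreal_leI)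
    then show "ennreal ((norm (u x + v x))\<^sup>2) \<le> 2 * ennreal ((norm (u x))\<^sup>2) + 2 * ennreal ((norm (v x))\<^sup>2)"
      by (simp add: ennreal_mult)
  qed
  also have "\<dots> = 2 * Lp_power M 2 u + 2 * Lp_power M 2 v"
    unfolding Lp_power_2 by (simp add: nn_integral_add nn_integral_cmult)
  finally show ?thesis .
qed

lemma Lp_2D:
  assumes "u \<in> Lp M 2"
  shows "u \<in> borel_measurable M" "Lp_power M 2 u < \<infinity>"
  using assms by (auto simp: Lp_def)

lemma Lp_2_dominated:
  assumes "v \<in> Lp M 2" "u \<in> borel_measurable M" "\<And>x. norm (u x) \<le> C * norm (v x)"
  shows "u \<in> Lp M 2"
  using Lp_power_2_mono[OF assms(3) Lp_2D(1)[OF assms(1)]] Lp_2D(2)[OF assms(1)] assms(2)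
  by (auto simp: Lp_def ennreal_mult_less_top intro: le_less_trans)

lemma Lp_2_add:
  fixes u v :: "'a \<Rightarrow> 'b::{real_normed_vector,second_countable_topology}"
  assumes "u \<in> Lp M 2" "v \<in> Lp M 2"
  shows "(\<lambda>x. u x + v x) \<in> Lp M 2"
proof -
  note [measurable] = Lp_2D(1)[OF assms(1)] Lp_2D(1)[OF assms(2)]
  have "2 * Lp_power M 2 u + 2 * Lp_power M 2 v < \<infinity>"
    using assms[THEN Lp_2D(2)] by (simp add: ennreal_mult_less_top)
  then show ?thesis
    using Lp_power_2_add[of u M v] by (auto simp: Lp_def intro: le_less_trans)
qed

lemma (in prob_space) Lp_2_bounded:
  assumes [measurable]: "u \<in> borel_measurable M" and "\<And>x. norm (u x) \<le> B"
  shows "u \<in> Lp M 2"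
proof -
  have "(\<lambda>_. 1::real) \<in> Lp M 2" by (simp add: Lp_def Lp_power_2 emeasure_space_1)
  then show ?thesis by (rule Lp_2_dominated[where C = B]) (use assms in auto)
qed

lemma L2_null_mono:
  assumes v: "((\<lambda>i. Lp_power M 2 (v i)) \<longlongrightarrow> 0) F"
    and "\<And>i x. norm (u i x) \<le> C * norm (v i x)" "\<And>i. v i \<in> borel_measurable M"
  shows "((\<lambda>i. Lp_power M 2 (u i)) \<longlongrightarrow> 0) F"
proof (rule tendsto_sandwich[OF _ _ tendsto_const])
  show "\<forall>\<^sub>F i in F. Lp_power M 2 (u i) \<le> ennreal (C\<^sup>2) * Lp_power M 2 (v i)"
    by (intro always_eventually allI Lp_power_2_mono assms)
  have "((\<lambda>i. ennreal (C\<^sup>2) * Lp_power M 2 (v i)) \<longlongrightarrow> ennreal (C\<^sup>2) * 0) F"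
    by (intro ennreal_tendsto_cmult v) simp
  then show "((\<lambda>i. ennreal (C\<^sup>2) * Lp_power M 2 (v i)) \<longlongrightarrow> 0) F" by simp
qed simp

lemma L2_null_add:
  fixes u v :: "'i \<Rightarrow> 'a \<Rightarrow> 'b::{real_normed_vector,second_countable_topology}"
  assumes u: "((\<lambda>i. Lp_power M 2 (u i)) \<longlongrightarrow> 0) F" and v: "((\<lambda>i. Lp_power M 2 (v i)) \<longlongrightarrow> 0) F"
    and m: "\<And>i. u i \<in> borel_measurable M" "\<And>i. v i \<in> borel_measurable M"
  shows "((\<lambda>i. Lp_power M 2 (\<lambda>x. u i x + v i x)) \<longlongrightarrow> 0) F"
proof (rule tendsto_sandwich[OF _ _ tendsto_const])
  show "\<forall>\<^sub>F i in F. Lp_power M 2 (\<lambda>x. u i x + v i x) \<le> 2 * Lp_power M 2 (u i) + 2 * Lp_power M 2 (v i)"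
    by (intro always_eventually allI Lp_power_2_add m)
  have "((\<lambda>i. 2 * Lp_power M 2 (u i) + 2 * Lp_power M 2 (v i)) \<longlongrightarrow> 2 * 0 + 2 * 0) F"
    by (intro tendsto_add ennreal_tendsto_cmult u v) simp_all
  then show "((\<lambda>i. 2 * Lp_power M 2 (u i) + 2 * Lp_power M 2 (v i)) \<longlongrightarrow> 0) F" by simp
qed simp

lemma L2_null_dominated:
  fixes u :: "nat \<Rightarrow> 'a \<Rightarrow> 'b::{real_normed_vector,second_countable_topology}"
  assumes g: "g \<in> Lp M 2" and [measurable]: "\<And>n. u n \<in> borel_measurable M"
    and bound: "\<And>n x. norm (u n x) \<le> C * norm (g x)"
    and lim: "AE x in M. (\<lambda>n. u n x) \<longlonglongrightarrow> 0"
  shows "(\<lambda>n. Lp_power M 2 (u n)) \<longlonglongrightarrow> 0"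
proof -
  note [measurable] = Lp_2D(1)[OF g]
  have "(\<lambda>n. \<integral>\<^sup>+x. ennreal ((norm (u n x))\<^sup>2) \<partial>M) \<longlonglongrightarrow> (\<integral>\<^sup>+x. 0 \<partial>M)"
  proof (rule nn_integral_dominated_convergence[where w = "\<lambda>x. ennreal (C\<^sup>2) * ennreal ((norm (g x))\<^sup>2)"])
    show "AE x in M. ennreal ((norm (u n x))\<^sup>2) \<le> ennreal (C\<^sup>2) * ennreal ((norm (g x))\<^sup>2)" for n
    proof (intro AE_I2)
      fix x
      have "(norm (u n x))\<^sup>2 \<le> (C * norm (g x))\<^sup>2" by (intro power_mono bound) auto
      then show "ennreal ((norm (u n x))\<^sup>2) \<le> ennreal (C\<^sup>2) * ennreal ((norm (g x))\<^sup>2)"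
        by (simp add: ennreal_mult[symmetric] power_mult_distrib)
    qed
    have "(\<integral>\<^sup>+x. ennreal (C\<^sup>2) * ennreal ((norm (g x))\<^sup>2) \<partial>M) = ennreal (C\<^sup>2) * Lp_power M 2 g"
      unfolding Lp_power_2 by (rule nn_integral_cmult) measurable
    then show "(\<integral>\<^sup>+x. ennreal (C\<^sup>2) * ennreal ((norm (g x))\<^sup>2) \<partial>M) < \<infinity>"
      using Lp_2D(2)[OF g] by (simp add: ennreal_mult_less_top)
    from lim show "AE x in M. (\<lambda>n. ennreal ((norm (u n x))\<^sup>2)) \<longlonglongrightarrow> 0"
    proof eventually_elim
      fix x assume "(\<lambda>n. u n x) \<longlonglongrightarrow> 0"
      then have "(\<lambda>n. ennreal ((norm (u n x))\<^sup>2)) \<longlonglongrightarrow> ennreal ((norm (0::'b))\<^sup>2)"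
        by (intro tendsto_intros)
      then show "(\<lambda>n. ennreal ((norm (u n x))\<^sup>2)) \<longlonglongrightarrow> 0" by simp
    qed
  qed measurable
  then show ?thesis by (simp add: Lp_power_2)
qed

lemma L2_null_AE_subseq:
  fixes u :: "nat \<Rightarrow> 'a \<Rightarrow> real"
  assumes u: "\<And>n. u n \<in> Lp M 2" and lim: "(\<lambda>n. Lp_power M 2 (u n)) \<longlonglongrightarrow> 0"
  obtains r :: "nat \<Rightarrow> nat" where "strict_mono r" "AE x in M. (\<lambda>n. u (r n) x) \<longlonglongrightarrow> 0"
proof -
  note [measurable] = Lp_2D(1)[OF u]
  have int: "integrable M (\<lambda>x. (u n x)\<^sup>2)" for n
    using Lp_2D(2)[OF u[of n]] by (simp add: integrable_iff_bounded Lp_power_2)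
  have "Lp_power M 2 (u n) = ennreal (\<integral>x. (u n x)\<^sup>2 \<partial>M)" for n
    using nn_integral_eq_integral[OF int[of n]] by (simp add: Lp_power_2)
  then have "(\<lambda>n. \<integral>x. norm ((u n x)\<^sup>2) \<partial>M) \<longlonglongrightarrow> 0"
    using lim by (simp add: ennreal_0[symmetric] tendsto_ennreal_iff del: ennreal_0)
  then obtain r :: "nat \<Rightarrow> nat" where r: "strict_mono r" "AE x in M. (\<lambda>n. (u (r n) x)\<^sup>2) \<longlonglongrightarrow> 0"
    using tendsto_L1_AE_subseq[of M "\<lambda>n x. (u n x)\<^sup>2"] int by blast
  have "AE x in M. (\<lambda>n. u (r n) x) \<longlonglongrightarrow> 0"
    using r(2) by eventually_elim (simp add: power_tendsto_0_iff)
  with r(1) show thesis by (rule that)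
qed

lemma L2_Cauchy_Schwarz:
  fixes u v :: "'a \<Rightarrow> 'b::{real_inner,second_countable_topology}"
  assumes u: "u \<in> Lp M 2" and v: "v \<in> Lp M 2"
  shows "integrable M (\<lambda>x. inner (u x) (v x))"
    and "ennreal ((\<integral>x. inner (u x) (v x) \<partial>M)\<^sup>2) \<le> Lp_power M 2 u * Lp_power M 2 v"
proof -
  note [measurable] = Lp_2D(1)[OF u] Lp_2D(1)[OF v]
  have le: "(\<integral>\<^sup>+x. ennreal (norm (inner (u x) (v x))) \<partial>M) \<le> (\<integral>\<^sup>+x. ennreal (norm (u x)) * ennreal (norm (v x)) \<partial>M)"
    by (intro nn_integral_mono) (auto simp: ennreal_mult[symmetric] intro!: ennreal_leI Cauchy_Schwarz_ineq2)
  have cs: "(\<integral>\<^sup>+x. ennreal (norm (u x)) * ennreal (norm (v x)) \<partial>M)\<^sup>2 \<le> Lp_power M 2 u * Lp_power M 2 v"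
    using Cauchy_Schwarz_nn_integral[of "\<lambda>x. ennreal (norm (u x))" M "\<lambda>x. ennreal (norm (v x))"]
    by (simp add: Lp_power_2 ennreal_power)
  also have "\<dots> < \<infinity>" using Lp_2D(2)[OF u] Lp_2D(2)[OF v] by (simp add: ennreal_mult_less_top)
  finally have "(\<integral>\<^sup>+x. ennreal (norm (u x)) * ennreal (norm (v x)) \<partial>M) < \<infinity>"
    by (simp add: power_less_top_ennreal)
  with le have "(\<integral>\<^sup>+x. ennreal (norm (inner (u x) (v x))) \<partial>M) < \<infinity>" by (rule le_less_trans)
  then show int: "integrable M (\<lambda>x. inner (u x) (v x))" by (simp add: integrable_iff_bounded)
  have "ennreal ((\<integral>x. inner (u x) (v x) \<partial>M)\<^sup>2) = (ennreal (norm (\<integral>x. inner (u x) (v x) \<partial>M)))\<^sup>2"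
    by (simp add: ennreal_power)
  also have "\<dots> \<le> (\<integral>\<^sup>+x. ennreal (norm (u x)) * ennreal (norm (v x)) \<partial>M)\<^sup>2"
    by (intro power_mono order_trans[OF integral_norm_bound_ennreal[OF int] le]) simp
  finally show "ennreal ((\<integral>x. inner (u x) (v x) \<partial>M)\<^sup>2) \<le> Lp_power M 2 u * Lp_power M 2 v"
    using cs by (rule order_trans)
qed

lemma L2_null_integral_inner:
  fixes u :: "'a \<Rightarrow> 'b::{real_inner,second_countable_topology}"
  assumes u: "u \<in> Lp M 2" and v: "\<And>i. v i \<in> Lp M 2" and lim: "((\<lambda>i. Lp_power M 2 (v i)) \<longlongrightarrow> 0) F"
  shows "((\<lambda>i. \<integral>x. inner (u x) (v i x) \<partial>M) \<longlongrightarrow> 0) F"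
proof -
  have "((\<lambda>i. ennreal ((\<integral>x. inner (u x) (v i x) \<partial>M)\<^sup>2)) \<longlongrightarrow> 0) F"
  proof (rule tendsto_sandwich[OF _ _ tendsto_const])
    show "\<forall>\<^sub>F i in F. ennreal ((\<integral>x. inner (u x) (v i x) \<partial>M)\<^sup>2) \<le> Lp_power M 2 u * Lp_power M 2 (v i)"
      by (intro always_eventually allI L2_Cauchy_Schwarz u v)
    have "((\<lambda>i. Lp_power M 2 u * Lp_power M 2 (v i)) \<longlongrightarrow> Lp_power M 2 u * 0) F"
      using Lp_2D(2)[OF u] by (intro ennreal_tendsto_cmult lim) simp
    then show "((\<lambda>i. Lp_power M 2 u * Lp_power M 2 (v i)) \<longlongrightarrow> 0) F" by simp
  qed simp
  then have "((\<lambda>i. (\<integral>x. inner (u x) (v i x) \<partial>M)\<^sup>2) \<longlongrightarrow> 0) F"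
    by (simp add: ennreal_0[symmetric] tendsto_ennreal_iff del: ennreal_0)
  then show ?thesis by (simp add: power_tendsto_0_iff)
qed

lemma L2_tendsto_integral_inner:
  fixes u :: "'a \<Rightarrow> 'b::{real_inner,second_countable_topology}"
  assumes u: "u \<in> Lp M 2" and v: "\<And>i. v i \<in> Lp M 2" and w: "w \<in> Lp M 2"
    and lim: "((\<lambda>i. Lp_power M 2 (\<lambda>x. v i x - w x)) \<longlongrightarrow> 0) F"
  shows "((\<lambda>i. \<integral>x. inner (u x) (v i x) \<partial>M) \<longlongrightarrow> (\<integral>x. inner (u x) (w x) \<partial>M)) F"
proof (rule LIM_zero_cancel)
  have "(\<lambda>x. - w x) \<in> Lp M 2" using w by (simp add: Lp_def Lp_power_def)
  then have d: "(\<lambda>x. v i x - w x) \<in> Lp M 2" for i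
    using Lp_2_add[OF v[of i], of "\<lambda>x. - w x"] by simp
  have "(\<integral>x. inner (u x) (v i x) \<partial>M) - (\<integral>x. inner (u x) (w x) \<partial>M) = (\<integral>x. inner (u x) (v i x - w x) \<partial>M)" for i
    by (simp add: inner_diff_right L2_Cauchy_Schwarz(1)[OF u v] L2_Cauchy_Schwarz(1)[OF u w])
  then show "((\<lambda>i. (\<integral>x. inner (u x) (v i x) \<partial>M) - (\<integral>x. inner (u x) (w x) \<partial>M)) \<longlongrightarrow> 0) F"
    using L2_null_integral_inner[OF u d lim] by simp
qed

lemma abs_cos_diff_le: "\<bar>cos x - cos y\<bar> \<le> \<bar>x - y\<bar>" for x y :: real
proof -
  have "\<bar>cos x - cos y\<bar> = 2 * \<bar>sin ((x + y) / 2)\<bar> * \<bar>sin ((y - x) / 2)\<bar>"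
    by (simp add: cos_diff_cos abs_mult)
  also have "\<dots> \<le> 2 * 1 * \<bar>(y - x) / 2\<bar>"
    by (intro mult_mono abs_sin_x_le_abs_x) auto
  finally show ?thesis by simp
qed

lemma abs_sin_diff_le: "\<bar>sin x - sin y\<bar> \<le> \<bar>x - y\<bar>" for x y :: real
  using abs_cos_diff_le[of "pi/2 - x" "pi/2 - y"] by (simp add: cos_diff)

section \<open>The operator \<open>F \<mapsto> \<delta>(A\<nabla>F)\<close>\<close>

locale skew_wiener = wiener_basis \<mu> \<iota> e
  for \<mu> :: "'w::{banach,second_countable_topology} measure"
    and \<iota> :: "'h::{real_inner,banach,second_countable_topology} \<Rightarrow> 'w"
    and e :: "nat \<Rightarrow> 'h" +
  fixes A :: "'w \<Rightarrow> 'h \<Rightarrow> 'h"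
  assumes skew: "random_skew_transformation \<mu> A"
begin

lemma linear_A: "linear (A x)"
  using skew by (simp add: random_skew_transformation_def)

lemma inner_A_self: "inner (A x h) h = 0"
proof -
  have "inner (A x h) h = - inner h (A x h)"
    using skew by (simp add: random_skew_transformation_def)
  then show ?thesis by (simp add: inner_commute)
qed

text \<open>
  A relation rather than a function, because the gradient and the divergence are determined up to null sets only.
\<close>
definition has_generator :: "('w \<Rightarrow> real) \<Rightarrow> ('w \<Rightarrow> real) \<Rightarrow> bool" where
  "has_generator F D \<longleftrightarrow> (\<exists>G. has_gradient \<mu> \<iota> 2 F G \<and> has_divergence \<mu> \<iota> 2 (\<lambda>x. A x (G x)) D)"

lemma has_generatorD:
  assumes "has_generator F D"
  shows "F \<in> Lp \<mu> 2" "D \<in> Lp \<mu> 2"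
  using assms by (auto simp: has_generator_def has_gradient_def has_divergence_def)

lemma smooth_functional_Lp: "F \<in> smooth_functionals \<Longrightarrow> F \<in> Lp \<mu> 2"
  using bounded_smooth_functional[of F] smooth_functional_measurable[of F]
  by (auto intro: Lp_2_bounded simp flip: real_norm_def)

lemma smooth_gradient_Lp: "F \<in> smooth_functionals \<Longrightarrow> smooth_gradient \<iota> F \<in> Lp \<mu> 2"
  using smooth_gradient_props(2,3)[of F] by (auto intro: Lp_2_bounded)

lemma has_generator_const: "has_generator (\<lambda>_. c) (\<lambda>_. 0)"
  unfolding has_generator_def
proof (intro exI conjI)
  have 0: "(\<lambda>_. 0) \<in> Lp \<mu> 2" by (simp add: Lp_def Lp_power_def)
  have c: "(\<lambda>_. c) \<in> Lp \<mu> 2" by (rule Lp_2_bounded[where B = "\<bar>c\<bar>"]) auto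
  have g: "smooth_gradient \<iota> (\<lambda>_. c) = (\<lambda>_. 0)" by (simp add: fun_eq_iff smooth_gradient_const)
  show "has_gradient \<mu> \<iota> 2 (\<lambda>_. c) (\<lambda>_. 0)"
    unfolding has_gradient_def
    by (intro conjI exI[of _ "\<lambda>_ _. c"] allI)
      (simp_all add: 0 c g smooth_functionals_const Lp_power_def)
  have "(\<lambda>x. A x 0) = (\<lambda>_. 0)" using linear_0[OF linear_A] by (simp add: fun_eq_iff)
  moreover have "(\<lambda>_. 0) \<in> Lp \<mu> 2" by (simp add: Lp_def Lp_power_def)
  ultimately show "has_divergence \<mu> \<iota> 2 (\<lambda>x. A x 0) (\<lambda>_. 0)"
    by (simp add: has_divergence_def 0)
qed

lemma has_generator_add_scaled:
  assumes "has_generator F D" "has_generator F' D'"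
  shows "has_generator (\<lambda>x. F x + c * F' x) (\<lambda>x. D x + c * D' x)"
proof -
  obtain G \<Phi> where G: "F \<in> Lp \<mu> 2" "G \<in> Lp \<mu> 2" "\<And>n. \<Phi> n \<in> smooth_functionals"
      "(\<lambda>n. Lp_power \<mu> 2 (\<lambda>x. \<Phi> n x - F x)) \<longlonglongrightarrow> 0"
      "(\<lambda>n. Lp_power \<mu> 2 (\<lambda>x. smooth_gradient \<iota> (\<Phi> n) x - G x)) \<longlonglongrightarrow> 0"
    and V: "has_divergence \<mu> \<iota> 2 (\<lambda>x. A x (G x)) D"
    using assms(1) unfolding has_generator_def has_gradient_def by blast
  obtain G' \<Phi>' where G': "F' \<in> Lp \<mu> 2" "G' \<in> Lp \<mu> 2" "\<And>n. \<Phi>' n \<in> smooth_functionals"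
      "(\<lambda>n. Lp_power \<mu> 2 (\<lambda>x. \<Phi>' n x - F' x)) \<longlonglongrightarrow> 0"
      "(\<lambda>n. Lp_power \<mu> 2 (\<lambda>x. smooth_gradient \<iota> (\<Phi>' n) x - G' x)) \<longlonglongrightarrow> 0"
    and V': "has_divergence \<mu> \<iota> 2 (\<lambda>x. A x (G' x)) D'"
    using assms(2) unfolding has_generator_def has_gradient_def by blast
  have Lp_comb: "(\<lambda>x. u x + c *\<^sub>R v x) \<in> Lp \<mu> 2" if "u \<in> Lp \<mu> 2" "v \<in> Lp \<mu> 2"
    for u v :: "'w \<Rightarrow> 'z::{real_normed_vector,second_countable_topology}"
  proof (rule Lp_2_add[OF that(1)])
    note [measurable] = Lp_2D(1)[OF that(2)]
    show "(\<lambda>x. c *\<^sub>R v x) \<in> Lp \<mu> 2" by (rule Lp_2_dominated[OF that(2), where C = "\<bar>c\<bar>"]) auto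
  qed
  have null_comb: "(\<lambda>n. Lp_power \<mu> 2 (\<lambda>x. (u n x + c *\<^sub>R v n x) - (u' x + c *\<^sub>R v' x))) \<longlonglongrightarrow> 0"
    if "(\<lambda>n. Lp_power \<mu> 2 (\<lambda>x. u n x - u' x)) \<longlonglongrightarrow> 0" "(\<lambda>n. Lp_power \<mu> 2 (\<lambda>x. v n x - v' x)) \<longlonglongrightarrow> 0"
      "\<And>n. u n \<in> Lp \<mu> 2" "\<And>n. v n \<in> Lp \<mu> 2" "u' \<in> Lp \<mu> 2" "v' \<in> Lp \<mu> 2"
    for u v :: "nat \<Rightarrow> 'w \<Rightarrow> 'z::{real_normed_vector,second_countable_topology}" and u' v'
  proof -
    note [measurable] = Lp_2D(1)[OF that(3)] Lp_2D(1)[OF that(4)] Lp_2D(1)[OF that(5)] Lp_2D(1)[OF that(6)]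
    have "(\<lambda>n. Lp_power \<mu> 2 (\<lambda>x. c *\<^sub>R (v n x - v' x))) \<longlonglongrightarrow> 0"
      by (rule L2_null_mono[OF that(2), where C = "\<bar>c\<bar>"]) auto
    then have "(\<lambda>n. Lp_power \<mu> 2 (\<lambda>x. (u n x - u' x) + c *\<^sub>R (v n x - v' x))) \<longlonglongrightarrow> 0"
      by (intro L2_null_add that(1)) measurable
    then show ?thesis by (simp add: algebra_simps)
  qed
  define \<Psi> where "\<Psi> n x = \<Phi> n x + c * \<Phi>' n x" for n x
  have c\<Phi>: "(\<lambda>x. c * \<Phi>' n x) \<in> smooth_functionals" for n
    using smooth_functionals_mult[OF smooth_functionals_const[of c] G'(3)[of n]] .
  have \<Psi>: "\<Psi> n \<in> smooth_functionals" for n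
    unfolding \<Psi>_def by (intro smooth_functionals_add G c\<Phi>)
  have g\<Psi>: "smooth_gradient \<iota> (\<Psi> n) x = smooth_gradient \<iota> (\<Phi> n) x + c *\<^sub>R smooth_gradient \<iota> (\<Phi>' n) x" for n x
    unfolding \<Psi>_def using smooth_gradient_mult[OF smooth_functionals_const[of c] G'(3)[of n]]
    by (simp add: smooth_gradient_add[OF G(3) c\<Phi>] smooth_gradient_const)
  have AG: "A x (G x + c *\<^sub>R G' x) = A x (G x) + c *\<^sub>R A x (G' x)" for x
    using linear_A by (simp add: linear_add linear_scale)
  note Vl = V[unfolded has_divergence_def] V'[unfolded has_divergence_def]
  show ?thesis
    unfolding has_generator_def
  proof (intro exI conjI)
    show "has_gradient \<mu> \<iota> 2 (\<lambda>x. F x + c * F' x) (\<lambda>x. G x + c *\<^sub>R G' x)"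
      unfolding has_gradient_def
    proof (intro conjI exI[of _ \<Psi>] allI)
      show "(\<lambda>x. F x + c * F' x) \<in> Lp \<mu> 2" using Lp_comb[OF G(1) G'(1)] by simp
      show "(\<lambda>x. G x + c *\<^sub>R G' x) \<in> Lp \<mu> 2" by (rule Lp_comb[OF G(2) G'(2)])
      show "(\<lambda>n. Lp_power \<mu> 2 (\<lambda>x. \<Psi> n x - (F x + c * F' x))) \<longlonglongrightarrow> 0"
        using null_comb[OF G(4) G'(4)] G G' by (simp add: \<Psi>_def smooth_functional_Lp)
      show "(\<lambda>n. Lp_power \<mu> 2 (\<lambda>x. smooth_gradient \<iota> (\<Psi> n) x - (G x + c *\<^sub>R G' x))) \<longlonglongrightarrow> 0"
        using null_comb[OF G(5) G'(5)] G G' by (simp add: g\<Psi> smooth_gradient_Lp)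
    qed (rule \<Psi>)
    show "has_divergence \<mu> \<iota> 2 (\<lambda>x. A x (G x + c *\<^sub>R G' x)) (\<lambda>x. D x + c * D' x)"
      unfolding has_divergence_def AG
    proof (intro conjI ballI)
      show "(\<lambda>x. A x (G x) + c *\<^sub>R A x (G' x)) \<in> Lp \<mu> 2" using Vl by (intro Lp_comb) auto
      show "(\<lambda>x. D x + c * D' x) \<in> Lp \<mu> 2" using Lp_comb[of D D'] Vl by simp
      fix \<Theta> :: "'w \<Rightarrow> real" assume \<Theta>: "\<Theta> \<in> smooth_functionals"
      have i: "integrable \<mu> (\<lambda>x. inner (A x (G x)) (smooth_gradient \<iota> \<Theta> x))"
          "integrable \<mu> (\<lambda>x. inner (A x (G' x)) (smooth_gradient \<iota> \<Theta> x))"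
        using Vl smooth_gradient_Lp[OF \<Theta>] by (auto intro!: L2_Cauchy_Schwarz(1))
      have j: "integrable \<mu> (\<lambda>x. \<Theta> x * D x)" "integrable \<mu> (\<lambda>x. \<Theta> x * D' x)"
        using Vl smooth_functional_Lp[OF \<Theta>] L2_Cauchy_Schwarz(1)[of \<Theta> \<mu> D] L2_Cauchy_Schwarz(1)[of \<Theta> \<mu> D'] by auto
      have "(\<integral>x. inner (A x (G x) + c *\<^sub>R A x (G' x)) (smooth_gradient \<iota> \<Theta> x) \<partial>\<mu>)
          = (\<integral>x. inner (A x (G x)) (smooth_gradient \<iota> \<Theta> x) \<partial>\<mu>) + c * (\<integral>x. inner (A x (G' x)) (smooth_gradient \<iota> \<Theta> x) \<partial>\<mu>)"
        using i by (simp add: inner_add_left)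
      also have "\<dots> = (\<integral>x. \<Theta> x * D x \<partial>\<mu>) + c * (\<integral>x. \<Theta> x * D' x \<partial>\<mu>)"
        using Vl \<Theta> by simp
      also have "\<dots> = (\<integral>x. \<Theta> x * D x + c * (\<Theta> x * D' x) \<partial>\<mu>)"
        using j by simp
      also have "\<dots> = (\<integral>x. \<Theta> x * (D x + c * D' x) \<partial>\<mu>)"
        by (simp add: algebra_simps)
      finally show "(\<integral>x. inner (A x (G x) + c *\<^sub>R A x (G' x)) (smooth_gradient \<iota> \<Theta> x) \<partial>\<mu>) = (\<integral>x. \<Theta> x * (D x + c * D' x) \<partial>\<mu>)" .
    qed
  qed
qed

text \<open>
  The defining duality of the divergence, tested against the constant \<open>1\<close>.
\<close>
lemma has_generator_integral_zero:
  assumes "has_generator F D"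
  shows "(\<integral>x. D x \<partial>\<mu>) = 0"
proof -
  obtain V where "has_divergence \<mu> \<iota> 2 V D"
    using assms by (auto simp: has_generator_def)
  then have "(\<integral>x. inner (V x) (smooth_gradient \<iota> (\<lambda>_. 1) x) \<partial>\<mu>) = (\<integral>x. 1 * D x \<partial>\<mu>)"
    unfolding has_divergence_def using smooth_functionals_const by blast
  then show ?thesis by (simp add: smooth_gradient_const)
qed

text \<open>
  Let smooth \<open>\<Phi>\<^sub>n\<close> approximate \<open>F\<close> together with their gradients, and put \<open>V = A\<nabla>F\<close>.  Testing
  \<open>\<delta>V = D\<close> against \<open>sin \<Phi>\<^sub>n \<cdot> \<Psi>\<close> gives
  \<open>E[sin \<Phi>\<^sub>n (V, \<nabla>\<Psi>)] + E[\<Psi> cos \<Phi>\<^sub>n (V, \<nabla>\<Phi>\<^sub>n)] = E[sin \<Phi>\<^sub>n \<cdot> \<Psi> D]\<close>.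
  Since \<open>(V, \<nabla>F) = 0\<close>, the gradient \<open>\<nabla>\<Phi>\<^sub>n\<close> in the second term may be replaced by \<open>\<nabla>\<Phi>\<^sub>n - \<nabla>F\<close>, so this term
  tends to \<open>0\<close>, and the limit of the identity says that \<open>- sin F \<cdot> D\<close> is the divergence of \<open>A\<nabla>(cos F)\<close>.
\<close>
lemma has_generator_cos:
  assumes "has_generator F D"
  shows "has_generator (\<lambda>x. cos (F x)) (\<lambda>x. - sin (F x) * D x)"
proof -
  obtain G \<Phi>0 where F: "F \<in> Lp \<mu> 2" and G: "G \<in> Lp \<mu> 2" and s0: "\<And>n. \<Phi>0 n \<in> smooth_functionals"
      and l0: "(\<lambda>n. Lp_power \<mu> 2 (\<lambda>x. \<Phi>0 n x - F x)) \<longlonglongrightarrow> 0"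
      "(\<lambda>n. Lp_power \<mu> 2 (\<lambda>x. smooth_gradient \<iota> (\<Phi>0 n) x - G x)) \<longlonglongrightarrow> 0"
    and div: "has_divergence \<mu> \<iota> 2 (\<lambda>x. A x (G x)) D"
    using assms(1) unfolding has_generator_def has_gradient_def by blast
  define V where "V x = A x (G x)" for x
  have V: "V \<in> Lp \<mu> 2" and D: "D \<in> Lp \<mu> 2"
    and dual: "\<And>\<Psi>. \<Psi> \<in> smooth_functionals \<Longrightarrow> (\<integral>x. inner (V x) (smooth_gradient \<iota> \<Psi> x) \<partial>\<mu>) = (\<integral>x. \<Psi> x * D x \<partial>\<mu>)"
    using div unfolding V_def has_divergence_def by auto
  have VG: "inner (V x) (G x) = 0" for x unfolding V_def by (rule inner_A_self)
  note [measurable] = Lp_2D(1)[OF F] Lp_2D(1)[OF G] Lp_2D(1)[OF V] Lp_2D(1)[OF D]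
  have "(\<lambda>x. - F x) \<in> Lp \<mu> 2" using F by (simp add: Lp_def Lp_power_def)
  then have "(\<lambda>x. \<Phi>0 n x - F x) \<in> Lp \<mu> 2" for n
    using Lp_2_add[OF smooth_functional_Lp[OF s0[of n]], of "\<lambda>x. - F x"] by simp
  \<comment> \<open>Pointwise convergence along a subsequence is needed for the part \<open>(sin F - sin \<Phi>\<^sub>n) \<nabla>F\<close> of the error in the
    gradient, which is controlled by dominated convergence only.\<close>
  then obtain r where r: "strict_mono r" "AE x in \<mu>. (\<lambda>n. \<Phi>0 (r n) x - F x) \<longlonglongrightarrow> 0"
    using L2_null_AE_subseq[OF _ l0(1)] by blast
  define \<Phi> where "\<Phi> n = \<Phi>0 (r n)" for n
  have s: "\<Phi> n \<in> smooth_functionals" for n by (simp add: \<Phi>_def s0)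
  have l: "(\<lambda>n. Lp_power \<mu> 2 (\<lambda>x. \<Phi> n x - F x)) \<longlonglongrightarrow> 0"
    "(\<lambda>n. Lp_power \<mu> 2 (\<lambda>x. smooth_gradient \<iota> (\<Phi> n) x - G x)) \<longlonglongrightarrow> 0"
    using LIMSEQ_subseq_LIMSEQ[OF l0(1) r(1)] LIMSEQ_subseq_LIMSEQ[OF l0(2) r(1)] by (simp_all add: \<Phi>_def o_def)
  have lAE: "AE x in \<mu>. (\<lambda>n. \<Phi> n x) \<longlonglongrightarrow> F x"
    using r(2) by eventually_elim (simp add: \<Phi>_def LIM_zero_iff)
  have [measurable]: "\<Phi> n \<in> borel_measurable \<mu>" "smooth_gradient \<iota> (\<Phi> n) \<in> borel_measurable \<mu>" for n
    using s by (auto intro: smooth_functional_measurable smooth_gradient_props)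
  define G' where "G' x = - sin (F x) *\<^sub>R G x" for x
  have [measurable]: "G' \<in> borel_measurable \<mu>" unfolding G'_def by measurable
  show ?thesis
    unfolding has_generator_def
  proof (intro exI conjI)
    show "has_gradient \<mu> \<iota> 2 (\<lambda>x. cos (F x)) G'"
      unfolding has_gradient_def
    proof (intro conjI exI[of _ "\<lambda>n x. cos (\<Phi> n x)"] allI)
      show "(\<lambda>x. cos (F x)) \<in> Lp \<mu> 2" by (rule Lp_2_bounded[where B = 1]) auto
      show "G' \<in> Lp \<mu> 2"
        by (rule Lp_2_dominated[OF G, where C = 1]) (auto simp: G'_def intro: mult_left_le_one_le)
      show "(\<lambda>x. cos (\<Phi> n x)) \<in> smooth_functionals" for n by (rule smooth_functionals_cos[OF s])
      show "(\<lambda>n. Lp_power \<mu> 2 (\<lambda>x. cos (\<Phi> n x) - cos (F x))) \<longlonglongrightarrow> 0"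
        by (rule L2_null_mono[OF l(1), where C = 1]) (auto simp: abs_cos_diff_le)
      have "(\<lambda>n. Lp_power \<mu> 2 (\<lambda>x. - sin (\<Phi> n x) *\<^sub>R (smooth_gradient \<iota> (\<Phi> n) x - G x))) \<longlonglongrightarrow> 0"
        by (rule L2_null_mono[OF l(2), where C = 1]) (auto intro: mult_left_le_one_le)
      moreover have "(\<lambda>n. Lp_power \<mu> 2 (\<lambda>x. (sin (F x) - sin (\<Phi> n x)) *\<^sub>R G x)) \<longlonglongrightarrow> 0"
      proof (rule L2_null_dominated[OF G, where C = 2])
        show "norm ((sin (F x) - sin (\<Phi> n x)) *\<^sub>R G x) \<le> 2 * norm (G x)" for n x
        proof -
          have "\<bar>sin (F x) - sin (\<Phi> n x)\<bar> \<le> 2"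
            using abs_triangle_ineq4[of "sin (F x)" "sin (\<Phi> n x)"] abs_sin_le_one[of "F x"] abs_sin_le_one[of "\<Phi> n x"]
            by linarith
          then show ?thesis by (auto intro: mult_right_mono)
        qed
        show "AE x in \<mu>. (\<lambda>n. (sin (F x) - sin (\<Phi> n x)) *\<^sub>R G x) \<longlonglongrightarrow> 0"
          using lAE
        proof eventually_elim
          fix x assume "(\<lambda>n. \<Phi> n x) \<longlonglongrightarrow> F x"
          then have "(\<lambda>n. (sin (F x) - sin (\<Phi> n x)) *\<^sub>R G x) \<longlonglongrightarrow> (sin (F x) - sin (F x)) *\<^sub>R G x"
            by (intro tendsto_intros)
          then show "(\<lambda>n. (sin (F x) - sin (\<Phi> n x)) *\<^sub>R G x) \<longlonglongrightarrow> 0" by simp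
        qed
      qed measurable
      ultimately have "(\<lambda>n. Lp_power \<mu> 2 (\<lambda>x. - sin (\<Phi> n x) *\<^sub>R (smooth_gradient \<iota> (\<Phi> n) x - G x)
          + (sin (F x) - sin (\<Phi> n x)) *\<^sub>R G x)) \<longlonglongrightarrow> 0"
        by (intro L2_null_add) measurable
      then show "(\<lambda>n. Lp_power \<mu> 2 (\<lambda>x. smooth_gradient \<iota> (\<lambda>x. cos (\<Phi> n x)) x - G' x)) \<longlonglongrightarrow> 0"
        by (simp add: smooth_gradient_cos[OF s] G'_def algebra_simps)
    qed
    have AG': "A x (G' x) = - sin (F x) *\<^sub>R V x" for x
      unfolding V_def G'_def using linear_scale[OF linear_A] by blast
    show "has_divergence \<mu> \<iota> 2 (\<lambda>x. A x (G' x)) (\<lambda>x. - sin (F x) * D x)"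
      unfolding has_divergence_def AG'
    proof (intro conjI ballI)
      show "(\<lambda>x. - sin (F x) *\<^sub>R V x) \<in> Lp \<mu> 2"
        by (rule Lp_2_dominated[OF V, where C = 1]) (auto intro: mult_left_le_one_le)
      show "(\<lambda>x. - sin (F x) * D x) \<in> Lp \<mu> 2"
        by (rule Lp_2_dominated[OF D, where C = 1]) (auto simp: abs_mult intro: mult_left_le_one_le)
      fix \<Psi> :: "'w \<Rightarrow> real" assume \<Psi>: "\<Psi> \<in> smooth_functionals"
      obtain B where B: "\<And>x. \<bar>\<Psi> x\<bar> \<le> B" using bounded_smooth_functional[OF \<Psi>] by blast
      obtain C where C: "\<And>x. norm (smooth_gradient \<iota> \<Psi> x) \<le> C" using smooth_gradient_props(3)[OF \<Psi>] by blast
      have B0: "B \<ge> 0" using B[of 0] by linarith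
      have C0: "C \<ge> 0" using C[of 0] norm_ge_zero order_trans by blast
      note [measurable] = smooth_functional_measurable[OF \<Psi>] smooth_gradient_props(2)[OF \<Psi>]
      \<comment> \<open>The sine, written as a cosine so that it is visibly a smooth functional.\<close>
      define S where "S n x = cos (\<Phi> n x + (- (pi / 2)))" for n x
      have S_sin: "S n x = sin (\<Phi> n x)" for n x unfolding S_def cos_add cos_minus sin_minus by simp
      have ss: "(\<lambda>x. \<Phi> n x + (- (pi / 2))) \<in> smooth_functionals" for n
        by (intro smooth_functionals_add s smooth_functionals_const)
      have S: "S n \<in> smooth_functionals" for n
        unfolding S_def by (rule smooth_functionals_cos[OF ss])
      have gS: "smooth_gradient \<iota> (S n) x = cos (\<Phi> n x) *\<^sub>R smooth_gradient \<iota> (\<Phi> n) x" for n x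
      proof -
        have "sin (\<Phi> n x + (- (pi / 2))) = - cos (\<Phi> n x)"
          unfolding sin_add cos_minus sin_minus by simp
        then show ?thesis
          unfolding S_def smooth_gradient_cos[OF ss] smooth_gradient_add[OF s smooth_functionals_const] smooth_gradient_const
          by (simp only: add_0_right minus_minus)
      qed
      define R where "R n x = (\<Psi> x * cos (\<Phi> n x)) *\<^sub>R (smooth_gradient \<iota> (\<Phi> n) x - G x)" for n x
      have [measurable]: "R n \<in> borel_measurable \<mu>" for n
        unfolding R_def by measurable
      have R: "R n \<in> Lp \<mu> 2" for n
      proof -
        have "(\<lambda>x. - G x) \<in> Lp \<mu> 2" using G by (simp add: Lp_def Lp_power_def)
        then have "(\<lambda>x. smooth_gradient \<iota> (\<Phi> n) x - G x) \<in> Lp \<mu> 2"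
          using Lp_2_add[OF smooth_gradient_Lp[OF s[of n]], of "\<lambda>x. - G x"] by simp
        then show ?thesis
          by (rule Lp_2_dominated[where C = B])
            (auto simp: R_def abs_mult intro!: mult_right_mono order_trans[OF mult_right_le_one_le B])
      qed
      have R0: "(\<lambda>n. Lp_power \<mu> 2 (R n)) \<longlonglongrightarrow> 0"
        unfolding R_def
        by (rule L2_null_mono[OF l(2), where C = B])
          (auto simp: abs_mult intro!: mult_right_mono order_trans[OF mult_right_le_one_le B])
      have sg: "(\<lambda>x. sin (g x) *\<^sub>R smooth_gradient \<iota> \<Psi> x) \<in> Lp \<mu> 2" if [measurable]: "g \<in> borel_measurable \<mu>" for g
        by (rule Lp_2_bounded[where B = C]) (auto intro!: order_trans[OF mult_left_le_one_le C])
      have sf: "(\<lambda>x. sin (g x) * \<Psi> x) \<in> Lp \<mu> 2" if [measurable]: "g \<in> borel_measurable \<mu>" for g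
        by (rule Lp_2_bounded[where B = B]) (auto simp: abs_mult intro!: order_trans[OF mult_left_le_one_le B])
      have id: "(\<integral>x. inner (V x) (sin (\<Phi> n x) *\<^sub>R smooth_gradient \<iota> \<Psi> x) \<partial>\<mu>) + (\<integral>x. inner (V x) (R n x) \<partial>\<mu>)
          = (\<integral>x. inner (D x) (sin (\<Phi> n x) * \<Psi> x) \<partial>\<mu>)" for n
      proof -
        have "(\<integral>x. inner (V x) (sin (\<Phi> n x) *\<^sub>R smooth_gradient \<iota> \<Psi> x) \<partial>\<mu>) + (\<integral>x. inner (V x) (R n x) \<partial>\<mu>)
            = (\<integral>x. inner (V x) (sin (\<Phi> n x) *\<^sub>R smooth_gradient \<iota> \<Psi> x) + inner (V x) (R n x) \<partial>\<mu>)"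
          by (rule Bochner_Integration.integral_add[symmetric, OF L2_Cauchy_Schwarz(1)[OF V sg] L2_Cauchy_Schwarz(1)[OF V R]]) measurable
        also have "\<dots> = (\<integral>x. inner (V x) (smooth_gradient \<iota> (\<lambda>x. S n x * \<Psi> x) x) \<partial>\<mu>)"
          unfolding smooth_gradient_mult[OF S \<Psi>] gS unfolding S_sin R_def
          by (simp add: inner_add_right inner_diff_right VG)
        also have "\<dots> = (\<integral>x. (S n x * \<Psi> x) * D x \<partial>\<mu>)"
          by (rule dual) (intro smooth_functionals_mult S \<Psi>)
        finally show ?thesis by (simp add: S_sin mult.commute)
      qed
      have "(\<lambda>n. (\<integral>x. inner (V x) (sin (\<Phi> n x) *\<^sub>R smooth_gradient \<iota> \<Psi> x) \<partial>\<mu>) + (\<integral>x. inner (V x) (R n x) \<partial>\<mu>))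
          \<longlonglongrightarrow> (\<integral>x. inner (V x) (sin (F x) *\<^sub>R smooth_gradient \<iota> \<Psi> x) \<partial>\<mu>) + 0"
      proof (intro tendsto_add L2_tendsto_integral_inner L2_null_integral_inner V R R0 sg)
        have "norm (sin (\<Phi> n x) *\<^sub>R smooth_gradient \<iota> \<Psi> x - sin (F x) *\<^sub>R smooth_gradient \<iota> \<Psi> x) \<le> C * norm (\<Phi> n x - F x)" for n x
          unfolding scaleR_left_diff_distrib[symmetric] norm_scaleR mult.commute[of C]
          by (intro mult_mono C) (auto simp: abs_sin_diff_le)
        then show "(\<lambda>n. Lp_power \<mu> 2 (\<lambda>x. sin (\<Phi> n x) *\<^sub>R smooth_gradient \<iota> \<Psi> x - sin (F x) *\<^sub>R smooth_gradient \<iota> \<Psi> x)) \<longlonglongrightarrow> 0"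
          by (rule L2_null_mono[OF l(1)]) measurable
      qed measurable
      moreover have "(\<lambda>n. (\<integral>x. inner (D x) (sin (\<Phi> n x) * \<Psi> x) \<partial>\<mu>)) \<longlonglongrightarrow> (\<integral>x. inner (D x) (sin (F x) * \<Psi> x) \<partial>\<mu>)"
      proof (intro L2_tendsto_integral_inner D sf)
        have "norm (sin (\<Phi> n x) * \<Psi> x - sin (F x) * \<Psi> x) \<le> B * norm (\<Phi> n x - F x)" for n x
          unfolding left_diff_distrib[symmetric] norm_mult mult.commute[of B]
          by (intro mult_mono) (auto simp: abs_sin_diff_le B)
        then show "(\<lambda>n. Lp_power \<mu> 2 (\<lambda>x. sin (\<Phi> n x) * \<Psi> x - sin (F x) * \<Psi> x)) \<longlonglongrightarrow> 0"
          by (rule L2_null_mono[OF l(1)]) measurable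
      qed measurable
      ultimately have "(\<integral>x. inner (V x) (sin (F x) *\<^sub>R smooth_gradient \<iota> \<Psi> x) \<partial>\<mu>) = (\<integral>x. inner (D x) (sin (F x) * \<Psi> x) \<partial>\<mu>)"
        unfolding id using LIMSEQ_unique by fastforce
      then show "(\<integral>x. inner (- sin (F x) *\<^sub>R V x) (smooth_gradient \<iota> \<Psi> x) \<partial>\<mu>) = (\<integral>x. \<Psi> x * (- sin (F x) * D x) \<partial>\<mu>)"
        by (simp add: mult_ac)
    qed
  qed
qed

end

section \<open>Solutions of the equation\<close>

context skew_wiener begin

definition flow_solution :: "(real \<Rightarrow> 'w \<Rightarrow> real) \<Rightarrow> bool" where
  "flow_solution g \<longleftrightarrow> (\<forall>t. \<exists>D. has_generator (g t) D \<and>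
     ((\<lambda>s. Lp_power \<mu> 2 (\<lambda>x. (g (t + s) x - g t x) / s - D x)) \<longlongrightarrow> 0) (at 0))"

lemma solves_iff: "solves \<mu> \<iota> A g g0 \<longleftrightarrow> (AE x in \<mu>. g 0 x = g0 x) \<and> flow_solution g"
  unfolding solves_def flow_solution_def has_generator_def by blast

lemma flow_solutionE:
  assumes "flow_solution g"
  obtains D where "has_generator (g t) D"
    "((\<lambda>s. Lp_power \<mu> 2 (\<lambda>x. (g (t + s) x - g t x) / s - D x)) \<longlongrightarrow> 0) (at 0)"
  using assms unfolding flow_solution_def by blast

lemma flow_solution_Lp: "flow_solution g \<Longrightarrow> g t \<in> Lp \<mu> 2"
  by (meson flow_solutionE has_generatorD(1))

lemma flow_solution_measurable: "flow_solution g \<Longrightarrow> g t \<in> borel_measurable \<mu>"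
  by (rule Lp_2D(1)[OF flow_solution_Lp])

lemma flow_solution_const: "flow_solution (\<lambda>t x. c)"
  unfolding flow_solution_def
  by (intro allI exI[of _ "\<lambda>_. 0"] conjI has_generator_const) (simp add: Lp_power_def)

lemma flow_solution_shift:
  assumes "flow_solution g"
  shows "flow_solution (\<lambda>t. g (t + \<tau>))"
  unfolding flow_solution_def
proof
  fix t
  show "\<exists>D. has_generator (g (t + \<tau>)) D \<and>
     ((\<lambda>s. Lp_power \<mu> 2 (\<lambda>x. (g (t + s + \<tau>) x - g (t + \<tau>) x) / s - D x)) \<longlongrightarrow> 0) (at 0)"
    using assms[unfolded flow_solution_def, rule_format, of "t + \<tau>"] by (simp add: add_ac)
qed

lemma flow_solution_add_scaled:
  assumes g: "flow_solution g" and h: "flow_solution h"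
  shows "flow_solution (\<lambda>t x. g t x + c * h t x)"
  unfolding flow_solution_def
proof
  fix t
  note [measurable] = flow_solution_measurable[OF g] flow_solution_measurable[OF h]
  obtain D where D: "has_generator (g t) D"
    "((\<lambda>s. Lp_power \<mu> 2 (\<lambda>x. (g (t + s) x - g t x) / s - D x)) \<longlongrightarrow> 0) (at 0)"
    using g by (rule flow_solutionE)
  obtain E where E: "has_generator (h t) E"
    "((\<lambda>s. Lp_power \<mu> 2 (\<lambda>x. (h (t + s) x - h t x) / s - E x)) \<longlongrightarrow> 0) (at 0)"
    using h by (rule flow_solutionE)
  note [measurable] = Lp_2D(1)[OF has_generatorD(2)[OF D(1)]] Lp_2D(1)[OF has_generatorD(2)[OF E(1)]]
  have "((\<lambda>s. Lp_power \<mu> 2 (\<lambda>x. c * ((h (t + s) x - h t x) / s - E x))) \<longlongrightarrow> 0) (at 0)"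
    by (rule L2_null_mono[OF E(2), where C = "\<bar>c\<bar>"]) (auto simp: abs_mult)
  then have "((\<lambda>s. Lp_power \<mu> 2 (\<lambda>x. ((g (t + s) x - g t x) / s - D x) + c * ((h (t + s) x - h t x) / s - E x))) \<longlongrightarrow> 0) (at 0)"
    by (intro L2_null_add D(2)) measurable
  moreover have "((g (t + s) x - g t x) / s - D x) + c * ((h (t + s) x - h t x) / s - E x)
      = ((g (t + s) x + c * h (t + s) x) - (g t x + c * h t x)) / s - (D x + c * E x)" for s x
    by (simp add: diff_divide_distrib add_divide_distrib algebra_simps)
  ultimately show "\<exists>D. has_generator (\<lambda>x. g t x + c * h t x) D \<and>
     ((\<lambda>s. Lp_power \<mu> 2 (\<lambda>x. ((g (t + s) x + c * h (t + s) x) - (g t x + c * h t x)) / s - D x)) \<longlongrightarrow> 0) (at 0)"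
    using has_generator_add_scaled[OF D(1) E(1), of c] by auto
qed

text \<open>
  The chain rule in mean square.  The difference quotient of \<open>cos \<circ> g\<close> is compared with that of \<open>cos (g t + s D)\<close>:
  their difference \<open>P\<close> is bounded by the error of the difference quotient of \<open>g\<close>, since the cosine is
  1-Lipschitz, while the error \<open>Q\<close> of the latter tends to \<open>0\<close> pointwise and is dominated by \<open>2 \<bar>D\<bar>\<close>.
\<close>
lemma flow_solution_cos:
  assumes g: "flow_solution g"
  shows "flow_solution (\<lambda>t x. cos (g t x))"
  unfolding flow_solution_def
proof
  fix t
  note [measurable] = flow_solution_measurable[OF g]
  obtain D where gen: "has_generator (g t) D"
    and lim: "((\<lambda>s. Lp_power \<mu> 2 (\<lambda>x. (g (t + s) x - g t x) / s - D x)) \<longlongrightarrow> 0) (at 0)"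
    using g by (rule flow_solutionE)
  note D = has_generatorD(2)[OF gen]
  note [measurable] = Lp_2D(1)[OF D]
  define P where "P s x = (cos (g (t + s) x) - cos (g t x + s * D x)) / s" for s x
  define Q where "Q s x = (cos (g t x + s * D x) - cos (g t x)) / s + sin (g t x) * D x" for s x
  have [measurable]: "P s \<in> borel_measurable \<mu>" "Q s \<in> borel_measurable \<mu>" for s
    unfolding P_def Q_def by measurable
  have P: "((\<lambda>s. Lp_power \<mu> 2 (P s)) \<longlongrightarrow> 0) (at 0)"
  proof (rule L2_null_mono[OF lim, where C = 1])
    fix s x
    show "norm (P s x) \<le> 1 * norm ((g (t + s) x - g t x) / s - D x)"
    proof (cases "s = 0")
      case False
      have "norm (P s x) \<le> \<bar>g (t + s) x - (g t x + s * D x)\<bar> / \<bar>s\<bar>"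
        unfolding P_def real_norm_def abs_divide by (intro divide_right_mono abs_cos_diff_le) simp
      also have "\<dots> = \<bar>(g (t + s) x - (g t x + s * D x)) / s\<bar>"
        by (simp add: abs_divide)
      also have "(g (t + s) x - (g t x + s * D x)) / s = (g (t + s) x - g t x) / s - D x"
        using False by (simp add: field_simps)
      finally show ?thesis by simp
    qed (simp add: P_def)
  qed measurable
  have Q: "((\<lambda>s. Lp_power \<mu> 2 (Q s)) \<longlongrightarrow> 0) (at 0)"
    unfolding tendsto_at_iff_sequentially o_def
  proof (intro allI impI)
    fix X :: "nat \<Rightarrow> real" assume X: "\<forall>i. X i \<in> UNIV - {0}" "X \<longlonglongrightarrow> 0"
    show "(\<lambda>i. Lp_power \<mu> 2 (Q (X i))) \<longlonglongrightarrow> 0"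
    proof (rule L2_null_dominated[OF D, where C = 2])
      fix i x
      have "\<bar>(cos (g t x + X i * D x) - cos (g t x)) / X i\<bar> \<le> \<bar>X i * D x\<bar> / \<bar>X i\<bar>"
        unfolding abs_divide using abs_cos_diff_le[of "g t x + X i * D x" "g t x"]
        by (intro divide_right_mono) auto
      also have "\<dots> = \<bar>D x\<bar>" using X(1) by (simp add: abs_mult)
      finally have "\<bar>(cos (g t x + X i * D x) - cos (g t x)) / X i\<bar> \<le> \<bar>D x\<bar>" .
      moreover have "\<bar>sin (g t x) * D x\<bar> \<le> \<bar>D x\<bar>"
        by (simp add: abs_mult mult_left_le_one_le)
      ultimately show "norm (Q (X i) x) \<le> 2 * norm (D x)"
        unfolding Q_def real_norm_def by linarith
    next
      show "AE x in \<mu>. (\<lambda>i. Q (X i) x) \<longlonglongrightarrow> 0"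
      proof (intro AE_I2)
        fix x
        have "((\<lambda>s. cos (g t x + s * D x)) has_real_derivative - sin (g t x) * D x) (at 0)"
          by (auto intro!: derivative_eq_intros)
        then have "((\<lambda>s. (cos (g t x + s * D x) - cos (g t x)) / s) \<longlongrightarrow> - sin (g t x) * D x) (at 0)"
          by (simp add: DERIV_def)
        then have "(\<lambda>i. (cos (g t x + X i * D x) - cos (g t x)) / X i) \<longlonglongrightarrow> - sin (g t x) * D x"
          using X unfolding tendsto_at_iff_sequentially o_def by blast
        from tendsto_add[OF this tendsto_const[of "sin (g t x) * D x"]]
        show "(\<lambda>i. Q (X i) x) \<longlonglongrightarrow> 0" by (simp add: Q_def)
      qed
    qed measurable
  qed
  have "((\<lambda>s. Lp_power \<mu> 2 (\<lambda>x. P s x + Q s x)) \<longlongrightarrow> 0) (at 0)"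
    by (intro L2_null_add P Q) measurable
  moreover have "P s x + Q s x = (cos (g (t + s) x) - cos (g t x)) / s - (- sin (g t x) * D x)" for s x
    by (simp add: P_def Q_def diff_divide_distrib)
  ultimately show "\<exists>D. has_generator (\<lambda>x. cos (g t x)) D \<and>
     ((\<lambda>s. Lp_power \<mu> 2 (\<lambda>x. (cos (g (t + s) x) - cos (g t x)) / s - D x)) \<longlongrightarrow> 0) (at 0)"
    using has_generator_cos[OF gen] by auto
qed

lemma flow_solution_sin:
  assumes g: "flow_solution g"
  shows "flow_solution (\<lambda>t x. sin (g t x))"
proof -
  have "flow_solution (\<lambda>t x. - (pi / 2) + 1 * g t x)"
    by (rule flow_solution_add_scaled[OF flow_solution_const g])
  from flow_solution_cos[OF this] show ?thesis
    unfolding cos_add cos_minus sin_minus by simp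
qed

text \<open>
  The time derivative of the expectation is the expectation of a divergence.
\<close>
lemma flow_solution_expectation:
  assumes g: "flow_solution g"
  shows "(\<integral>x. g t x \<partial>\<mu>) = (\<integral>x. g t' x \<partial>\<mu>)"
proof (rule DERIV_isconst_all[of "\<lambda>t. \<integral>x. g t x \<partial>\<mu>"], intro allI)
  fix t
  obtain D where gen: "has_generator (g t) D"
    and lim: "((\<lambda>s. Lp_power \<mu> 2 (\<lambda>x. (g (t + s) x - g t x) / s - D x)) \<longlongrightarrow> 0) (at 0)"
    using g by (rule flow_solutionE)
  have one: "(\<lambda>_. 1::real) \<in> Lp \<mu> 2" by (rule Lp_2_bounded[where B = 1]) auto
  have int: "integrable \<mu> u" if "u \<in> Lp \<mu> 2" for u :: "'w \<Rightarrow> real"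
    using L2_Cauchy_Schwarz(1)[OF one that] by simp
  have neg: "(\<lambda>x. - u x) \<in> Lp \<mu> 2" if "u \<in> Lp \<mu> 2" for u :: "'w \<Rightarrow> real"
    using that by (simp add: Lp_def Lp_power_def)
  have sub: "(\<lambda>x. u x - v x) \<in> Lp \<mu> 2" if "u \<in> Lp \<mu> 2" "v \<in> Lp \<mu> 2" for u v :: "'w \<Rightarrow> real"
    using Lp_2_add[OF that(1) neg[OF that(2)]] by simp
  have q: "(\<lambda>x. (g (t + s) x - g t x) / s) \<in> Lp \<mu> 2" for s
  proof (rule Lp_2_dominated[where C = "1 / \<bar>s\<bar>"])
    show d: "(\<lambda>x. g (t + s) x - g t x) \<in> Lp \<mu> 2" by (intro sub flow_solution_Lp g)
    note [measurable] = Lp_2D(1)[OF d]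
    show "(\<lambda>x. (g (t + s) x - g t x) / s) \<in> borel_measurable \<mu>" by measurable
  qed simp
  have "((\<lambda>s. \<integral>x. inner 1 ((g (t + s) x - g t x) / s - D x) \<partial>\<mu>) \<longlongrightarrow> 0) (at 0)"
    by (rule L2_null_integral_inner[OF one _ lim]) (intro sub q has_generatorD(2)[OF gen])
  moreover have "(\<integral>x. inner 1 ((g (t + s) x - g t x) / s - D x) \<partial>\<mu>) = ((\<integral>x. g (t + s) x \<partial>\<mu>) - (\<integral>x. g t x \<partial>\<mu>)) / s" for s
    using int[OF q] int[OF has_generatorD(2)[OF gen]] int[OF flow_solution_Lp[OF g]]
    by (simp add: has_generator_integral_zero[OF gen])
  ultimately show "((\<lambda>t. \<integral>x. g t x \<partial>\<mu>) has_real_derivative 0) (at t)"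
    by (simp add: DERIV_def)
qed

end

section \<open>Shift invariance and the stationary process\<close>

locale solution_family = skew_wiener \<mu> \<iota> e A
  for \<mu> :: "'w::{banach,second_countable_topology} measure"
    and \<iota> :: "'h::{real_inner,banach,second_countable_topology} \<Rightarrow> 'w"
    and e :: "nat \<Rightarrow> 'h" and A :: "'w \<Rightarrow> 'h \<Rightarrow> 'h" +
  fixes f :: "nat \<Rightarrow> real \<Rightarrow> 'w \<Rightarrow> real"
  assumes f_solves: "\<And>j. solves \<mu> \<iota> A (f j) (wpairing \<iota> (e j))"
begin

lemma f_flow: "flow_solution (f j)"
  using f_solves[of j] by (simp add: solves_iff)

lemma f_measurable [measurable]: "f j t \<in> borel_measurable \<mu>"
  by (rule flow_solution_measurable[OF f_flow])

lemma f_initial: "AE x in \<mu>. \<forall>j. f j 0 x = blinfun_apply (coord j) x"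
  unfolding AE_all_countable using f_solves by (auto simp: solves_iff wpairing_basis)

lemma flow_solution_sum: "flow_solution (\<lambda>t x. \<Sum>j<n. \<beta> j * f j (t + \<tau> j) x)"
proof (induction n)
  case 0
  then show ?case using flow_solution_const[of 0] by simp
next
  case (Suc n)
  then show ?case
    using flow_solution_add_scaled[OF Suc flow_solution_shift[OF f_flow]] by simp
qed

text \<open>
  Linear combinations of the values of the \<open>f j\<close> at arbitrary times, all shifted by \<open>\<tau>\<close>.  Coefficient lists make
  this family closed under linear combinations and allow induction.
\<close>
definition linear_comb :: "(real \<times> nat \<times> real) list \<Rightarrow> real \<Rightarrow> 'w \<Rightarrow> real" where
  "linear_comb v \<tau> x = (\<Sum>(c, j, s)\<leftarrow>v. c * f j (s + \<tau>) x)"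

lemma flow_solution_linear_comb: "flow_solution (linear_comb v)"
proof (induction v)
  case Nil
  have "linear_comb [] = (\<lambda>_ _. 0)" by (simp add: linear_comb_def fun_eq_iff)
  then show ?case by (simp add: flow_solution_const)
next
  case (Cons a v)
  obtain c j s where a: "a = (c, j, s)" by (cases a)
  have "linear_comb (a # v) = (\<lambda>\<tau> x. linear_comb v \<tau> x + c * f j (\<tau> + s) x)"
    by (simp add: linear_comb_def fun_eq_iff a add_ac)
  then show ?case
    using flow_solution_add_scaled[OF Cons flow_solution_shift[OF f_flow]] by simp
qed

text \<open>
  All values of the family at times shifted by \<open>\<tau>\<close>, as one random element; its law carries all the joint laws.
\<close>
definition trajectory :: "real \<Rightarrow> 'w \<Rightarrow> nat \<times> real \<Rightarrow> real" where
  "trajectory \<tau> x p = f (fst p) (snd p + \<tau>) x"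

abbreviation trajectory_space :: "(nat \<times> real \<Rightarrow> real) measure" where
  "trajectory_space \<equiv> Pi\<^sub>M UNIV (\<lambda>_. borel)"

lemma trajectory_measurable [measurable]: "trajectory \<tau> \<in> measurable \<mu> trajectory_space"
  by (rule measurable_PiM_single') (auto simp: trajectory_def)

text \<open>
  Cosines and sines of linear combinations are solutions, so their expectations are constant in \<open>\<tau>\<close>.  The
  values \<open>f j (s + \<tau>)\<close> themselves are the linear combinations with a single coefficient \<open>1\<close>.
\<close>
lemma trajectory_law: "distr \<mu> trajectory_space (trajectory \<tau>) = distr \<mu> trajectory_space (trajectory 0)"
proof -
  let ?\<Pi> = "Pi\<^sub>M UNIV (\<lambda>_. borel) :: ((real \<times> nat \<times> real) list \<Rightarrow> real) measure"
  have [measurable]: "linear_comb v s \<in> borel_measurable \<mu>" for v s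
    by (rule flow_solution_measurable[OF flow_solution_linear_comb])
  have eq: "distr \<mu> ?\<Pi> (\<lambda>x v. linear_comb v \<tau> x) = distr \<mu> ?\<Pi> (\<lambda>x v. linear_comb v 0 x)"
  proof (rule joint_law_eqI)
    fix u v :: "(real \<times> nat \<times> real) list" and c
    have "linear_comb (u @ map (\<lambda>(d, p). (c * d, p)) v) s x = linear_comb u s x + c * linear_comb v s x" for s x
      by (induction v) (auto simp: linear_comb_def algebra_simps)
    then show "\<exists>w. (\<forall>x. linear_comb w \<tau> x = linear_comb u \<tau> x + c * linear_comb v \<tau> x) \<and>
                   (\<forall>x. linear_comb w 0 x = linear_comb u 0 x + c * linear_comb v 0 x)"
      by blast
    show "(\<integral>x. cos (linear_comb v \<tau> x) \<partial>\<mu>) = (\<integral>x. cos (linear_comb v 0 x) \<partial>\<mu>)"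
      by (rule flow_solution_expectation[OF flow_solution_cos[OF flow_solution_linear_comb]])
    show "(\<integral>x. sin (linear_comb v \<tau> x) \<partial>\<mu>) = (\<integral>x. sin (linear_comb v 0 x) \<partial>\<mu>)"
      by (rule flow_solution_expectation[OF flow_solution_sin[OF flow_solution_linear_comb]])
  qed (auto intro: prob_space_axioms)
  define R where "R \<xi> = (\<lambda>p. \<xi> [(1, p)])" for \<xi> :: "(real \<times> nat \<times> real) list \<Rightarrow> real"
  have [measurable]: "R \<in> measurable ?\<Pi> trajectory_space"
    unfolding R_def by (rule measurable_PiM_single') auto
  have m: "(\<lambda>x v. linear_comb v s x) \<in> measurable \<mu> ?\<Pi>" for s
    by (rule measurable_PiM_single') auto
  have "trajectory s = R \<circ> (\<lambda>x v. linear_comb v s x)" for s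
    by (auto simp: fun_eq_iff trajectory_def R_def linear_comb_def)
  then have "distr \<mu> trajectory_space (trajectory s) = distr (distr \<mu> ?\<Pi> (\<lambda>x v. linear_comb v s x)) trajectory_space R" for s
    by (simp add: distr_distr[OF _ m])
  then show ?thesis by (simp add: eq)
qed

lemma trajectory_functional_law:
  assumes "\<Psi> \<in> measurable trajectory_space N"
  shows "distr \<mu> N (\<lambda>x. \<Psi> (trajectory \<tau> x)) = distr \<mu> N (\<lambda>x. \<Psi> (trajectory 0 x))"
  using distr_distr[OF assms trajectory_measurable[of \<tau>]] distr_distr[OF assms trajectory_measurable[of 0]]
  by (simp add: trajectory_law[of \<tau>] o_def)

lemma trajectory_AE:
  assumes "Measurable.pred trajectory_space P" "AE x in \<mu>. P (trajectory 0 x)"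
  shows "AE x in \<mu>. P (trajectory \<tau> x)"
proof -
  have P: "{\<xi>\<in>space trajectory_space. P \<xi>} \<in> sets trajectory_space"
    using assms(1) by measurable
  have "AE \<xi> in distr \<mu> trajectory_space (trajectory 0). P \<xi>"
    using assms(2) by (simp add: AE_distr_iff[OF trajectory_measurable P])
  then have "AE \<xi> in distr \<mu> trajectory_space (trajectory \<tau>). P \<xi>" by (subst trajectory_law)
  then show ?thesis by (simp add: AE_distr_iff[OF trajectory_measurable P])
qed


definition synthesis :: "(nat \<Rightarrow> real) \<Rightarrow> 'w" where
  "synthesis a = (\<Sum>j. a j *\<^sub>R \<iota> (e j))"

lemma synthesis_measurable [measurable]:
  "(\<lambda>\<xi>. synthesis (\<lambda>j. \<xi> (j, t))) \<in> measurable trajectory_space \<mu>"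
proof -
  have "(\<lambda>\<xi>. synthesis (\<lambda>j. \<xi> (j, t))) \<in> borel_measurable trajectory_space"
    unfolding synthesis_def suminf_eq_lim by measurable
  then show ?thesis by (simp cong: measurable_cong_sets add: sets_borel)
qed

abbreviation T :: "real \<Rightarrow> 'w \<Rightarrow> 'w" where
  "T t x \<equiv> synthesis (\<lambda>j. f j t x)"

lemma T_measurable: "T t \<in> measurable \<mu> \<mu>"
proof -
  have "(\<lambda>x. synthesis (\<lambda>j. trajectory 0 x (j, t))) \<in> measurable \<mu> \<mu>"
    by (rule measurable_compose[OF trajectory_measurable synthesis_measurable])
  then show ?thesis by (simp add: trajectory_def)
qed

lemma initial_series_sums: "AE x in \<mu>. (\<lambda>j. f j 0 x *\<^sub>R \<iota> (e j)) sums x"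
  using f_initial partial_expansion_tendsto
proof eventually_elim
  fix x assume "\<forall>j. f j 0 x = blinfun_apply (coord j) x" "(\<lambda>n. partial_expansion n x) \<longlonglongrightarrow> x"
  then show "(\<lambda>j. f j 0 x *\<^sub>R \<iota> (e j)) sums x"
    by (simp add: sums_def partial_expansion_def)
qed

lemma T_0: "AE x in \<mu>. T 0 x = x"
  using initial_series_sums by eventually_elim (simp add: synthesis_def sums_iff)

lemma series_summable: "AE x in \<mu>. summable (\<lambda>j. f j t x *\<^sub>R \<iota> (e j))"
proof -
  have "AE x in \<mu>. Cauchy (\<lambda>n. \<Sum>j<n. trajectory t x (j, 0) *\<^sub>R \<iota> (e j))"
  proof (rule trajectory_AE)
    show "Measurable.pred trajectory_space (\<lambda>\<xi>. Cauchy (\<lambda>n. \<Sum>j<n. \<xi> (j, 0) *\<^sub>R \<iota> (e j)))"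
      unfolding pred_def by (rule sets_Collect_Cauchy) measurable
    show "AE x in \<mu>. Cauchy (\<lambda>n. \<Sum>j<n. trajectory 0 x (j, 0) *\<^sub>R \<iota> (e j))"
      using initial_series_sums
      by eventually_elim (auto simp: trajectory_def sums_def intro: LIMSEQ_imp_Cauchy)
  qed
  then show ?thesis
    by eventually_elim (simp add: summable_iff_convergent Cauchy_convergent_iff trajectory_def)
qed

lemma T_measure_preserving: "distr \<mu> \<mu> (T t) = \<mu>"
proof -
  have "distr \<mu> \<mu> (T t) = distr \<mu> \<mu> (T 0)"
    using trajectory_functional_law[OF synthesis_measurable[of 0], of t] by (simp add: trajectory_def)
  also have "\<dots> = distr \<mu> \<mu> (\<lambda>x. x)"
    using T_0 by (intro distr_cong_AE T_measurable) auto
  also have "\<dots> = \<mu>" by (rule distr_id)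
  finally show ?thesis .
qed

lemma stationary_T: "stationary_process \<mu> T"
  unfolding stationary_process_def
proof (intro conjI allI impI)
  fix n :: nat and t :: "nat \<Rightarrow> real" and \<phi> :: "nat \<Rightarrow> 'w \<Rightarrow> real" and \<tau> :: real
  assume "\<forall>k<n. \<phi> k \<in> smooth_functionals"
  then have \<phi>: "\<phi> k \<in> borel_measurable \<mu>" if "k < n" for k
    using that by (intro smooth_functional_measurable) auto
  have "(\<lambda>\<xi>. \<lambda>k\<in>{..<n}. \<phi> k (synthesis (\<lambda>j. \<xi> (j, t k)))) \<in> measurable trajectory_space (Pi\<^sub>M {..<n} (\<lambda>_. borel))"
    by (intro measurable_restrict measurable_compose[OF synthesis_measurable] \<phi>) simp
  from trajectory_functional_law[OF this, of \<tau>]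
  show "distr \<mu> (Pi\<^sub>M {..<n} (\<lambda>_. borel)) (\<lambda>x. \<lambda>k\<in>{..<n}. \<phi> k (T (t k) x)) =
        distr \<mu> (Pi\<^sub>M {..<n} (\<lambda>_. borel)) (\<lambda>x. \<lambda>k\<in>{..<n}. \<phi> k (T (t k + \<tau>) x))"
    by (simp add: trajectory_def)
qed (use T_measurable T_measure_preserving T_0 in auto)

text \<open>
  For \<open>t = 0\<close> this is \<open>T\<^sub>0 = id\<close>.  As \<open>T t x\<close> and \<open>f j (s + t) x\<close> are the same functions of the trajectory at
  \<open>t\<close> as \<open>T 0 x\<close> and \<open>f j s x\<close> of the trajectory at \<open>0\<close>, shift invariance gives the general case.
\<close>
lemma f_comp_T: "AE x in \<mu>. f j s (T t x) = f j (s + t) x"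
proof -
  have "AE x in \<mu>. f j s (synthesis (\<lambda>i. trajectory t x (i, 0))) = trajectory t x (j, s)"
  proof (rule trajectory_AE)
    have "(\<lambda>\<xi>. f j s (synthesis (\<lambda>i. \<xi> (i, 0)))) \<in> borel_measurable trajectory_space"
      by (rule measurable_compose[OF synthesis_measurable f_measurable])
    then show "Measurable.pred trajectory_space (\<lambda>\<xi>. f j s (synthesis (\<lambda>i. \<xi> (i, 0))) = \<xi> (j, s))"
      unfolding pred_def by (rule borel_measurable_eq) measurable
    show "AE x in \<mu>. f j s (synthesis (\<lambda>i. trajectory 0 x (i, 0))) = trajectory 0 x (j, s)"
      using T_0 by eventually_elim (simp add: trajectory_def)
  qed
  then show ?thesis by (simp add: trajectory_def)
qed

lemma T_group: "AE x in \<mu>. T s (T t x) = T (s + t) x"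
proof -
  have "AE x in \<mu>. \<forall>j. f j s (T t x) = f j (s + t) x"
    unfolding AE_all_countable by (intro allI f_comp_T)
  then show ?thesis by eventually_elim simp
qed

lemma solves_trigonometric:
  "solves_complex \<mu> \<iota> A
     (\<lambda>t x. exp (\<i> * complex_of_real (\<Sum>j<n. f j (t + \<tau> j) x)))
     (\<lambda>x. exp (\<i> * complex_of_real (\<Sum>j<n. f j (\<tau> j) x)))"
proof -
  have flow: "flow_solution (\<lambda>t x. \<Sum>j<n. f j (t + \<tau> j) x)"
    using flow_solution_sum[where \<beta> = "\<lambda>_. 1"] by simp
  show ?thesis
    unfolding solves_complex_def solves_iff
    using flow_solution_cos[OF flow] flow_solution_sin[OF flow] by (simp add: Re_exp Im_exp)
qed

end

theorem proposition6p8: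
  fixes \<mu> :: "'w::{banach,second_countable_topology} measure"
    and \<iota> :: "'h::{real_inner,banach,second_countable_topology} \<Rightarrow> 'w"
    and A :: "'w \<Rightarrow> 'h \<Rightarrow> 'h"
    and e :: "nat \<Rightarrow> 'h"
    and f :: "nat \<Rightarrow> real \<Rightarrow> 'w \<Rightarrow> real"
    and p :: real
  assumes "abstract_wiener_space \<mu> \<iota>"
    and "p > 1"
    and "random_skew_transformation \<mu> A"
    and "\<And>u. u \<in> sobolev \<mu> \<iota> 2 1 \<Longrightarrow> (\<lambda>\<omega>. A \<omega> (u \<omega>)) \<in> sobolev \<mu> \<iota> 2 1"
    and "smooth_orthonormal_basis \<iota> e"
    and "\<And>j t. f j t \<in> sobolev \<mu> \<iota> p 2"
    and "\<And>j t. \<exists>G. has_gradient \<mu> \<iota> p (f j t) G \<and> (AE \<omega> in \<mu>. G \<omega> \<in> range (dual_embed \<iota>))"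
    and "\<And>j. solves \<mu> \<iota> A (f j) (wpairing \<iota> (e j))"
  defines "T \<equiv> \<lambda>t \<omega>. \<Sum>j. f j t \<omega> *\<^sub>R \<iota> (e j)"
  shows "(\<forall>n (\<beta> :: nat \<Rightarrow> real) \<tau>.
            solves \<mu> \<iota> A (\<lambda>t \<omega>. \<Sum>j<n. \<beta> j * f j (t + \<tau> j) \<omega>) (\<lambda>\<omega>. \<Sum>j<n. \<beta> j * f j (\<tau> j) \<omega>)) \<and>
         (\<forall>n (\<tau> :: nat \<Rightarrow> real).
            solves_complex \<mu> \<iota> A
              (\<lambda>t \<omega>. exp (\<i> * complex_of_real (\<Sum>j<n. f j (t + \<tau> j) \<omega>)))
              (\<lambda>\<omega>. exp (\<i> * complex_of_real (\<Sum>j<n. f j (\<tau> j) \<omega>)))) \<and>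
         ((\<forall>t. AE \<omega> in \<mu>. summable (\<lambda>j. f j t \<omega> *\<^sub>R \<iota> (e j))) \<and> stationary_process \<mu> T) \<and>
         (uniquely_solvable \<mu> \<iota> p A \<longrightarrow>
            (\<forall>s t. AE \<omega> in \<mu>. T s (T t \<omega>) = T (s + t) \<omega>))"
proof -
  interpret abstract_wiener_space \<mu> \<iota> by fact
  interpret solution_family \<mu> \<iota> e A f
    by unfold_locales (fact assms)+
  have T: "T = (\<lambda>t \<omega>. synthesis (\<lambda>j. f j t \<omega>))"
    by (simp add: T_def synthesis_def)
  show ?thesis
    unfolding T
    by (intro conjI allI impI solves_trigonometric series_summable stationary_T T_group)
      (simp add: solves_iff flow_solution_sum)
qed

end
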